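(* Assume the hypotheses [Convexity], [Dynamics], [Running cost], [Terminal cost], [Inner ball] and [Nondegenerate Hamiltonian] stated in the context, that $g$ is locally semiconcave and that $V$ is (real-valued and) continuous. (i) For every $x\in\Sigma_V$ with $\dim\big[\partial^PV(x)\cup\partial^\infty V(x)\big]<d$, there exist a constant $\sigma>0$ and a Lipschitz arc $\bar x:[0,\sigma]\to\mathbb{R}^d$ with $\bar x(0)=x$ and $\bar x(s)\in\Sigma_V\setminus\{x\}$ for all $s\in(0,\sigma]$. (ii) For every $x\in\mathcal S^c\setminus\Sigma_{V,\infty}$, the function $V$ is differentiable along every optimal trajectory starting from $x$ except for the initial and terminal points.
   Context: Setting. $U\subset\mathbb{R}^m$ is nonempty and compact, $\mathcal S\subseteq\mathbb{R}^d$ is nonempty and closed (the target), $\mathcal S^c=\mathbb{R}^d\setminus\mathcal S$, and $f:\mathbb{R}^d\times U\to\mathbb{R}^d$, $r:\mathbb{R}^d\times U\to\mathbb{R}$, $g:\mathbb{R}^d\to\mathbb{R}$ are given. For $x\in\mathbb{R}^d$ and a measurable control $u:[0,\infty)\to U$, $y^{x,u}$ is the Carath\'eodory solution of $y'(s)=f(y(s),u(s))$, $y(0)=x$, and $\tau^{x,u}=\min\{t\ge 0:y^{x,u}(t)\in\mathcal S\}$ ($+\infty$ if $\mathcal S$ is never reached). The value function is $V(x)=\inf_u\big(\int_0^{\tau^{x,u}}r(y^{x,u}(s),u(s))\,ds+g(y^{x,u}(\tau^{x,u}))\big)$, the infimum being over measurable controls with $\tau^{x,u}<\infty$. Here $V$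 is understood to be finite and continuous on $\mathbb{R}^d$. If $u^*$ attains the infimum, $y^{x,u^*}$ on $[0,\tau^{x,u^*}]$ is an optimal trajectory starting from $x$. $H(x,p)=\max_{\omega\in U}\{-p\cdot f(x,\omega)-r(x,\omega)\}$. Hypotheses (with constants $N,L,r_0,\rho_0>0$). [Convexity] For every $x$ the set $\{(v,\lambda)\in\mathbb{R}^d\times\mathbb{R}:\exists\omega\in U,\ v=f(x,\omega),\ \lambda\ge r(x,\omega)\}$ is convex. [Dynamics] $f$ is continuous, $|f|<N$; $D_xf$ exists everywhere and is continuous in $(x,u)$; $|f(y,\omega)-f(x,\omega)|\le L|y-x|$ and $|D_xf(y,\omega)-D_xf(x,\omega)|\le L|y-x|$ for all $x,y\in\mathbb{R}^d$, $\omega\in U$. [Running cost] $r$ is continuous and differentiable in $x$, $D_xr$ is continuous, $|r(y,\omega)-r(x,\omega)|+|D_xr(y,\omega)-D_xr(x,\omega)|\le L|y-x|$ for all $x,y,\omega$, and $r(x,\omega)\ge r_0$ for all $x,\omega$. [Terminal cost] There are a neighborhood $\mathcal N$ of $\partial\mathcal S$ and $0\le G<r_0/N$ with $|g(y)-g(x)|\le G|y-x|$ for $x,y\in\mathcal N$. [Inner ball] For every $x\in\partial\mathcal S$ there is a unit vector $\xi_x$ with $\xi_x\cdot(y-x)\le\frac1{2\rho_0}|y-x|^2$ for all $y\in\overline{\mathcal S^c}$. [Nondegenerate Hamiltonian] For any fixed $x\in\mathbb{R}^d$, if $H(x,p)=0$ for all $p$ in a (nonempty) convex set $C$, then $C$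 is a singleton. Notions. For a set $Q$ and $x\in Q$, $v\in N^P_Q(x)$ iff there is $\sigma\ge0$ with $v\cdot(y-x)\le\sigma|y-x|^2$ for all $y\in Q$. $\mathrm{hypo}(V)=\{(z,\beta)\in\overline{\mathcal S^c}\times\mathbb{R}:\beta\le V(z)\}$. $\partial^PV(x)=\{v:(-v,1)\in N^P_{\mathrm{hypo}(V)}(x,V(x))\}$, $\partial^\infty V(x)=\{v:(-v,0)\in N^P_{\mathrm{hypo}(V)}(x,V(x))\}$ (both convex). The dimension of a union of convex sets is the maximum of the dimensions of their affine hulls. $\Sigma_V=\{x\in\mathcal S^c:V\text{ is not differentiable at }x\}$, $\Sigma_{V,\infty}=\{x\in\mathcal S^c:\partial^\infty V(x)\neq\{0\}\}$. $g$ is locally semiconcave if every point has a ball $B$ and $c>0$ with $(1-\lambda)g(x_0)+\lambda g(x_1)-g((1-\lambda)x_0+\lambda x_1)\le c\lambda(1-\lambda)|x_0-x_1|^2$ for $x_0,x_1\in B$, $\lambda\in[0,1]$. *)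

theory Defs
  imports "HOL-Analysis.Analysis"
begin

text \<open>
  Throughout, \<open>'a\<close> is the state space, \<open>'b\<close> the space containing the control set \<open>U\<close>, and
  \<open>S\<close> the target. The data \<open>f x \<omega>\<close> and \<open>r x \<omega>\<close> are only constrained for \<open>\<omega> \<in> U\<close>; controls and
  trajectories are only constrained on \<open>[0,\<infinity>)\<close>.
\<close>

definition control :: "'b::euclidean_space set \<Rightarrow> (real \<Rightarrow> 'b) \<Rightarrow> bool" where
  "control U u \<longleftrightarrow> u \<in> borel_measurable (lebesgue_on {0..}) \<and> (\<forall>s\<ge>0. u s \<in> U)"

text \<open>
  The Caratheodory solution of \<open>y' = f(y,u)\<close>, \<open>y(0) = x\<close>, as a solution of the integral equation
  with the Lebesgue integral.
\<close>

definition caratheodory_solution ::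
    "('a::euclidean_space \<Rightarrow> 'b \<Rightarrow> 'a) \<Rightarrow> 'a \<Rightarrow> (real \<Rightarrow> 'b) \<Rightarrow> (real \<Rightarrow> 'a) \<Rightarrow> bool" where
  "caratheodory_solution f x u y \<longleftrightarrow>
     (\<forall>t\<ge>0. (\<lambda>s. f (y s) (u s)) absolutely_integrable_on {0..t} \<and>
            y t = x + integral {0..t} (\<lambda>s. f (y s) (u s)))"

definition exit_time :: "'a set \<Rightarrow> (real \<Rightarrow> 'a) \<Rightarrow> ereal" where
  "exit_time S y =
     (if \<exists>t\<ge>0. y t \<in> S then ereal (LEAST t. 0 \<le> t \<and> y t \<in> S) else \<infinity>)"

text \<open>
  For the data considered here the trajectory \<open>y\<close> is determined on \<open>[0,\<infinity>)\<close> by \<open>x\<close> and \<open>u\<close>, so that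
  ranging over pairs \<open>(u, y)\<close> is the same as ranging over controls.
\<close>

definition admissible ::
    "'b::euclidean_space set \<Rightarrow> 'a set \<Rightarrow> ('a::euclidean_space \<Rightarrow> 'b \<Rightarrow> 'a) \<Rightarrow>
     'a \<Rightarrow> (real \<Rightarrow> 'b) \<Rightarrow> (real \<Rightarrow> 'a) \<Rightarrow> bool" where
  "admissible U S f x u y \<longleftrightarrow>
     control U u \<and> caratheodory_solution f x u y \<and> exit_time S y < \<infinity>"

definition cost ::
    "'a set \<Rightarrow> ('a \<Rightarrow> 'b \<Rightarrow> real) \<Rightarrow> ('a \<Rightarrow> real) \<Rightarrow> (real \<Rightarrow> 'b) \<Rightarrow> (real \<Rightarrow> 'a) \<Rightarrow> real" where
  "cost S r g u y =
     (let \<tau> = real_of_ereal (exit_time S y)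
      in integral {0..\<tau>} (\<lambda>s. r (y s) (u s)) + g (y \<tau>))"

definition value_function ::
    "'b::euclidean_space set \<Rightarrow> 'a set \<Rightarrow> ('a::euclidean_space \<Rightarrow> 'b \<Rightarrow> 'a) \<Rightarrow>
     ('a \<Rightarrow> 'b \<Rightarrow> real) \<Rightarrow> ('a \<Rightarrow> real) \<Rightarrow> 'a \<Rightarrow> ereal" where
  "value_function U S f r g x =
     (INF (u, y) \<in> {(u, y). admissible U S f x u y}. ereal (cost S r g u y))"

text \<open>
  The trajectory proper is the restriction of \<open>y\<close> to \<open>[0, \<tau>]\<close>, where \<open>\<tau>\<close> is its exit time.
\<close>

definition optimal_trajectory ::
    "'b::euclidean_space set \<Rightarrow> 'a set \<Rightarrow> ('a::euclidean_space \<Rightarrow> 'b \<Rightarrow> 'a) \<Rightarrow>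
     ('a \<Rightarrow> 'b \<Rightarrow> real) \<Rightarrow> ('a \<Rightarrow> real) \<Rightarrow> 'a \<Rightarrow> (real \<Rightarrow> 'a) \<Rightarrow> bool" where
  "optimal_trajectory U S f r g x y \<longleftrightarrow>
     (\<exists>u. admissible U S f x u y \<and> ereal (cost S r g u y) = value_function U S f r g x)"

text \<open>
  For compact nonempty \<open>U\<close> and continuous data the supremum is a maximum.
\<close>

definition hamiltonian ::
    "'b set \<Rightarrow> ('a::euclidean_space \<Rightarrow> 'b \<Rightarrow> 'a) \<Rightarrow> ('a \<Rightarrow> 'b \<Rightarrow> real) \<Rightarrow> 'a \<Rightarrow> 'a \<Rightarrow> real" where
  "hamiltonian U f r x p = (SUP \<omega>\<in>U. - (p \<bullet> f x \<omega>) - r x \<omega>)"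

definition convexity_hyp ::
    "'b set \<Rightarrow> ('a::euclidean_space \<Rightarrow> 'b \<Rightarrow> 'a) \<Rightarrow> ('a \<Rightarrow> 'b \<Rightarrow> real) \<Rightarrow> bool" where
  "convexity_hyp U f r \<longleftrightarrow>
     (\<forall>x. convex {(v, l). \<exists>\<omega>\<in>U. v = f x \<omega> \<and> r x \<omega> \<le> l})"

definition dynamics_hyp ::
    "'b::euclidean_space set \<Rightarrow> ('a::euclidean_space \<Rightarrow> 'b \<Rightarrow> 'a) \<Rightarrow> real \<Rightarrow> real \<Rightarrow> bool" where
  "dynamics_hyp U f N L \<longleftrightarrow>
     continuous_on (UNIV \<times> U) (\<lambda>(x, \<omega>). f x \<omega>) \<and>
     (\<forall>x. \<forall>\<omega>\<in>U. norm (f x \<omega>) < N) \<and>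
     (\<forall>x y. \<forall>\<omega>\<in>U. norm (f y \<omega> - f x \<omega>) \<le> L * norm (y - x)) \<and>
     (\<exists>Df :: 'a \<Rightarrow> 'b \<Rightarrow> 'a \<Rightarrow>\<^sub>L 'a.
        (\<forall>x. \<forall>\<omega>\<in>U. ((\<lambda>z. f z \<omega>) has_derivative blinfun_apply (Df x \<omega>)) (at x)) \<and>
        continuous_on (UNIV \<times> U) (\<lambda>(x, \<omega>). Df x \<omega>) \<and>
        (\<forall>x y. \<forall>\<omega>\<in>U. norm (Df y \<omega> - Df x \<omega>) \<le> L * norm (y - x)))"

definition running_cost_hyp ::
    "'b::euclidean_space set \<Rightarrow> ('a::euclidean_space \<Rightarrow> 'b \<Rightarrow> real) \<Rightarrow> real \<Rightarrow> real \<Rightarrow> bool" where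
  "running_cost_hyp U r L r0 \<longleftrightarrow>
     continuous_on (UNIV \<times> U) (\<lambda>(x, \<omega>). r x \<omega>) \<and>
     (\<forall>x. \<forall>\<omega>\<in>U. r0 \<le> r x \<omega>) \<and>
     (\<exists>Dr :: 'a \<Rightarrow> 'b \<Rightarrow> 'a \<Rightarrow>\<^sub>L real.
        (\<forall>x. \<forall>\<omega>\<in>U. ((\<lambda>z. r z \<omega>) has_derivative blinfun_apply (Dr x \<omega>)) (at x)) \<and>
        continuous_on (UNIV \<times> U) (\<lambda>(x, \<omega>). Dr x \<omega>) \<and>
        (\<forall>x y. \<forall>\<omega>\<in>U.
           \<bar>r y \<omega> - r x \<omega>\<bar> + norm (Dr y \<omega> - Dr x \<omega>) \<le> L * norm (y - x)))"

definition terminal_cost_hyp ::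
    "'a::euclidean_space set \<Rightarrow> ('a \<Rightarrow> real) \<Rightarrow> real \<Rightarrow> real \<Rightarrow> bool" where
  "terminal_cost_hyp S g N r0 \<longleftrightarrow>
     (\<exists>W G. open W \<and> frontier S \<subseteq> W \<and> 0 \<le> G \<and> G < r0 / N \<and>
            (\<forall>x\<in>W. \<forall>y\<in>W. \<bar>g y - g x\<bar> \<le> G * norm (y - x)))"

definition inner_ball_hyp :: "'a::euclidean_space set \<Rightarrow> real \<Rightarrow> bool" where
  "inner_ball_hyp S \<rho>0 \<longleftrightarrow>
     (\<forall>x\<in>frontier S. \<exists>\<xi>. norm \<xi> = 1 \<and>
        (\<forall>y\<in>closure (- S). \<xi> \<bullet> (y - x) \<le> 1 / (2 * \<rho>0) * (norm (y - x))\<^sup>2))"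

definition nondegenerate_hamiltonian_hyp ::
    "'b set \<Rightarrow> ('a::euclidean_space \<Rightarrow> 'b \<Rightarrow> 'a) \<Rightarrow> ('a \<Rightarrow> 'b \<Rightarrow> real) \<Rightarrow> bool" where
  "nondegenerate_hamiltonian_hyp U f r \<longleftrightarrow>
     (\<forall>x C. convex C \<and> C \<noteq> {} \<and> (\<forall>p\<in>C. hamiltonian U f r x p = 0) \<longrightarrow> is_singleton C)"

definition locally_semiconcave :: "('a::euclidean_space \<Rightarrow> real) \<Rightarrow> bool" where
  "locally_semiconcave g \<longleftrightarrow>
     (\<forall>z. \<exists>\<delta>>0. \<exists>c>0. \<forall>x0\<in>ball z \<delta>. \<forall>x1\<in>ball z \<delta>. \<forall>l\<in>{0..1}.
        (1 - l) * g x0 + l * g x1 - g ((1 - l) *\<^sub>R x0 + l *\<^sub>R x1)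
          \<le> c * l * (1 - l) * (norm (x0 - x1))\<^sup>2)"

definition proximal_normal_cone :: "'a::real_inner set \<Rightarrow> 'a \<Rightarrow> 'a set" where
  "proximal_normal_cone Q x =
     {v. \<exists>\<sigma>\<ge>0. \<forall>y\<in>Q. v \<bullet> (y - x) \<le> \<sigma> * (norm (y - x))\<^sup>2}"

definition hypo :: "'a::euclidean_space set \<Rightarrow> ('a \<Rightarrow> real) \<Rightarrow> ('a \<times> real) set" where
  "hypo S V = {(z, \<beta>). z \<in> closure (- S) \<and> \<beta> \<le> V z}"

definition proximal_superdiff ::
    "'a::euclidean_space set \<Rightarrow> ('a \<Rightarrow> real) \<Rightarrow> 'a \<Rightarrow> 'a set" where
  "proximal_superdiff S V x = {v. (- v, 1) \<in> proximal_normal_cone (hypo S V) (x, V x)}"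

definition horizon_superdiff ::
    "'a::euclidean_space set \<Rightarrow> ('a \<Rightarrow> real) \<Rightarrow> 'a \<Rightarrow> 'a set" where
  "horizon_superdiff S V x = {v. (- v, 0) \<in> proximal_normal_cone (hypo S V) (x, V x)}"

text \<open>
  The dimension of \<open>A \<union> B\<close> for convex \<open>A\<close>, \<open>B\<close>; this is not the dimension of the affine hull of
  the union. Note \<open>aff_dim {} = -1\<close>.
\<close>

definition dim_union :: "'a::euclidean_space set \<Rightarrow> 'a set \<Rightarrow> int" where
  "dim_union A B = max (aff_dim A) (aff_dim B)"

definition singular_set :: "'a::euclidean_space set \<Rightarrow> ('a \<Rightarrow> real) \<Rightarrow> 'a set" where
  "singular_set S V = {x \<in> - S. \<not> V differentiable (at x)}"

definition singular_set_inf :: "'a::euclidean_space set \<Rightarrow> ('a \<Rightarrow> real) \<Rightarrow> 'a set" where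
  "singular_set_inf S V = {x \<in> - S. horizon_superdiff S V x \<noteq> {0}}"

end

theory Submission
  imports Defs "HOL-Complex_Analysis.Great_Picard"
begin

text \<open>
  Let \<open>z\<close> be the end point of an \<open>\<epsilon>\<close>-optimal trajectory from \<open>x\<close>, let \<open>\<xi>\<close> be the inner normal
  of the target and \<open>pg\<close> a supergradient of \<open>g\<close> at \<open>z\<close>. Choose \<open>l\<close> in \<open>[0,1]\<close> such that the
  maximum over the controls of \<open>(1 - l) \<xi> \<bullet> f z w - l (pg \<bullet> f z w + r z w)\<close> is \<open>0\<close>. Pulling
  \<open>(l pg - (1 - l) \<xi>, l)\<close> back along the linearised flow gives a vector \<open>(- p, l)\<close> that is normal
  to the hypograph of \<open>V\<close> at \<open>x\<close> up to an error of order \<open>\<epsilon>\<close>, with constants that are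
  locally uniform in \<open>x\<close>; optimal trajectories are not needed.

  If \<open>V\<close> has a nonzero horizontal normal at \<open>x\<close>, there are points \<open>xn \<longlonglongrightarrow> x\<close> with proximal
  subgradients of norm tending to infinity, so their normals become horizontal; near-optimal
  trajectories from \<open>xn\<close> then converge to a curve from \<open>x\<close> which carries horizontal normals and
  along which \<open>V\<close> decreases. Otherwise \<open>V\<close> is semiconcave near \<open>x\<close>. At a singular point the
  nondegeneracy of the Hamiltonian gives a supergradient \<open>p0\<close> with \<open>H(x, p0) < 0\<close>, and the
  dimension hypothesis puts the superdifferential in a hyperplane, so that the argument of Albano and
  Cannarsa yields an arc with supergradients tending to \<open>p0\<close>; since \<open>H = 0\<close> at gradients, its
  points near \<open>x\<close> are singular.

  For (ii), horizontal normals pull back along optimal trajectories, and a supergradient \<open>p\<close> at a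
  point reached by an optimal trajectory at a positive time satisfies \<open>H \<ge> 0\<close>, which is
  incompatible with two different supergradients.
\<close>

section \<open>Integral inequalities and Caratheodory equations\<close>

text \<open>The core is a comparison with a free stopping time. From \<open>x + h\<close>, keep the
  control and stop at a time s near the original end \<tau>, chosen so that the change of cost due
  to stopping at s makes up for \<open>h\<close> and \<open>a\<close>. If the point reached were in
  the target, it would give a competitor cheaper than \<open>V x + a\<close>; so it lies outside,
  the inner ball condition gives a one-sided inequality there, and this is the normal inequality.
  The time s may precede or follow \<tau>, and the vanishing maximum gives the right sign in both
  cases. \<open>G * N < r0\<close> enters twice: the cost to first order grows strictly with the
  stopping time, so a suitable s exists near \<tau>, and arriving late never beats the first hit.
  All errors are quadratic in \<open>h\<close> and \<open>a\<close>, plus a multiple of \<epsilon>,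
  with constants that do not depend on the trajectory; so \<epsilon> can tend to 0 while the base
  point moves. The multiplier \<open>l\<close> belongs to the end point and is therefore the same
  all along a near-optimal trajectory: this is how a nearly horizontal normal at the start becomes
  one at every later point. \<open>V\<close> need not be Lipschitz, so semiconcavity has to be
  extracted from a lower bound on \<open>l\<close>.\<close>

lemma gronwall:
  fixes a :: "real \<Rightarrow> real"
  assumes cont: "continuous_on {0..T} a" and "0 \<le> L"
    and le: "\<And>t. 0 \<le> t \<Longrightarrow> t \<le> T \<Longrightarrow> a t \<le> c + L * integral {0..t} a"
    and t: "0 \<le> t" "t \<le> T"
  shows "a t \<le> c * exp (L * t)"
proof -
  define A where "A s = integral {0..s} a" for s
  \<comment> \<open>Integrating factor: the hypothesis says exactly that \<open>G\<close> does not
    increase.\<close>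
  define G where "G s = exp (- L * s) * (c + L * A s)" for s
  have der: "(A has_real_derivative a s) (at s within {0..T})" if "s \<in> {0..T}" for s
    unfolding A_def using integral_has_real_derivative[OF cont that] .
  have derA: "(A has_real_derivative a s) (at s)" if "0 < s" "s < T" for s
    using der[of s] that at_within_Icc_at[of 0 s T] by auto
  have contA: "continuous_on {0..T} A"
    unfolding continuous_on_eq_continuous_within using der DERIV_continuous by blast
  have "G t \<le> G 0"
  proof (rule DERIV_nonpos_imp_decreasing_open[of 0 t G])
    show "continuous_on {0..t} G"
      unfolding G_def
      by (intro continuous_intros continuous_on_subset[OF contA]) (use t in auto)
    fix s assume s: "0 < s" "s < t"
    have "(G has_real_derivative exp (- L * s) * (L * a s) + (- L * exp (- L * s)) * (c + L * A s)) (at s)"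
      unfolding G_def
      by (rule derivative_eq_intros derA refl | use s t in simp)+
    moreover have "exp (- L * s) * (L * a s) + (- L * exp (- L * s)) * (c + L * A s) \<le> 0"
    proof -
      have "L * a s \<le> L * (c + L * A s)"
        using le[of s] s t \<open>0 \<le> L\<close> by (intro mult_left_mono) (auto simp: A_def)
      then have "exp (- L * s) * (L * a s) \<le> exp (- L * s) * (L * (c + L * A s))"
        by (rule mult_left_mono) simp
      then show ?thesis by (simp add: algebra_simps)
    qed
    ultimately show "\<exists>y. (G has_real_derivative y) (at s) \<and> y \<le> 0" by blast
  qed (use t in auto)
  then have "exp (- L * t) * (c + L * A t) \<le> c" by (simp add: G_def A_def)
  then have "exp (L * t) * (exp (- L * t) * (c + L * A t)) \<le> exp (L * t) * c"
    by (intro mult_left_mono) auto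
  moreover have "exp (L * t) * (exp (- L * t) * (c + L * A t)) = c + L * A t"
    by (simp add: mult.assoc[symmetric] mult_exp_exp)
  ultimately have "c + L * A t \<le> exp (L * t) * c" by (simp only:)
  then show ?thesis using le[OF t] by (simp add: A_def mult.commute)
qed

text \<open>Bounds a state by a later one. In \<open>flow_linearization\<close> it shows that the
  linearised flow cannot shrink vectors too much.\<close>

lemma gronwall_backward:
  fixes a :: "real \<Rightarrow> real"
  assumes cont: "continuous_on {0..T} a" and "0 \<le> L" "0 \<le> T"
    and le: "\<And>s. 0 \<le> s \<Longrightarrow> s \<le> T \<Longrightarrow> a s \<le> c + L * integral {s..T} a"
  shows "a 0 \<le> c * exp (L * T)"
proof -
  define A where "A s = integral {0..s} a" for s
  define G where "G s = exp (L * s) * (c + L * (A T - A s))" for s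
  have int: "a integrable_on {0..T}" using cont by (rule integrable_continuous_real)
  have split: "integral {s..T} a = A T - A s" if "0 \<le> s" "s \<le> T" for s
    using Henstock_Kurzweil_Integration.integral_combine[OF that int] by (simp add: A_def)
  have der: "(A has_real_derivative a s) (at s within {0..T})" if "s \<in> {0..T}" for s
    unfolding A_def using integral_has_real_derivative[OF cont that] .
  have derA: "(A has_real_derivative a s) (at s)" if "0 < s" "s < T" for s
    using der[of s] that at_within_Icc_at[of 0 s T] by auto
  have contA: "continuous_on {0..T} A"
    unfolding continuous_on_eq_continuous_within using der DERIV_continuous by blast
  have "G 0 \<le> G T"
  proof (rule DERIV_nonneg_imp_increasing_open[of 0 T G])
    show "continuous_on {0..T} G"
      unfolding G_def by (intro continuous_intros contA)
    fix s assume s: "0 < s" "s < T"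
    have "(G has_real_derivative exp (L * s) * (L * (- a s)) + (L * exp (L * s)) * (c + L * (A T - A s))) (at s)"
      unfolding G_def using derA[OF s] by (auto intro!: derivative_eq_intros)
    moreover have "exp (L * s) * (L * (- a s)) + (L * exp (L * s)) * (c + L * (A T - A s)) \<ge> 0"
    proof -
      have "L * a s \<le> L * (c + L * (A T - A s))"
        using le[of s] s \<open>0 \<le> L\<close> split[of s] by (intro mult_left_mono) auto
      then have "exp (L * s) * (L * a s) \<le> exp (L * s) * (L * (c + L * (A T - A s)))"
        by (rule mult_left_mono) simp
      then show ?thesis by (simp add: algebra_simps)
    qed
    ultimately show "\<exists>y. (G has_real_derivative y) (at s) \<and> y \<ge> 0" by blast
  qed (use assms in auto)
  then have "c + L * A T \<le> exp (L * T) * c" by (simp add: G_def A_def)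
  moreover have "integral {0..T} a = A T" by (simp add: A_def)
  ultimately show ?thesis using le[of 0] \<open>0 \<le> T\<close> by (simp add: mult.commute)
qed

lemma norm_integral_le_const:
  fixes \<phi> :: "real \<Rightarrow> 'e::euclidean_space"
  assumes "\<phi> integrable_on {s..t}" "s \<le> t" "\<And>x. x \<in> {s..t} \<Longrightarrow> norm (\<phi> x) \<le> B"
  shows "norm (integral {s..t} \<phi>) \<le> B * (t - s)"
proof -
  have "norm (integral {s..t} \<phi>) \<le> integral {s..t} (\<lambda>_. B)"
    by (rule integral_norm_bound_integral) (use assms in auto)
  then show ?thesis using assms(2) by (simp add: mult.commute)
qed

lemma norm_integral_increment_le:
  fixes \<phi> :: "real \<Rightarrow> 'e::euclidean_space"
  assumes int: "\<And>t. 0 \<le> t \<Longrightarrow> \<phi> integrable_on {0..t}" and "0 \<le> s" "0 \<le> t"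
    and B: "\<And>x. min s t \<le> x \<Longrightarrow> x \<le> max s t \<Longrightarrow> norm (\<phi> x) \<le> B"
  shows "norm (integral {0..t} \<phi> - integral {0..s} \<phi>) \<le> B * \<bar>t - s\<bar>"
proof -
  have *: "norm (integral {0..t} \<phi> - integral {0..s} \<phi>) \<le> B * (t - s)"
    if st: "0 \<le> s" "s \<le> t" and B: "\<And>x. s \<le> x \<Longrightarrow> x \<le> t \<Longrightarrow> norm (\<phi> x) \<le> B" for s t
  proof -
    have "integral {0..t} \<phi> - integral {0..s} \<phi> = integral {s..t} \<phi>"
      using Henstock_Kurzweil_Integration.integral_combine[of 0 s t \<phi>] int[of t] st by (simp add: algebra_simps)
    moreover have "\<phi> integrable_on {s..t}"
      by (rule integrable_on_subinterval[OF int[of t]]) (use st in auto)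
    ultimately show ?thesis using norm_integral_le_const[of \<phi> s t B] st B by auto
  qed
  show ?thesis
  proof (cases "s \<le> t")
    case True then show ?thesis using *[of s t] assms by auto
  next
    case False
    then show ?thesis using *[of t s] assms by (auto simp: norm_minus_commute)
  qed
qed

lemma exp_has_integral:
  fixes k :: real
  assumes "k \<noteq> 0" "0 \<le> t"
  shows "((\<lambda>s. exp (k * s)) has_integral (exp (k * t) - 1) / k) {0..t}"
proof -
  have "((\<lambda>s. exp (k * s)) has_integral exp (k * t) / k - exp (k * 0) / k) {0..t}"
    by (rule fundamental_theorem_of_calculus)
      (use assms in \<open>auto intro!: derivative_eq_intros simp: has_real_derivative_iff_has_vector_derivative[symmetric]\<close>)
  then show ?thesis by (simp add: diff_divide_distrib)
qed

lemma norm_integral_le_exp: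
  fixes \<phi> :: "real \<Rightarrow> 'e::euclidean_space"
  assumes "\<phi> integrable_on {0..t}" "0 \<le> t" "k > 0" "0 \<le> c"
    and "\<And>s. s \<in> {0..t} \<Longrightarrow> norm (\<phi> s) \<le> c * exp (k * s)"
  shows "norm (integral {0..t} \<phi>) \<le> c * exp (k * t) / k"
proof -
  have hi: "((\<lambda>s. c * exp (k * s)) has_integral c * ((exp (k * t) - 1) / k)) {0..t}"
    by (rule has_integral_mult_right[OF exp_has_integral]) (use assms in auto)
  then have "norm (integral {0..t} \<phi>) \<le> c * ((exp (k * t) - 1) / k)"
    using integral_norm_bound_integral[OF assms(1) has_integral_integrable[OF hi] assms(5)]
    unfolding integral_unique[OF hi] by blast
  also have "\<dots> \<le> c * exp (k * t) / k"
    using \<open>k > 0\<close> \<open>0 \<le> c\<close> by (simp add: divide_right_mono right_diff_distrib)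
  finally show ?thesis .
qed

lemma continuous_on_indefinite_integral_halfline:
  fixes \<phi> :: "real \<Rightarrow> 'e::banach"
  assumes "\<And>t. 0 \<le> t \<Longrightarrow> \<phi> integrable_on {0..t}"
  shows "continuous_on {0..} (\<lambda>t. integral {0..t} \<phi>)"
  unfolding continuous_on_eq_continuous_within
proof
  fix t :: real assume t: "t \<in> {0..}"
  have "continuous (at t within {0..t+1}) (\<lambda>t. integral {0..t} \<phi>)"
    using indefinite_integral_continuous_1[OF assms[of "t+1"]] t
    by (auto simp: continuous_on_eq_continuous_within)
  moreover have "at t within {0..t+1} = at t within {0..}"
    by (rule at_within_nhd[of t "{..<t+1}"]) auto
  ultimately show "continuous (at t within {0..}) (\<lambda>t. integral {0..t} \<phi>)" by simp
qed

text \<open>Banach's fixed point theorem in the norm \<open>sup\<^sub>t exp (- 2 L t) |y t - x0|\<close>, which gives the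
  solution on the whole half line at once.\<close>

lemma caratheodory_equation_exists:
  fixes F :: "real \<Rightarrow> 'e::euclidean_space \<Rightarrow> 'e"
  assumes int: "\<And>y t. continuous_on {0..} y \<Longrightarrow> 0 \<le> t \<Longrightarrow> (\<lambda>s. F s (y s)) integrable_on {0..t}"
    and lip: "\<And>s a b. 0 \<le> s \<Longrightarrow> norm (F s a - F s b) \<le> L * norm (a - b)"
    and bd: "\<And>s. 0 \<le> s \<Longrightarrow> norm (F s x0) \<le> B" and "L > 0" "B \<ge> 0"
  obtains y where "continuous_on {0..} y"
    "\<And>t. 0 \<le> t \<Longrightarrow> y t = x0 + integral {0..t} (\<lambda>s. F s (y s))"
proof -
  \<comment> \<open>The factor 2 gives the contraction constant
    \<open>L / k = 1 / 2\<close>.\<close>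
  define k where "k = 2 * L"
  have "k > 0" using \<open>L > 0\<close> by (simp add: k_def)
  \<comment> \<open>\<open>z\<close> is the displacement from \<open>x0\<close> divided by the
    weight, so the ordinary sup metric on bounded continuous functions is the weighted one. These
    functions live on the whole line; in \<open>P\<close> the term \<open>max 0 t\<close> freezes
    the negative half line.\<close>
  define Y where "Y z s = x0 + exp (k * s) *\<^sub>R apply_bcontfun z s" for z :: "real \<Rightarrow>\<^sub>C 'e" and s
  define I where "I z t = integral {0..t} (\<lambda>s. F s (Y z s))" for z t
  define P where "P z t = exp (- k * max 0 t) *\<^sub>R I z (max 0 t)" for z t
  have contY: "continuous_on A (Y z)" for A z
    unfolding Y_def by (intro continuous_intros continuous_on_apply_bcontfun)
  have intY: "(\<lambda>s. F s (Y z s)) integrable_on {0..t}" if "0 \<le> t" for z t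
    using int[OF contY that] .
  have contP: "continuous_on UNIV (P z)" for z
  proof -
    have "continuous_on {0..} (I z)"
      unfolding I_def by (rule continuous_on_indefinite_integral_halfline[OF intY])
    moreover have "continuous_on UNIV (\<lambda>t::real. max 0 t)" by (intro continuous_intros)
    ultimately have "continuous_on UNIV (\<lambda>t. I z (max 0 t))"
      by (rule continuous_on_compose2) auto
    moreover have "continuous_on UNIV (\<lambda>t::real. exp (- k * max 0 t))" by (intro continuous_intros)
    ultimately show ?thesis unfolding P_def by (intro continuous_on_scaleR)
  qed
  have Ybd: "norm (F s (Y z s)) \<le> (B + L * norm z) * exp (k * s)" if "0 \<le> s" for s z
  proof -
    have "norm (F s (Y z s)) \<le> norm (F s x0) + norm (F s (Y z s) - F s x0)"
      using norm_triangle_ineq[of "F s x0" "F s (Y z s) - F s x0"] by simp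
    also have "\<dots> \<le> B + L * norm (Y z s - x0)"
      using bd[OF that] lip[OF that, of "Y z s" x0] by simp
    also have "norm (Y z s - x0) = exp (k * s) * norm (apply_bcontfun z s)"
      by (simp add: Y_def)
    also have "B + L * (exp (k * s) * norm (apply_bcontfun z s)) \<le> B * exp (k * s) + L * (exp (k * s) * norm z)"
      using \<open>L > 0\<close> \<open>B \<ge> 0\<close> \<open>k > 0\<close> that
      by (intro add_mono mult_left_mono norm_bounded) (auto simp: mult_le_cancel_left1)
    finally show ?thesis by (simp add: algebra_simps)
  qed
  have bdP: "norm (P z t) \<le> (B + L * norm z) / k" for z t
  proof -
    define \<tau> where "\<tau> = max 0 t"
    have \<tau>0: "0 \<le> \<tau>" unfolding \<tau>_def by (rule max.cobounded1)
    have "norm (I z \<tau>) \<le> (B + L * norm z) * exp (k * \<tau>) / k"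
      unfolding I_def
      by (rule norm_integral_le_exp[OF intY[OF \<tau>0] \<tau>0]) (use \<open>k > 0\<close> \<open>B \<ge> 0\<close> \<open>L > 0\<close> Ybd in \<open>simp_all\<close>)
    then have "exp (- k * \<tau>) * norm (I z \<tau>) \<le> exp (- k * \<tau>) * ((B + L * norm z) * exp (k * \<tau>) / k)"
      by (intro mult_left_mono) auto
    also have "exp (- k * \<tau>) * ((B + L * norm z) * exp (k * \<tau>) / k)
        = (exp (- k * \<tau>) * exp (k * \<tau>)) * ((B + L * norm z) / k)"
      by simp
    also have "exp (- k * \<tau>) * exp (k * \<tau>) = 1" by (simp add: mult_exp_exp)
    finally show ?thesis by (simp add: P_def \<tau>_def[symmetric])
  qed
  have PC: "P z \<in> bcontfun" for z
    using contP bdP by (auto simp: bcontfun_def bounded_iff)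
  define \<Psi> where "\<Psi> z = Bcontfun (P z)" for z
  have app\<Psi>: "apply_bcontfun (\<Psi> z) = P z" for z
    unfolding \<Psi>_def using PC by (simp add: Bcontfun_inverse)
  have contr: "dist (\<Psi> z) (\<Psi> w) \<le> 1 / 2 * dist z w" for z w
  proof (rule dist_bound)
    fix t :: real
    define \<tau> where "\<tau> = max 0 t"
    have "\<tau> \<ge> 0" by (simp add: \<tau>_def)
    have "norm (integral {0..\<tau>} (\<lambda>s. F s (Y z s) - F s (Y w s))) \<le> (L * dist z w) * exp (k * \<tau>) / k"
    proof (rule norm_integral_le_exp)
      fix s assume "s \<in> {0..\<tau>}"
      then have "norm (F s (Y z s) - F s (Y w s)) \<le> L * norm (Y z s - Y w s)" using lip by simp
      also have "norm (Y z s - Y w s) = exp (k * s) * dist (apply_bcontfun z s) (apply_bcontfun w s)"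
        by (simp add: Y_def dist_norm scaleR_diff_right[symmetric])
      also have "L * \<dots> \<le> L * (exp (k * s) * dist z w)"
        using \<open>L > 0\<close> by (intro mult_left_mono dist_bounded) auto
      finally show "norm (F s (Y z s) - F s (Y w s)) \<le> L * dist z w * exp (k * s)" by (simp add: mult_ac)
    qed (use intY \<open>\<tau> \<ge> 0\<close> \<open>k > 0\<close> \<open>L > 0\<close> in \<open>auto intro!: integrable_diff\<close>)
    then have "norm (I z \<tau> - I w \<tau>) \<le> (L * dist z w) * exp (k * \<tau>) / k"
      unfolding I_def using intY \<open>\<tau> \<ge> 0\<close> by (simp add: integral_diff)
    then have "exp (- k * \<tau>) * norm (I z \<tau> - I w \<tau>) \<le> exp (- k * \<tau>) * ((L * dist z w) * exp (k * \<tau>) / k)"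
      by (intro mult_left_mono) auto
    moreover have "exp (- k * \<tau>) * ((L * dist z w) * exp (k * \<tau>) / k) = 1 / 2 * dist z w"
      using \<open>L > 0\<close> by (simp add: k_def exp_minus field_simps)
    ultimately have "exp (- k * \<tau>) * norm (I z \<tau> - I w \<tau>) \<le> 1 / 2 * dist z w" by (simp only:)
    then show "dist (apply_bcontfun (\<Psi> z) t) (apply_bcontfun (\<Psi> w) t) \<le> 1 / 2 * dist z w"
      by (simp add: app\<Psi> P_def \<tau>_def[symmetric] dist_norm scaleR_diff_right[symmetric])
  qed
  have "\<exists>!z\<in>UNIV. \<Psi> z = z"
    by (rule Banach_fix[where c = "1/2"]) (use contr in \<open>auto simp: complete_UNIV\<close>)
  then obtain z where z: "\<Psi> z = z" by blast
  show ?thesis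
  proof
    show "continuous_on {0..} (Y z)" by (rule contY)
    fix t :: real assume "0 \<le> t"
    then have "apply_bcontfun z t = exp (- k * t) *\<^sub>R I z t"
      using app\<Psi>[of z] by (simp add: z P_def)
    then have "exp (k * t) *\<^sub>R apply_bcontfun z t = I z t" by (simp add: exp_minus)
    then show "Y z t = x0 + integral {0..t} (\<lambda>s. F s (Y z s))" unfolding I_def Y_def[of z t] by simp
  qed
qed

section \<open>Supergradients of semiconcave functions\<close>

text \<open>Stands in for dividing by \<theta> and letting \<theta> tend to 0; most first-order
  arguments below end with it.\<close>

lemma le_zero_if_le_small_multiples:
  fixes e K \<theta>0 :: real
  assumes "\<theta>0 > 0" "\<And>\<theta>. 0 < \<theta> \<Longrightarrow> \<theta> < \<theta>0 \<Longrightarrow> e \<le> \<theta> * K"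
  shows "e \<le> 0"
proof (rule tendsto_lowerbound)
  show "((\<lambda>\<theta>. \<theta> * K) \<longlongrightarrow> 0) (at_right 0)"
    by (rule tendsto_mult_left_zero[OF tendsto_ident_at])
  show "\<forall>\<^sub>F \<theta> in at_right 0. e \<le> \<theta> * K"
    by (rule eventually_mono[OF eventually_at_right_real[OF assms(1)]]) (use assms(2) in auto)
qed simp

text \<open>Separates the hypograph from the point \<open>(z, h z)\<close>. The hypograph is taken
  strict so that the point is not in it, and a vertical hyperplane is excluded because
  \<open>z\<close> is the centre of the ball.\<close>

lemma concave_supergradient:
  fixes h :: "'a::euclidean_space \<Rightarrow> real"
  assumes "\<delta> > 0"
    and conc: "\<And>x y l. x \<in> ball z \<delta> \<Longrightarrow> y \<in> ball z \<delta> \<Longrightarrow> 0 \<le> l \<Longrightarrow> l \<le> 1 \<Longrightarrow>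
        (1 - l) * h x + l * h y \<le> h ((1 - l) *\<^sub>R x + l *\<^sub>R y)"
  obtains v where "\<And>y. y \<in> ball z \<delta> \<Longrightarrow> h y \<le> h z + v \<bullet> (y - z)"
proof -
  define A where "A = {(y, b). y \<in> ball z \<delta> \<and> b < h y}"
  have "convex A"
  proof (rule convexI)
    fix p q :: "'a \<times> real" and u v :: real
    assume p: "p \<in> A" and q: "q \<in> A" and uv: "0 \<le> u" "0 \<le> v" "u + v = 1"
    obtain y b y' b' where [simp]: "p = (y, b)" "q = (y', b')" by (cases p, cases q)
    have u: "u = 1 - v" using uv by simp
    have in_ball: "u *\<^sub>R y + v *\<^sub>R y' \<in> ball z \<delta>"
      using p q uv convexD[OF convex_ball, of y z \<delta> y' u v] by (auto simp: A_def)
    have "u * b + v * b' < u * h y + v * h y'"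
    proof (cases "v = 0")
      case True then show ?thesis using p uv by (simp add: A_def)
    next
      case False
      then have "v * b' < v * h y'" using q uv by (simp add: A_def)
      moreover have "u * b \<le> u * h y" using p uv by (simp add: A_def mult_left_mono)
      ultimately show ?thesis by simp
    qed
    also have "\<dots> \<le> h (u *\<^sub>R y + v *\<^sub>R y')"
      using conc[of y y' v] p q uv unfolding u by (auto simp: A_def)
    finally show "u *\<^sub>R p + v *\<^sub>R q \<in> A" using in_ball by (simp add: A_def)
  qed
  moreover have "(z, h z - 1) \<in> A" using \<open>\<delta> > 0\<close> by (simp add: A_def)
  moreover have "A \<inter> {(z, h z)} = {}" by (auto simp: A_def)
  ultimately have "\<exists>a b. a \<noteq> 0 \<and> (\<forall>x\<in>A. a \<bullet> x \<le> b) \<and> (\<forall>x\<in>{(z, h z)}. a \<bullet> x \<ge> b)"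
    by (intro separating_hyperplane_sets convex_singleton) blast+
  then obtain a b where "a \<noteq> 0" and le: "\<And>x. x \<in> A \<Longrightarrow> a \<bullet> x \<le> b" and ge: "a \<bullet> (z, h z) \<ge> b"
    by blast
  obtain a1 a2 where a: "a = (a1, a2)" by (cases a)
  have sep: "a1 \<bullet> (y - z) + a2 * (c - h z) \<le> 0" if "y \<in> ball z \<delta>" "c < h y" for y c
    using le[of "(y, c)"] ge that by (simp add: A_def a inner_diff_right algebra_simps)
  have "a2 \<ge> 0" using sep[of z "h z - 1"] \<open>\<delta> > 0\<close> by simp
  have "a2 \<noteq> 0"
  proof
    assume "a2 = 0"
    then have "a1 \<noteq> 0" using \<open>a \<noteq> 0\<close> a by (auto simp: zero_prod_def)
    define y where "y = z + (\<delta> / 2 / norm a1) *\<^sub>R a1"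
    have "y \<in> ball z \<delta>" using \<open>a1 \<noteq> 0\<close> \<open>\<delta> > 0\<close> by (simp add: y_def dist_norm)
    then have "a1 \<bullet> (y - z) \<le> 0" using sep[of y "h y - 1"] \<open>a2 = 0\<close> by simp
    moreover have "a1 \<bullet> (y - z) > 0" using \<open>a1 \<noteq> 0\<close> \<open>\<delta> > 0\<close> by (simp add: y_def)
    ultimately show False by simp
  qed
  then have "a2 > 0" using \<open>a2 \<ge> 0\<close> by simp
  show ?thesis
  proof
    fix y assume y: "y \<in> ball z \<delta>"
    have "h y \<le> h z - (a1 \<bullet> (y - z)) / a2"
    proof (rule dense_le)
      fix c assume "c < h y"
      from sep[OF y this] show "c \<le> h z - (a1 \<bullet> (y - z)) / a2"
        using \<open>a2 > 0\<close> by (simp add: field_simps)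
    qed
    then show "h y \<le> h z + (- (1 / a2) *\<^sub>R a1) \<bullet> (y - z)" by simp
  qed
qed

text \<open>Domain and constant are explicit: one pair \<open>B\<close>, \<open>C\<close> that works
  at every point of a convex \<open>B\<close> amounts to semiconcavity of \<open>V\<close> on
  \<open>B\<close>, and the same pair has to survive limits and changes of base point.\<close>

definition supergrad_on :: "('a::euclidean_space \<Rightarrow> real) \<Rightarrow> 'a set \<Rightarrow> real \<Rightarrow> 'a \<Rightarrow> 'a \<Rightarrow> bool" where
  "supergrad_on V B C y p \<longleftrightarrow> (\<forall>z\<in>B. V z \<le> V y + p \<bullet> (z - y) + C * (norm (z - y))\<^sup>2)"

lemma supergrad_onD:
  "supergrad_on V B C y p \<Longrightarrow> z \<in> B \<Longrightarrow> V z \<le> V y + p \<bullet> (z - y) + C * (norm (z - y))\<^sup>2"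
  by (simp add: supergrad_on_def)

text \<open>The inequalities based at a point of the segment from \<open>y\<close> to
  \<open>z\<close> give semiconcavity along it with constant \<open>C\<close>. The local constant
  \<open>C'\<close> appears only multiplied by \<theta> and disappears as the point approaches
  \<open>y\<close>. This matters for the arc below, whose local constants \<open>1 / (2 * s)\<close>
  blow up.\<close>

lemma supergrad_on_if_local:
  fixes V :: "'a::euclidean_space \<Rightarrow> real"
  assumes "convex B" "y \<in> B" "\<rho> > 0"
    and semi: "\<And>z. z \<in> B \<Longrightarrow> \<exists>q. supergrad_on V B C z q"
    and loc: "\<And>z. z \<in> B \<Longrightarrow> norm (z - y) < \<rho> \<Longrightarrow> V z \<le> V y + p \<bullet> (z - y) + C' * (norm (z - y))\<^sup>2"
  shows "supergrad_on V B C y p"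
  unfolding supergrad_on_def
proof
  fix z assume z: "z \<in> B"
  define D where "D = norm (z - y)"
  have "D \<ge> 0" by (simp add: D_def)
  have "V z - V y - p \<bullet> (z - y) - C * D\<^sup>2 \<le> 0"
  proof (rule le_zero_if_le_small_multiples)
    show "min 1 (\<rho> / (D + 1)) > 0" using \<open>\<rho> > 0\<close> \<open>D \<ge> 0\<close> by simp
    fix \<theta> :: real assume \<theta>: "0 < \<theta>" "\<theta> < min 1 (\<rho> / (D + 1))"
    define w where "w = (1 - \<theta>) *\<^sub>R y + \<theta> *\<^sub>R z"
    have w: "w \<in> B" unfolding w_def using \<open>convex B\<close> \<open>y \<in> B\<close> z \<theta> by (intro convexD) auto
    have e1: "w - y = \<theta> *\<^sub>R (z - y)" "y - w = (- \<theta>) *\<^sub>R (z - y)" "z - w = (1 - \<theta>) *\<^sub>R (z - y)"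
      by (simp_all add: w_def algebra_simps)
    have "\<theta> * (D + 1) < \<rho>" using \<theta> \<open>D \<ge> 0\<close> by (simp add: less_divide_eq)
    then have "\<theta> * D < \<rho>" using \<theta> by (simp add: distrib_left)
    then have "norm (w - y) < \<rho>" using \<theta> by (simp add: e1(1) D_def)
    then have 1: "V w \<le> V y + \<theta> * (p \<bullet> (z - y)) + C' * (\<theta>\<^sup>2 * D\<^sup>2)"
      using loc[OF w] by (simp add: e1 D_def power_mult_distrib)
    obtain q where q: "supergrad_on V B C w q" using semi[OF w] by blast
    have 2: "V y \<le> V w - \<theta> * (q \<bullet> (z - y)) + C * (\<theta>\<^sup>2 * D\<^sup>2)"
      using supergrad_onD[OF q \<open>y \<in> B\<close>] by (simp add: e1 D_def power_mult_distrib norm_minus_commute)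
    have 3: "V z \<le> V w + (1 - \<theta>) * (q \<bullet> (z - y)) + C * ((1 - \<theta>)\<^sup>2 * D\<^sup>2)"
      using supergrad_onD[OF q z] by (simp add: e1 D_def power_mult_distrib)
    have "(1 - \<theta>) * V y + \<theta> * V z \<le> (1 - \<theta>) * (V w - \<theta> * (q \<bullet> (z - y)) + C * (\<theta>\<^sup>2 * D\<^sup>2))
        + \<theta> * (V w + (1 - \<theta>) * (q \<bullet> (z - y)) + C * ((1 - \<theta>)\<^sup>2 * D\<^sup>2))"
      using 2 3 \<theta> by (intro add_mono mult_left_mono) auto
    also have "\<dots> = V w + C * \<theta> * (1 - \<theta>) * D\<^sup>2"
      by (simp add: algebra_simps power2_eq_square)
    finally have "(1 - \<theta>) * V y + \<theta> * V z \<le> V y + \<theta> * (p \<bullet> (z - y)) + C' * (\<theta>\<^sup>2 * D\<^sup>2) + C * \<theta> * (1 - \<theta>) * D\<^sup>2"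
      using 1 by simp
    then have "\<theta> * (V z - V y - p \<bullet> (z - y) - C * D\<^sup>2) \<le> \<theta> * (\<theta> * ((C' - C) * D\<^sup>2))"
      by (simp add: algebra_simps power2_eq_square)
    then show "V z - V y - p \<bullet> (z - y) - C * D\<^sup>2 \<le> \<theta> * ((C' - C) * D\<^sup>2)"
      using \<theta> by simp
  qed
  then show "V z \<le> V y + p \<bullet> (z - y) + C * (norm (z - y))\<^sup>2" by (simp add: D_def)
qed

lemma supergrad_on_limit:
  fixes V :: "'a::euclidean_space \<Rightarrow> real"
  assumes V: "continuous_on UNIV V" and y: "y \<longlonglongrightarrow> y0" and p: "p \<longlonglongrightarrow> p0"
    and sg: "\<And>n. supergrad_on V B C (y n) (p n)"
  shows "supergrad_on V B C y0 p0"
  unfolding supergrad_on_def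
proof
  fix z assume z: "z \<in> B"
  have Vy: "(\<lambda>n. V (y n)) \<longlonglongrightarrow> V y0"
    using continuous_on_tendsto_compose[OF V y] by simp
  have "(\<lambda>n. V (y n) + p n \<bullet> (z - y n) + C * (norm (z - y n))\<^sup>2) \<longlonglongrightarrow> V y0 + p0 \<bullet> (z - y0) + C * (norm (z - y0))\<^sup>2"
    by (intro tendsto_intros Vy y p)
  then show "V z \<le> V y0 + p0 \<bullet> (z - y0) + C * (norm (z - y0))\<^sup>2"
    by (rule LIMSEQ_le_const) (use supergrad_onD[OF sg z] in auto)
qed

lemma bounded_sequence_convergent_subseq:
  fixes p :: "nat \<Rightarrow> 'a::euclidean_space"
  assumes "\<And>n. norm (p n) \<le> K"
  obtains l k where "strict_mono k" "(p \<circ> k) \<longlonglongrightarrow> l"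
proof -
  have "seq_compact (cball (0::'a) K)" using compact_cball compact_imp_seq_compact by blast
  moreover have "\<forall>n. p n \<in> cball 0 K" using assms by simp
  ultimately obtain l k where "strict_mono k" "(p \<circ> k) \<longlonglongrightarrow> l" unfolding seq_compact_def by blast
  then show ?thesis using that by blast
qed

text \<open>If \<open>p\<close> were the only supergradient at \<open>x\<close>, the bound
  \<open>K\<close> and the closed graph would force the supergradients at nearby points to tend to
  \<open>p\<close>. The inequality based at \<open>x\<close> bounds \<open>V y\<close> from above,
  the one based at \<open>y\<close> bounds it from below, and together they make \<open>p\<close>
  the gradient.\<close>

lemma supergrad_on_two_if_not_differentiable:
  fixes V :: "'a::euclidean_space \<Rightarrow> real"
  assumes V: "continuous_on UNIV V" and "R > 0"
    and semi: "\<And>y. y \<in> cball x R \<Longrightarrow> \<exists>q. norm q \<le> K \<and> supergrad_on V (cball x R) C y q"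
    and nd: "\<not> V differentiable (at x)"
  obtains p1 p2 where "p1 \<noteq> p2" "supergrad_on V (cball x R) C x p1" "supergrad_on V (cball x R) C x p2"
proof (rule ccontr)
  assume "\<not> thesis"
  with that have uniq: "p1 = p2" if "supergrad_on V (cball x R) C x p1" "supergrad_on V (cball x R) C x p2" for p1 p2
    using that by blast
  obtain p where p: "supergrad_on V (cball x R) C x p"
    using semi[of x] \<open>R > 0\<close> by auto
  have close: "\<exists>d>0. \<forall>y q. dist x y < d \<longrightarrow> y \<in> cball x R \<longrightarrow> norm q \<le> K \<longrightarrow> supergrad_on V (cball x R) C y q \<longrightarrow> norm (q - p) < e"
    if "e > 0" for e
  proof (rule ccontr)
    assume *: "\<not> ?thesis"
    have "\<forall>d>0. \<exists>y q. dist x y < d \<and> y \<in> cball x R \<and> norm q \<le> K \<and> supergrad_on V (cball x R) C y q \<and> norm (q - p) \<ge> e"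
      using * by (meson not_less)
    then have "\<exists>y q. dist x y < 1 / Suc n \<and> y \<in> cball x R \<and> norm q \<le> K \<and> supergrad_on V (cball x R) C y q \<and> norm (q - p) \<ge> e" for n :: nat
      by (meson of_nat_0_less_iff zero_less_Suc zero_less_divide_1_iff)
    then obtain y q where yq: "\<And>n. dist x (y n) < 1 / Suc n" "\<And>n. norm (q n) \<le> K"
      "\<And>n. supergrad_on V (cball x R) C (y n) (q n)" "\<And>n. norm (q n - p) \<ge> e"
      by metis
    obtain l k where k: "strict_mono k" and l: "(q \<circ> k) \<longlonglongrightarrow> l"
      using bounded_sequence_convergent_subseq[of q K] yq(2) by blast
    have "(\<lambda>n. dist x (y n)) \<longlonglongrightarrow> 0"
      using LIMSEQ_inverse_real_of_nat yq(1)
      by (intro tendsto_sandwich[OF _ _ tendsto_const LIMSEQ_inverse_real_of_nat])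
        (auto intro!: always_eventually less_imp_le simp: inverse_eq_divide)
    then have "y \<longlonglongrightarrow> x" using tendsto_dist_iff[of y x] by (simp add: dist_commute)
    then have "(y \<circ> k) \<longlonglongrightarrow> x" using k by (rule LIMSEQ_subseq_LIMSEQ)
    then have "supergrad_on V (cball x R) C x l"
      by (rule supergrad_on_limit[OF V _ l]) (simp add: yq(3))
    then have "l = p" using p uniq by blast
    moreover have "norm (l - p) \<ge> e"
      by (rule LIMSEQ_le_const[OF tendsto_norm[OF tendsto_diff[OF l tendsto_const]]]) (use yq(4) in auto)
    ultimately show False using \<open>e > 0\<close> by simp
  qed
  have "(V has_derivative (\<lambda>h. p \<bullet> h)) (at x)"
    unfolding has_derivative_at_alt
  proof (intro conjI allI impI)
    show "bounded_linear (\<lambda>h. p \<bullet> h)" by (rule bounded_linear_inner_right)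
    fix e :: real assume "e > 0"
    obtain d where d: "d > 0" "\<And>y q. dist x y < d \<Longrightarrow> y \<in> cball x R \<Longrightarrow> norm q \<le> K \<Longrightarrow> supergrad_on V (cball x R) C y q \<Longrightarrow> norm (q - p) < e / 2"
      using close[OF half_gt_zero[OF \<open>e > 0\<close>]] by blast
    \<comment> \<open>The last bound keeps the quadratic term below \<open>e / 2\<close> times the
      distance.\<close>
    define d' where "d' = min (min d R) (e / (2 * (\<bar>C\<bar> + 1)))"
    have "d' > 0" using d(1) \<open>R > 0\<close> \<open>e > 0\<close> by (simp add: d'_def)
    have "norm (V y - V x - p \<bullet> (y - x)) \<le> e * norm (y - x)" if y: "norm (y - x) < d'" for y
    proof -
      have yin: "y \<in> cball x R" "dist x y < d"
        using y by (auto simp: d'_def dist_norm norm_minus_commute)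
      have xin: "x \<in> cball x R" using \<open>R > 0\<close> by simp
      define D where "D = norm (y - x)"
      have "D * (2 * (\<bar>C\<bar> + 1)) \<le> e" using y by (simp add: d'_def D_def field_simps)
      then have "\<bar>C\<bar> * D \<le> e / 2" using norm_ge_zero[of "y - x"] by (simp add: algebra_simps D_def[symmetric])
      then have "(\<bar>C\<bar> * D) * D \<le> e / 2 * D" by (intro mult_right_mono) (auto simp: D_def)
      then have CD: "\<bar>C * D\<^sup>2\<bar> \<le> e / 2 * D" by (simp add: abs_mult power2_eq_square mult.assoc)
      obtain q where q: "norm q \<le> K" "supergrad_on V (cball x R) C y q" using semi[OF yin(1)] by blast
      have "norm (q - p) \<le> e / 2" using d(2)[OF yin(2,1) q] by simp
      then have "\<bar>(q - p) \<bullet> (y - x)\<bar> \<le> e / 2 * D"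
        using Cauchy_Schwarz_ineq2[of "q - p" "y - x"] mult_right_mono[of "norm (q - p)" "e/2" D]
        by (simp add: D_def)
      moreover have "V y \<le> V x + p \<bullet> (y - x) + C * D\<^sup>2"
        using supergrad_onD[OF p yin(1)] by (simp add: D_def)
      moreover have "V x \<le> V y - q \<bullet> (y - x) + C * D\<^sup>2"
        using supergrad_onD[OF q(2) xin] by (simp add: D_def inner_diff_right norm_minus_commute)
      ultimately show ?thesis using CD
        unfolding D_def[symmetric] real_norm_def inner_diff_left abs_le_iff by linarith
    qed
    then show "\<exists>d>0. \<forall>y. norm (y - x) < d \<longrightarrow> norm (V y - V x - p \<bullet> (y - x)) \<le> e * norm (y - x)"
      using \<open>d' > 0\<close> by blast
  qed
  then show False using nd by (auto simp: differentiable_def)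
qed

text \<open>The arc follows the maximisers of \<open>V y - p0 \<bullet> (y - x) - |y - x - s q|\<^sup>2 / (2 s)\<close>
  (Albano and Cannarsa). Its supergradients at \<open>arc s\<close> tend to \<open>p0\<close> because \<open>q\<close> is orthogonal
  to the superdifferential at \<open>x\<close>.\<close>

lemma supergradient_arc:
  fixes V :: "'a::euclidean_space \<Rightarrow> real"
  assumes V: "continuous_on UNIV V" and "R > 0" "C \<ge> 0" "q \<noteq> 0"
    and semi: "\<And>y. y \<in> cball x R \<Longrightarrow> \<exists>p. supergrad_on V (cball x R) C y p"
    and p0: "supergrad_on V (cball x R) C x p0"
    and orth: "\<And>p. supergrad_on V (cball x R) C x p \<Longrightarrow> q \<bullet> (p - p0) = 0"
  obtains \<sigma> K :: real and arc P :: "real \<Rightarrow> 'a" where "\<sigma> > 0" "K-lipschitz_on {0..\<sigma>} arc" "arc 0 = x"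
    "\<And>s. s \<in> {0<..\<sigma>} \<Longrightarrow> arc s \<noteq> x \<and> arc s \<in> ball x R \<and> supergrad_on V (cball x R) C (arc s) (P s)"
    "\<And>s. (\<forall>n. s n \<in> {0<..\<sigma>}) \<Longrightarrow> s \<longlonglongrightarrow> 0 \<Longrightarrow> \<exists>k. strict_mono k \<and> (P \<circ> s \<circ> k) \<longlonglongrightarrow> p0"
proof -
  define \<phi> where "\<phi> s y = V y - p0 \<bullet> (y - x) - (norm (y - x - s *\<^sub>R q))\<^sup>2 / (2 * s)" for s y
  have "\<exists>y\<in>cball x R. \<forall>z\<in>cball x R. \<phi> s z \<le> \<phi> s y" if "s > 0" for s
  proof (rule continuous_attains_sup)
    show "continuous_on (cball x R) (\<phi> s)"
      unfolding \<phi>_def using that by (intro continuous_intros continuous_on_subset[OF V]) auto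
  qed (use \<open>R > 0\<close> in auto)
  then obtain m where m: "\<And>s. s > 0 \<Longrightarrow> m s \<in> cball x R"
    and max: "\<And>s z. s > 0 \<Longrightarrow> z \<in> cball x R \<Longrightarrow> \<phi> s z \<le> \<phi> s (m s)"
    by metis
  define arc where "arc s = (if s > 0 then m s else x)" for s
  define D where "D s = (1 / s) *\<^sub>R (arc s - x)" for s
  \<comment> \<open>The gradient at \<open>arc s\<close> of the function that \<phi> subtracts from
    \<open>V\<close>.\<close>
  define P where "P s = p0 + D s - q" for s
  define M where "M = 4 * norm q"
  have "norm q > 0" using \<open>q \<noteq> 0\<close> by simp
  \<comment> \<open>The first bound gives \<open>C * s \<le> 1 / 4\<close>, so that semiconcavity
    errors can be absorbed; the second keeps the maximiser within \<open>R / 2\<close> of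
    \<open>x\<close>.\<close>
  define \<sigma> where "\<sigma> = min (1 / (4 * (C + 1))) (R / (2 * M))"
  have "\<sigma> > 0" using \<open>R > 0\<close> \<open>C \<ge> 0\<close> \<open>norm q > 0\<close> by (simp add: \<sigma>_def M_def)
  have Cs: "C * s \<le> 1 / 4" if "0 < s" "s \<le> \<sigma>" for s
  proof -
    have "s \<le> 1 / (4 * (C + 1))" using that by (simp add: \<sigma>_def)
    then have "s * (4 * (C + 1)) \<le> 1" using \<open>C \<ge> 0\<close> by (simp add: le_divide_eq)
    then show ?thesis using that by (simp add: algebra_simps)
  qed
  have arcD: "arc s - x = s *\<^sub>R D s" if "s > 0" for s
    using that by (simp add: D_def)
  have growth: "norm (arc s - x) \<le> M * s" if s: "0 < s" "s \<le> \<sigma>" for s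
  proof -
    define d where "d = norm (m s - x)"
    have "\<phi> s x \<le> \<phi> s (m s)" using max s \<open>R > 0\<close> by simp
    moreover have "V (m s) \<le> V x + p0 \<bullet> (m s - x) + C * d\<^sup>2"
      using supergrad_onD[OF p0 m] s by (simp add: d_def)
    ultimately have "(norm (m s - x - s *\<^sub>R q))\<^sup>2 / (2 * s) \<le> C * d\<^sup>2 + (norm (s *\<^sub>R q))\<^sup>2 / (2 * s)"
      by (simp add: \<phi>_def)
    then have "(norm (m s - x - s *\<^sub>R q))\<^sup>2 \<le> 2 * s * (C * d\<^sup>2) + (norm (s *\<^sub>R q))\<^sup>2"
      using s by (simp add: field_simps)
    moreover have "(norm (m s - x - s *\<^sub>R q))\<^sup>2 = d\<^sup>2 - 2 * s * ((m s - x) \<bullet> q) + (norm (s *\<^sub>R q))\<^sup>2"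
      unfolding d_def power2_norm_eq_inner
      by (simp add: inner_diff_left inner_diff_right inner_commute algebra_simps)
    ultimately have "d\<^sup>2 \<le> 2 * s * (C * d\<^sup>2) + 2 * s * ((m s - x) \<bullet> q)" by simp
    also have "2 * s * (C * d\<^sup>2) = 2 * (C * s) * d\<^sup>2" by simp
    also have "2 * (C * s) * d\<^sup>2 \<le> 1 / 2 * d\<^sup>2"
      using Cs[OF s] by (intro mult_right_mono) auto
    also have "2 * s * ((m s - x) \<bullet> q) \<le> 2 * s * (d * norm q)"
      using s norm_cauchy_schwarz[of "m s - x" q] by (simp add: d_def)
    also have "2 * s * (d * norm q) = (M * s) * d / 2" by (simp add: M_def)
    finally have "d * d \<le> (M * s) * d" by (simp add: power2_eq_square)
    then have "d \<le> M * s"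
      using s \<open>norm q > 0\<close> by (cases "d = 0") (auto simp: d_def M_def)
    then show ?thesis using s by (simp add: arc_def d_def)
  qed
  have Dbd: "norm (D s) \<le> M" if "0 < s" "s \<le> \<sigma>" for s
    using growth[OF that] that by (simp add: D_def pos_divide_le_eq del: scaleR_diff_right)
  have arc_ball: "arc s \<in> ball x R" if s: "0 < s" "s \<le> \<sigma>" for s
  proof -
    have "M > 0" using \<open>norm q > 0\<close> by (simp add: M_def)
    have "s \<le> R / (2 * M)" using s by (simp add: \<sigma>_def)
    then have "M * s \<le> R / 2" using \<open>M > 0\<close> by (simp add: field_simps)
    then show ?thesis using growth[OF s] \<open>R > 0\<close> by (simp add: dist_norm norm_minus_commute)
  qed
  have sg: "supergrad_on V (cball x R) C (arc s) (P s)" if s: "0 < s" "s \<le> \<sigma>" for s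
  proof (rule supergrad_on_if_local[of _ _ 1])
    show "convex (cball x R)" by simp
    show "arc s \<in> cball x R" using arc_ball[OF s] by simp
    fix z assume z: "z \<in> cball x R"
    show "\<exists>p. supergrad_on V (cball x R) C z p" by (rule semi[OF z])
    define w where "w = arc s - x - s *\<^sub>R q"
    have "\<phi> s z \<le> \<phi> s (arc s)" using max z s by (simp add: arc_def)
    moreover have "z - x - s *\<^sub>R q = w + (z - arc s)" by (simp add: w_def)
    ultimately have "V z - p0 \<bullet> (z - x) - (norm (w + (z - arc s)))\<^sup>2 / (2 * s) \<le> V (arc s) - p0 \<bullet> (arc s - x) - (norm w)\<^sup>2 / (2 * s)"
      by (simp add: \<phi>_def w_def)
    moreover have "(norm (w + (z - arc s)))\<^sup>2 = (norm w)\<^sup>2 + 2 * (w \<bullet> (z - arc s)) + (norm (z - arc s))\<^sup>2"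
      unfolding power2_norm_eq_inner by (simp add: inner_add_left inner_add_right inner_commute algebra_simps)
    ultimately have "V z \<le> V (arc s) + p0 \<bullet> (z - arc s) + (w \<bullet> (z - arc s)) / s + (norm (z - arc s))\<^sup>2 / (2 * s)"
      using s by (simp add: inner_diff_right[of p0] add_divide_distrib)
    moreover have "P s = p0 + (1 / s) *\<^sub>R w"
      using s by (simp add: P_def D_def w_def scaleR_diff_right)
    ultimately show "V z \<le> V (arc s) + P s \<bullet> (z - arc s) + 1 / (2 * s) * (norm (z - arc s))\<^sup>2"
      by (simp add: inner_add_left)
  qed simp
  \<comment> \<open>One-sided monotonicity of supergradients, the sum of the two inequalities. It
    gives both the Lipschitz bound and the limit of \<open>P\<close>.\<close>
  have mono: "(p - p') \<bullet> (y - y') \<le> 2 * C * (norm (y - y'))\<^sup>2"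
    if "supergrad_on V (cball x R) C y p" "supergrad_on V (cball x R) C y' p'" "y \<in> cball x R" "y' \<in> cball x R" for p p' y y'
    using supergrad_onD[OF that(1,4)] supergrad_onD[OF that(2,3)]
    by (simp add: inner_diff_left inner_diff_right norm_minus_commute)
  \<comment> \<open>Otherwise \<open>p0 - q\<close> would be a supergradient at \<open>x\<close>,
    off the hyperplane through \<open>p0\<close> orthogonal to \<open>q\<close>.\<close>
  have arc_ne: "arc s \<noteq> x" if s: "0 < s" "s \<le> \<sigma>" for s
  proof
    assume "arc s = x"
    then have "supergrad_on V (cball x R) C x (p0 - q)"
      using sg[OF s] by (simp add: P_def D_def)
    from orth[OF this] show False using \<open>q \<noteq> 0\<close> by simp
  qed
  have lip: "norm (arc s - arc t) \<le> 2 * M * \<bar>s - t\<bar>" if s: "0 < s" "s \<le> \<sigma>" and t: "0 < t" "t \<le> \<sigma>" for s t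
  proof -
    define e where "e = arc s - arc t"
    have "(P s - P t) \<bullet> e \<le> 2 * C * (norm e)\<^sup>2"
      unfolding e_def using arc_ball[OF s] arc_ball[OF t] by (intro mono[OF sg[OF s] sg[OF t]]) auto
    \<comment> \<open>The difference of the \<open>P\<close> contains \<open>e / s\<close>, so
      monotonicity becomes a bound for \<open>|e|^2\<close>, with its right-hand side absorbed by
      \<open>C * s \<le> 1 / 4\<close>.\<close>
    moreover have "s *\<^sub>R (P s - P t) = e - (s - t) *\<^sub>R D t"
    proof -
      have "e = (arc s - x) - (arc t - x)" by (simp add: e_def)
      also have "\<dots> = s *\<^sub>R D s - t *\<^sub>R D t" using arcD s t by simp
      finally show ?thesis by (simp add: P_def algebra_simps)
    qed
    then have "s * ((P s - P t) \<bullet> e) = (norm e)\<^sup>2 - (s - t) * (D t \<bullet> e)"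
      by (metis inner_diff_left inner_scaleR_left power2_norm_eq_inner)
    ultimately have "(norm e)\<^sup>2 - (s - t) * (D t \<bullet> e) \<le> s * (2 * C * (norm e)\<^sup>2)"
      using s by (metis less_imp_le mult_left_mono)
    also have "s * (2 * C * (norm e)\<^sup>2) = 2 * (C * s) * (norm e)\<^sup>2" by simp
    also have "\<dots> \<le> 1 / 2 * (norm e)\<^sup>2" using Cs[OF s] by (intro mult_right_mono) auto
    finally have "(norm e)\<^sup>2 \<le> 2 * ((s - t) * (D t \<bullet> e))" by simp
    also have "(s - t) * (D t \<bullet> e) \<le> \<bar>s - t\<bar> * (M * norm e)"
    proof -
      have "\<bar>D t \<bullet> e\<bar> \<le> M * norm e"
        using Cauchy_Schwarz_ineq2[of "D t" e] Dbd[OF t] mult_right_mono[of "norm (D t)" M "norm e"] by simp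
      then have "\<bar>s - t\<bar> * \<bar>D t \<bullet> e\<bar> \<le> \<bar>s - t\<bar> * (M * norm e)" by (intro mult_left_mono) auto
      then show ?thesis using abs_ge_self[of "(s - t) * (D t \<bullet> e)"] by (simp add: abs_mult)
    qed
    finally have "norm e * norm e \<le> (2 * M * \<bar>s - t\<bar>) * norm e" by (simp add: power2_eq_square mult_ac)
    then show ?thesis
      using \<open>norm q > 0\<close> by (cases "norm e = 0") (auto simp: e_def M_def)
  qed
  show ?thesis
  proof (rule that[of \<sigma> "2 * M" arc P])
    show "\<sigma> > 0" by fact
    show "arc 0 = x" by (simp add: arc_def)
    show "arc s \<noteq> x \<and> arc s \<in> ball x R \<and> supergrad_on V (cball x R) C (arc s) (P s)" if "s \<in> {0<..\<sigma>}" for s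
      using that arc_ne arc_ball sg by auto
    show "(2 * M)-lipschitz_on {0..\<sigma>} arc"
    proof (rule lipschitz_onI)
      show "0 \<le> 2 * M" by (simp add: M_def)
      have M0: "M \<ge> 0" by (simp add: M_def)
      have zero: "norm (arc s - arc 0) \<le> 2 * M * s" if "0 < s" "s \<le> \<sigma>" for s
        using growth[OF that] mult_nonneg_nonneg[OF M0, of s] that by (simp add: arc_def)
      fix s t assume st: "s \<in> {0..\<sigma>}" "t \<in> {0..\<sigma>}"
      show "dist (arc s) (arc t) \<le> 2 * M * dist s t"
      proof (cases "s = 0 \<or> t = 0")
        case True
        then show ?thesis
          using st zero[of s] zero[of t] M0
          by (cases "s = t") (auto simp: dist_norm norm_minus_commute)
      next
        case False
        then show ?thesis using st lip[of s t] by (simp add: dist_norm)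
      qed
    qed
    fix s :: "nat \<Rightarrow> real" assume s: "\<forall>n. s n \<in> {0<..\<sigma>}" and s0: "s \<longlonglongrightarrow> 0"
    have sn: "0 < s n" "s n \<le> \<sigma>" for n using s by auto
    have "norm (P (s n)) \<le> norm p0 + M + norm q" for n
    proof -
      have "norm (P (s n)) \<le> norm (p0 + D (s n)) + norm q"
        unfolding P_def by (rule norm_triangle_ineq4)
      also have "norm (p0 + D (s n)) \<le> norm p0 + norm (D (s n))" by (rule norm_triangle_ineq)
      finally show ?thesis using Dbd[OF sn, of n] by simp
    qed
    then obtain l k where k: "strict_mono k" and l: "((\<lambda>n. P (s n)) \<circ> k) \<longlonglongrightarrow> l"
      using bounded_sequence_convergent_subseq[of "\<lambda>n. P (s n)"] by blast
    have sk: "(\<lambda>n. s (k n)) \<longlonglongrightarrow> 0" using LIMSEQ_subseq_LIMSEQ[OF s0 k] by (simp add: comp_def)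
    have "(\<lambda>n. norm (arc (s (k n)) - x)) \<longlonglongrightarrow> 0"
    proof (rule tendsto_sandwich[OF _ _ tendsto_const])
      show "(\<lambda>n. M * s (k n)) \<longlonglongrightarrow> 0" using tendsto_mult_right_zero[OF sk] .
    qed (use growth[OF sn] in auto)
    then have arck: "(\<lambda>n. arc (s (k n))) \<longlonglongrightarrow> x"
      using tendsto_norm_zero_iff LIM_zero_iff by blast
    have "supergrad_on V (cball x R) C x l"
      by (rule supergrad_on_limit[OF V arck l]) (simp add: sg[OF sn])
    then have ql: "q \<bullet> (l - p0) = 0" by (rule orth)
    \<comment> \<open>As \<open>D t = (P t - p0) + q\<close>, monotonicity against \<open>p0\<close>
      bounds \<open>|P t - p0|^2 + (P t - p0) \<bullet> q\<close> by a multiple of \<open>t\<close>.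
      Orthogonality removes the inner product only in the limit, because only the limit is a
      supergradient at \<open>x\<close>.\<close>
    have "(norm (l - p0))\<^sup>2 + (l - p0) \<bullet> q \<le> 0"
    proof (rule LIMSEQ_le)
      show "(\<lambda>n. (P (s (k n)) - p0) \<bullet> (P (s (k n)) - p0) + (P (s (k n)) - p0) \<bullet> q) \<longlonglongrightarrow> (norm (l - p0))\<^sup>2 + (l - p0) \<bullet> q"
        unfolding power2_norm_eq_inner using l by (intro tendsto_intros) (simp_all add: comp_def)
      show "(\<lambda>n. 2 * C * M\<^sup>2 * s (k n)) \<longlonglongrightarrow> 0" using tendsto_mult_right_zero[OF sk] .
      have "(P t - p0) \<bullet> (P t - p0) + (P t - p0) \<bullet> q \<le> 2 * C * M\<^sup>2 * t" if t: "0 < t" "t \<le> \<sigma>" for t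
      proof -
        have "(P t - p0) \<bullet> (arc t - x) \<le> 2 * C * (norm (arc t - x))\<^sup>2"
          using arc_ball[OF t] \<open>R > 0\<close> by (intro mono[OF sg[OF t] p0]) auto
        also have "2 * C * (norm (arc t - x))\<^sup>2 \<le> 2 * C * (M * t)\<^sup>2"
          using growth[OF t] \<open>C \<ge> 0\<close> by (intro mult_left_mono power_mono) auto
        finally have "t * ((P t - p0) \<bullet> D t) \<le> t * (2 * C * M\<^sup>2 * t)"
          using arcD[of t] t by (simp add: power2_eq_square mult_ac)
        then have "(P t - p0) \<bullet> D t \<le> 2 * C * M\<^sup>2 * t" using t by simp
        moreover have "D t = (P t - p0) + q" by (simp add: P_def)
        ultimately show ?thesis by (metis inner_add_right)
      qed
      then show "\<exists>N. \<forall>n\<ge>N. (P (s (k n)) - p0) \<bullet> (P (s (k n)) - p0) + (P (s (k n)) - p0) \<bullet> q \<le> 2 * C * M\<^sup>2 * s (k n)"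
        using sn by blast
    qed
    then have "l = p0" using ql by (simp add: inner_commute)
    then show "\<exists>k. strict_mono k \<and> (P \<circ> s \<circ> k) \<longlonglongrightarrow> p0" using k l by (auto simp: comp_def)
  qed
qed

section \<open>Controls and trajectories\<close>

text \<open>Extension by 0 to the whole line makes translations available, which do not preserve the
  half line.\<close>

lemma control_measurable_extension:
  assumes "control U u"
  shows "(\<lambda>x. if x \<in> {0..} then u x else 0) \<in> borel_measurable lebesgue"
  using assms by (subst borel_measurable_if) (auto simp: control_def)

lemma measurable_translation_real:
  fixes h :: "real \<Rightarrow> 'b::euclidean_space"
  assumes "h \<in> borel_measurable lebesgue"
  shows "(\<lambda>x. h (s + x)) \<in> borel_measurable lebesgue"
proof -
  have "(\<lambda>x::real. s + x) \<in> lebesgue \<rightarrow>\<^sub>M lebesgue"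
    using lebesgue_affine_measurable[of "\<lambda>_::real. 1" s] by simp
  from measurable_compose[OF this assms] show ?thesis .
qed

lemma control_shift:
  assumes "control U u" "0 \<le> s"
  shows "control U (\<lambda>\<sigma>. u (s + \<sigma>))"
proof -
  have "(\<lambda>x. if s + x \<in> {0..} then u (s + x) else 0) \<in> borel_measurable (lebesgue_on {0..})"
    by (rule measurable_restrict_space1[OF measurable_translation_real[OF control_measurable_extension[OF assms(1)]]])
  then have "(\<lambda>\<sigma>. u (s + \<sigma>)) \<in> borel_measurable (lebesgue_on {0..})"
    by (subst measurable_lebesgue_cong[where g = "\<lambda>x. if s + x \<in> {0..} then u (s + x) else 0"])
      (use assms in auto)
  then show ?thesis using assms by (auto simp: control_def)
qed

lemma control_concat:
  assumes "control U u" "control U v" "0 \<le> t"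
  shows "control U (\<lambda>\<sigma>. if \<sigma> < t then u \<sigma> else v (\<sigma> - t))"
proof -
  let ?u = "\<lambda>x. if x \<in> {0..} then u x else 0" and ?v = "\<lambda>x. if x \<in> {0..} then v x else 0"
  have "(\<lambda>x. if x < t then ?u x else ?v (- t + x)) \<in> borel_measurable lebesgue"
    by (rule measurable_If[OF control_measurable_extension[OF assms(1)]
          measurable_translation_real[OF control_measurable_extension[OF assms(2)]]]) simp
  then have *: "(\<lambda>x. if x < t then ?u x else ?v (- t + x)) \<in> borel_measurable (lebesgue_on {0..})"
    by (rule measurable_restrict_space1)
  have "(\<lambda>\<sigma>. if \<sigma> < t then u \<sigma> else v (\<sigma> - t)) \<in> borel_measurable (lebesgue_on {0..})"
    by (subst measurable_lebesgue_cong[OF _, THEN iffD2, OF _ *]) auto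
  then show ?thesis using assms by (auto simp: control_def)
qed

lemma control_const: "\<omega> \<in> U \<Longrightarrow> control U (\<lambda>_. \<omega>)"
  by (simp add: control_def)

text \<open>\<open>F\<close> is continuous only on \<open>UNIV \<times> U\<close>, so measurability
  passes through the restricted Borel space; boundedness comes from compactness of \<open>U\<close>
  and of the image of \<open>{0..t}\<close> under \<open>y\<close>.\<close>

lemma control_compose_absolutely_integrable:
  fixes U :: "'b::euclidean_space set" and y :: "real \<Rightarrow> 'c::euclidean_space"
    and F :: "'c \<Rightarrow> 'b \<Rightarrow> 'd::euclidean_space"
  assumes "compact U" and u: "control U u" and y: "continuous_on {0..} y"
    and F: "continuous_on (UNIV \<times> U) (\<lambda>(c, w). F c w)"
  shows "(\<lambda>s. F (y s) (u s)) absolutely_integrable_on {0..t}"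
proof -
  have "y \<in> borel_measurable (lebesgue_on {0..})"
    by (rule continuous_imp_measurable_on_sets_lebesgue[OF y]) auto
  moreover have "u \<in> borel_measurable (lebesgue_on {0..})" using u by (simp add: control_def)
  ultimately have "(\<lambda>s. (y s, u s)) \<in> borel_measurable (lebesgue_on {0..})"
    by (rule borel_measurable_Pair)
  then have "(\<lambda>s. (y s, u s)) \<in> measurable (lebesgue_on {0..}) (restrict_space borel (UNIV \<times> U))"
    by (intro measurable_restrict_space2) (use u in \<open>auto simp: control_def\<close>)
  from measurable_compose[OF this borel_measurable_continuous_on_restrict[OF F]]
  have "(\<lambda>s. F (y s) (u s)) \<in> borel_measurable (lebesgue_on {0..})" by simp
  then have m: "(\<lambda>s. F (y s) (u s)) \<in> borel_measurable (lebesgue_on {0..t})"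
    by (rule measurable_restrict_mono) auto
  have "compact (y ` {0..t} \<times> U)"
    by (intro compact_Times compact_continuous_image continuous_on_subset[OF y] \<open>compact U\<close>) auto
  then have "compact ((\<lambda>(c, w). F c w) ` (y ` {0..t} \<times> U))"
    by (rule compact_continuous_image[rotated]) (rule continuous_on_subset[OF F], auto)
  then obtain B where B: "\<And>z. z \<in> (\<lambda>(c, w). F c w) ` (y ` {0..t} \<times> U) \<Longrightarrow> norm z \<le> B"
    using compact_imp_bounded bounded_iff by metis
  show ?thesis
  proof (rule measurable_bounded_by_integrable_imp_absolutely_integrable[OF m])
    show "(\<lambda>_. B) integrable_on {0..t}" by auto
    show "norm (F (y s) (u s)) \<le> B" if "s \<in> {0..t}" for s
      by (rule B) (use that u in \<open>auto simp: control_def\<close>)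
  qed auto
qed

lemma integral_shift_halfline:
  fixes \<phi> :: "real \<Rightarrow> 'e::euclidean_space"
  assumes "\<And>t. 0 \<le> t \<Longrightarrow> \<phi> integrable_on {0..t}" "0 \<le> s" "0 \<le> t"
  shows "integral {0..t} (\<lambda>\<sigma>. \<phi> (s + \<sigma>)) = integral {0..s+t} \<phi> - integral {0..s} \<phi>"
proof -
  have "integral {0..t} (\<lambda>\<sigma>. \<phi> (s + \<sigma>)) = integral {s..s+t} \<phi>"
    using integral_shift_Icc_real[of 0 t \<phi> s] by (simp add: comp_def add.commute)
  then show ?thesis
    using Henstock_Kurzweil_Integration.integral_combine[of 0 s "s+t" \<phi>] assms by (simp add: algebra_simps)
qed

lemma integral_concat:
  fixes \<phi> \<psi> :: "real \<Rightarrow> 'e::euclidean_space"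
  assumes "\<And>t. 0 \<le> t \<Longrightarrow> (\<lambda>\<sigma>. if \<sigma> < t0 then \<phi> \<sigma> else \<psi> (\<sigma> - t0)) integrable_on {0..t}" "0 \<le> t0"
  shows "0 \<le> t \<Longrightarrow> t \<le> t0 \<Longrightarrow> integral {0..t} (\<lambda>\<sigma>. if \<sigma> < t0 then \<phi> \<sigma> else \<psi> (\<sigma> - t0)) = integral {0..t} \<phi>"
    and "t0 \<le> t \<Longrightarrow> integral {0..t} (\<lambda>\<sigma>. if \<sigma> < t0 then \<phi> \<sigma> else \<psi> (\<sigma> - t0)) = integral {0..t0} \<phi> + integral {0..t - t0} \<psi>"
proof -
  let ?h = "\<lambda>\<sigma>. if \<sigma> < t0 then \<phi> \<sigma> else \<psi> (\<sigma> - t0)"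
  show 1: "integral {0..t} ?h = integral {0..t} \<phi>" if "0 \<le> t" "t \<le> t0" for t
    by (rule integral_spike[of "{t0}"]) (use that in auto)
  show "integral {0..t} ?h = integral {0..t0} \<phi> + integral {0..t - t0} \<psi>" if "t0 \<le> t"
  proof -
    have "integral {0..t} ?h = integral {0..t0} ?h + integral {t0..t} ?h"
      using Henstock_Kurzweil_Integration.integral_combine[of 0 t0 t ?h] assms that by simp
    also have "integral {t0..t} ?h = integral {t0..t} (\<psi> \<circ> (+) (- t0))"
      by (rule Henstock_Kurzweil_Integration.integral_cong) auto
    also have "\<dots> = integral {0..t - t0} \<psi>"
      using integral_shift_Icc_real[of t0 t \<psi> "- t0"] by simp
    finally show ?thesis using 1[of t0] assms(2) by simp
  qed
qed

section \<open>The exit time problem\<close>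

text \<open>The existentially quantified data of the hypotheses (\<open>Df\<close>,
  \<open>Dr\<close>, \<open>W\<close>, \<open>G\<close>) become parameters, and \<open>K0\<close>
  stands for \<open>1 / (2 * \<rho>0)\<close>.\<close>

locale exit_time_problem =
  fixes U :: "'b::euclidean_space set" and S :: "'a::euclidean_space set"
    and f :: "'a \<Rightarrow> 'b \<Rightarrow> 'a" and r :: "'a \<Rightarrow> 'b \<Rightarrow> real" and g V :: "'a \<Rightarrow> real"
    and N L r0 K0 G :: real and W :: "'a set"
    and Df :: "'a \<Rightarrow> 'b \<Rightarrow> 'a \<Rightarrow>\<^sub>L 'a" and Dr :: "'a \<Rightarrow> 'b \<Rightarrow> 'a \<Rightarrow>\<^sub>L real"
  assumes U_compact: "compact U" and U_ne: "U \<noteq> {}" and S_closed: "closed S"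
    and N_pos: "N > 0" and L_pos: "L > 0" and r0_pos: "r0 > 0" and K0_nonneg: "K0 \<ge> 0"
    and f_cont: "continuous_on (UNIV \<times> U) (\<lambda>(x, \<omega>). f x \<omega>)"
    and f_le: "\<And>x \<omega>. \<omega> \<in> U \<Longrightarrow> norm (f x \<omega>) \<le> N"
    and f_lip: "\<And>x y \<omega>. \<omega> \<in> U \<Longrightarrow> norm (f y \<omega> - f x \<omega>) \<le> L * norm (y - x)"
    and Df: "\<And>x \<omega>. \<omega> \<in> U \<Longrightarrow> ((\<lambda>z. f z \<omega>) has_derivative blinfun_apply (Df x \<omega>)) (at x)"
    and Df_cont: "continuous_on (UNIV \<times> U) (\<lambda>(x, \<omega>). Df x \<omega>)"
    and Df_lip: "\<And>x y \<omega>. \<omega> \<in> U \<Longrightarrow> norm (Df y \<omega> - Df x \<omega>) \<le> L * norm (y - x)"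
    and r_cont: "continuous_on (UNIV \<times> U) (\<lambda>(x, \<omega>). r x \<omega>)"
    and r_ge: "\<And>x \<omega>. \<omega> \<in> U \<Longrightarrow> r0 \<le> r x \<omega>"
    and r_lip: "\<And>x y \<omega>. \<omega> \<in> U \<Longrightarrow> \<bar>r y \<omega> - r x \<omega>\<bar> \<le> L * norm (y - x)"
    and Dr: "\<And>x \<omega>. \<omega> \<in> U \<Longrightarrow> ((\<lambda>z. r z \<omega>) has_derivative blinfun_apply (Dr x \<omega>)) (at x)"
    and Dr_cont: "continuous_on (UNIV \<times> U) (\<lambda>(x, \<omega>). Dr x \<omega>)"
    and Dr_lip: "\<And>x y \<omega>. \<omega> \<in> U \<Longrightarrow> norm (Dr y \<omega> - Dr x \<omega>) \<le> L * norm (y - x)"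
    and W_open: "open W" and frontier_W: "frontier S \<subseteq> W" and G_nonneg: "0 \<le> G" and G_less: "G * N < r0"
    and g_lip: "\<And>x y. x \<in> W \<Longrightarrow> y \<in> W \<Longrightarrow> \<bar>g y - g x\<bar> \<le> G * norm (y - x)"
    and inner_normal: "\<And>x. x \<in> frontier S \<Longrightarrow> \<exists>\<xi>. norm \<xi> = 1 \<and> (\<forall>y\<in>closure (- S). \<xi> \<bullet> (y - x) \<le> K0 * (norm (y - x))\<^sup>2)"
    and nondegenerate: "nondegenerate_hamiltonian_hyp U f r"
    and g_semiconcave: "locally_semiconcave g"
    and value_eq: "\<And>x. value_function U S f r g x = ereal (V x)"
    and V_cont: "continuous_on UNIV V"
begin

text \<open>In contrast to \<open>admissible\<close> the target is left out: a perturbed initial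
  point is run with the control of another trajectory and may never reach \<open>S\<close>.\<close>

definition traj :: "'a \<Rightarrow> (real \<Rightarrow> 'b) \<Rightarrow> (real \<Rightarrow> 'a) \<Rightarrow> bool" where
  "traj x u y \<longleftrightarrow> control U u \<and> caratheodory_solution f x u y"

definition rcost :: "(real \<Rightarrow> 'b) \<Rightarrow> (real \<Rightarrow> 'a) \<Rightarrow> real \<Rightarrow> real" where
  "rcost u y t = integral {0..t} (\<lambda>s. r (y s) (u s))"

lemma traj_control: "traj x u y \<Longrightarrow> control U u"
  by (simp add: traj_def)

lemma control_in: "control U u \<Longrightarrow> 0 \<le> s \<Longrightarrow> u s \<in> U"
  by (simp add: control_def)

lemma traj_eq: "traj x u y \<Longrightarrow> 0 \<le> t \<Longrightarrow> y t = x + integral {0..t} (\<lambda>s. f (y s) (u s))"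
  by (simp add: traj_def caratheodory_solution_def)

lemma traj_0: "traj x u y \<Longrightarrow> y 0 = x"
  using traj_eq[of x u y 0] by simp

lemma f_integrable: "traj x u y \<Longrightarrow> 0 \<le> t \<Longrightarrow> (\<lambda>s. f (y s) (u s)) integrable_on {0..t}"
  unfolding traj_def caratheodory_solution_def
  using absolutely_integrable_on_def by blast

lemma traj_continuous: assumes "traj x u y" shows "continuous_on {0..} y"
proof -
  have "continuous_on {0..} (\<lambda>t. x + integral {0..t} (\<lambda>s. f (y s) (u s)))"
    using assms by (intro continuous_intros continuous_on_indefinite_integral_halfline f_integrable)
  then show ?thesis by (rule continuous_on_eq) (use traj_eq[OF assms] in auto)
qed

lemma trajI:
  assumes "control U u" "continuous_on {0..} y" "\<And>t. 0 \<le> t \<Longrightarrow> y t = x + integral {0..t} (\<lambda>s. f (y s) (u s))"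
  shows "traj x u y"
  using assms control_compose_absolutely_integrable[OF U_compact assms(1,2) f_cont]
  by (simp add: traj_def caratheodory_solution_def)

lemma compose_integrable:
  fixes F :: "'c::euclidean_space \<Rightarrow> 'b \<Rightarrow> 'd::euclidean_space"
  assumes "control U u" "continuous_on {0..} y" "continuous_on (UNIV \<times> U) (\<lambda>(c, w). F c w)"
  shows "(\<lambda>s. F (y s) (u s)) integrable_on {0..t}"
  using control_compose_absolutely_integrable[OF U_compact assms] absolutely_integrable_on_def by blast

lemma r_integrable: "traj x u y \<Longrightarrow> (\<lambda>s. r (y s) (u s)) integrable_on {0..t}"
  by (rule compose_integrable[OF traj_control traj_continuous r_cont])

lemma traj_lipschitz:
  assumes "traj x u y" "0 \<le> s" "0 \<le> t"
  shows "norm (y t - y s) \<le> N * \<bar>t - s\<bar>"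
proof -
  have "norm (integral {0..t} (\<lambda>s. f (y s) (u s)) - integral {0..s} (\<lambda>s. f (y s) (u s))) \<le> N * \<bar>t - s\<bar>"
    by (rule norm_integral_increment_le[OF f_integrable[OF assms(1)]])
      (use assms control_in[OF traj_control[OF assms(1)]] in \<open>auto intro!: f_le\<close>)
  then show ?thesis using traj_eq[OF assms(1)] assms by simp
qed

lemma rcost_ge:
  assumes "traj x u y" "0 \<le> s" "s \<le> t"
  shows "rcost u y t - rcost u y s \<ge> r0 * (t - s)"
proof -
  have "rcost u y t - rcost u y s = integral {s..t} (\<lambda>s. r (y s) (u s))"
    using Henstock_Kurzweil_Integration.integral_combine[of 0 s t "\<lambda>s. r (y s) (u s)"] r_integrable[OF assms(1)] assms
    by (simp add: rcost_def)
  moreover have "integral {s..t} (\<lambda>_. r0) \<le> integral {s..t} (\<lambda>s. r (y s) (u s))"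
    by (rule integral_le) (use assms control_in[OF traj_control[OF assms(1)]] in
        \<open>auto intro!: r_ge intro: integrable_on_subinterval[OF r_integrable[OF assms(1), of t]]\<close>)
  ultimately show ?thesis using assms by (simp add: mult.commute)
qed

lemma rcost_0 [simp]: "rcost u y 0 = 0"
  by (simp add: rcost_def)

lemma traj_exists: assumes "control U u" obtains y where "traj x u y"
proof -
  obtain y where "continuous_on {0..} y" "\<And>t. 0 \<le> t \<Longrightarrow> y t = x + integral {0..t} (\<lambda>s. f (y s) (u s))"
  proof (rule caratheodory_equation_exists[of "\<lambda>s a. f a (u s)" L x N])
    show "(\<lambda>s. f (y s) (u s)) integrable_on {0..t}" if "continuous_on {0..} y" for y t
      by (rule compose_integrable[OF assms that f_cont])
    show "norm (f a (u s) - f b (u s)) \<le> L * norm (a - b)" if "0 \<le> s" for s a b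
      by (rule f_lip) (rule control_in[OF assms that])
    show "norm (f x (u s)) \<le> N" if "0 \<le> s" for s
      by (rule f_le) (rule control_in[OF assms that])
  qed (use L_pos N_pos in auto)
  with assms show ?thesis using that trajI by blast
qed

lemma traj_shift:
  assumes "traj x u y" "0 \<le> s"
  shows "traj (y s) (\<lambda>\<sigma>. u (s + \<sigma>)) (\<lambda>\<sigma>. y (s + \<sigma>))"
proof (rule trajI)
  show "control U (\<lambda>\<sigma>. u (s + \<sigma>))" by (rule control_shift[OF traj_control]) (use assms in auto)
  show "continuous_on {0..} (\<lambda>\<sigma>. y (s + \<sigma>))"
    by (rule continuous_on_compose2[OF traj_continuous[OF assms(1)]])
      (use assms in \<open>auto intro!: continuous_intros\<close>)
  show "y (s + t) = y s + integral {0..t} (\<lambda>\<sigma>. f (y (s + \<sigma>)) (u (s + \<sigma>)))" if "0 \<le> t" for t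
    using integral_shift_halfline[of "\<lambda>s. f (y s) (u s)" s t] f_integrable[OF assms(1)] assms that
      traj_eq[OF assms(1), of s] traj_eq[OF assms(1), of "s + t"] by simp
qed

lemma rcost_shift:
  assumes "traj x u y" "0 \<le> s" "0 \<le> t"
  shows "rcost (\<lambda>\<sigma>. u (s + \<sigma>)) (\<lambda>\<sigma>. y (s + \<sigma>)) t = rcost u y (s + t) - rcost u y s"
  unfolding rcost_def
  using integral_shift_halfline[of "\<lambda>s. r (y s) (u s)" s t] r_integrable[OF assms(1)] assms by simp

lemma traj_concat:
  assumes "traj x u y" "0 \<le> t0" "traj (y t0) v w"
  defines "uv \<equiv> \<lambda>\<sigma>. if \<sigma> < t0 then u \<sigma> else v (\<sigma> - t0)" and "yw \<equiv> \<lambda>\<sigma>. if \<sigma> < t0 then y \<sigma> else w (\<sigma> - t0)"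
  shows "traj x uv yw"
    and "0 \<le> t \<Longrightarrow> t \<le> t0 \<Longrightarrow> yw t = y t"
    and "0 \<le> t \<Longrightarrow> t \<le> t0 \<Longrightarrow> rcost uv yw t = rcost u y t"
    and "t0 \<le> t \<Longrightarrow> rcost uv yw t = rcost u y t0 + rcost v w (t - t0)"
proof -
  have yw: "yw t = y t" if "0 \<le> t" "t \<le> t0" for t
    using that traj_0[OF assms(3)] by (auto simp: yw_def)
  then show "yw t = y t" if "0 \<le> t" "t \<le> t0" using that .
  have c: "control U uv"
    unfolding uv_def by (rule control_concat) (use assms traj_control in auto)
  have yc: "continuous_on {0..} yw"
  proof -
    have "continuous_on ({0..t0} \<union> {t0..}) yw"
    proof (rule continuous_on_closed_Un)
      show "continuous_on {0..t0} yw"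
        by (rule continuous_on_eq[OF continuous_on_subset[OF traj_continuous[OF assms(1)]]]) (use yw in auto)
      have "continuous_on {t0..} (\<lambda>\<sigma>. w (\<sigma> - t0))"
        by (rule continuous_on_compose2[OF traj_continuous[OF assms(3)]]) (auto intro!: continuous_intros)
      then show "continuous_on {t0..} yw" by (rule continuous_on_eq) (auto simp: yw_def)
    qed auto
    moreover have "{0..t0} \<union> {t0..} = {0..}" using \<open>0 \<le> t0\<close> by auto
    ultimately show ?thesis by simp
  qed
  have split: "F (yw \<sigma>) (uv \<sigma>) = (if \<sigma> < t0 then F (y \<sigma>) (u \<sigma>) else F (w (\<sigma> - t0)) (v (\<sigma> - t0)))" for F :: "'a \<Rightarrow> 'b \<Rightarrow> 'z" and \<sigma>
    by (simp add: yw_def uv_def)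
  have fi: "(\<lambda>\<sigma>. if \<sigma> < t0 then f (y \<sigma>) (u \<sigma>) else f (w (\<sigma> - t0)) (v (\<sigma> - t0))) integrable_on {0..t}" for t
    using compose_integrable[OF c yc f_cont] unfolding split .
  have ri: "(\<lambda>\<sigma>. if \<sigma> < t0 then r (y \<sigma>) (u \<sigma>) else r (w (\<sigma> - t0)) (v (\<sigma> - t0))) integrable_on {0..t}" for t
    using compose_integrable[OF c yc r_cont] unfolding split .
  show "traj x uv yw"
  proof (rule trajI[OF c yc])
    fix t :: real assume t: "0 \<le> t"
    show "yw t = x + integral {0..t} (\<lambda>s. f (yw s) (uv s))"
    proof (cases "t \<le> t0")
      case True
      then show ?thesis
        unfolding split integral_concat(1)[OF fi \<open>0 \<le> t0\<close> t True] using yw t traj_eq[OF assms(1)] by simp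
    next
      case False
      then have tt: "t0 \<le> t" by simp
      show ?thesis
        unfolding split integral_concat(2)[where \<phi> = "\<lambda>\<sigma>. f (y \<sigma>) (u \<sigma>)" and \<psi> = "\<lambda>\<sigma>. f (w \<sigma>) (v \<sigma>)", OF fi \<open>0 \<le> t0\<close> tt]
        using False traj_eq[OF assms(1), of t0] traj_eq[OF assms(3), of "t - t0"] \<open>0 \<le> t0\<close> by (simp add: yw_def)
    qed
  qed
  show "rcost uv yw t = rcost u y t" if "0 \<le> t" "t \<le> t0"
    unfolding rcost_def split using integral_concat(1)[OF ri \<open>0 \<le> t0\<close> that] .
  show "rcost uv yw t = rcost u y t0 + rcost v w (t - t0)" if "t0 \<le> t"
    unfolding rcost_def split
    using integral_concat(2)[where \<phi> = "\<lambda>\<sigma>. r (y \<sigma>) (u \<sigma>)" and \<psi> = "\<lambda>\<sigma>. r (w \<sigma>) (v \<sigma>)", OF ri \<open>0 \<le> t0\<close> that] .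
qed

lemma traj_dependence:
  assumes y: "traj x u y" and y': "traj x' u y'" and t: "0 \<le> t" "t \<le> T"
  shows "norm (y' t - y t) \<le> norm (x' - x) * exp (L * T)"
proof -
  have cont: "continuous_on {0..t} (\<lambda>s. norm (y' s - y s))"
    by (intro continuous_intros continuous_on_subset[OF traj_continuous[OF y]] continuous_on_subset[OF traj_continuous[OF y']]) auto
  have "norm (y' t - y t) \<le> norm (x' - x) * exp (L * t)"
  proof (rule gronwall[OF cont])
    fix s assume s: "0 \<le> s" "s \<le> t"
    have int: "(\<lambda>\<sigma>. f (y' \<sigma>) (u \<sigma>) - f (y \<sigma>) (u \<sigma>)) integrable_on {0..s}"
      by (intro integrable_diff f_integrable[OF y] f_integrable[OF y'] s)
    have "norm (integral {0..s} (\<lambda>\<sigma>. f (y' \<sigma>) (u \<sigma>) - f (y \<sigma>) (u \<sigma>))) \<le> integral {0..s} (\<lambda>\<sigma>. L * norm (y' \<sigma> - y \<sigma>))"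
    proof (rule integral_norm_bound_integral[OF int])
      show "(\<lambda>\<sigma>. L * norm (y' \<sigma> - y \<sigma>)) integrable_on {0..s}"
        by (intro integrable_continuous_real continuous_intros continuous_on_subset[OF traj_continuous[OF y]]
              continuous_on_subset[OF traj_continuous[OF y']]) auto
    qed (use f_lip control_in[OF traj_control[OF y]] in auto)
    moreover have "y' s - y s = (x' - x) + integral {0..s} (\<lambda>\<sigma>. f (y' \<sigma>) (u \<sigma>) - f (y \<sigma>) (u \<sigma>))"
      using traj_eq[OF y s(1)] traj_eq[OF y' s(1)] f_integrable[OF y s(1)] f_integrable[OF y' s(1)]
      by (simp add: integral_diff)
    ultimately show "norm (y' s - y s) \<le> norm (x' - x) + L * integral {0..s} (\<lambda>s. norm (y' s - y s))"
      using norm_triangle_ineq[of "x' - x" "integral {0..s} (\<lambda>\<sigma>. f (y' \<sigma>) (u \<sigma>) - f (y \<sigma>) (u \<sigma>))"] by simp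
  qed (use L_pos t in auto)
  also have "\<dots> \<le> norm (x' - x) * exp (L * T)"
    using t L_pos by (intro mult_left_mono) auto
  finally show ?thesis .
qed

end

section \<open>Linearisation of the flow\<close>

lemma quadratic_remainder:
  fixes F :: "'a::real_normed_vector \<Rightarrow> 'c::real_normed_vector" and D :: "'a \<Rightarrow> 'a \<Rightarrow>\<^sub>L 'c"
  assumes der: "\<And>z. (F has_derivative blinfun_apply (D z)) (at z)"
    and lip: "\<And>x y. norm (D y - D x) \<le> L * norm (y - x)" and "L \<ge> 0"
  shows "norm (F y - F x - D x (y - x)) \<le> L * (norm (y - x))\<^sup>2"
proof -
  have "norm (F y - F x - D x (y - x)) \<le> norm (y - x) * (L * norm (y - x))"
  proof (rule differentiable_bound_linearization[where S = "cball x (norm (y - x))" and f' = "\<lambda>z. blinfun_apply (D z)"])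
    fix t :: real assume "t \<in> {0..1}"
    then show "x + t *\<^sub>R (y - x) \<in> cball x (norm (y - x))"
      by (simp add: dist_norm mult_left_le_one_le)
  next
    fix z assume z: "z \<in> cball x (norm (y - x))"
    show "(F has_derivative blinfun_apply (D z)) (at z within cball x (norm (y - x)))"
      by (rule has_derivative_at_withinI[OF der])
    have "onorm (blinfun_apply (D z) - blinfun_apply (D x)) = norm (D z - D x)"
      by (simp add: norm_blinfun.rep_eq minus_blinfun.rep_eq fun_diff_def)
    also have "\<dots> \<le> L * norm (z - x)" by (rule lip)
    also have "\<dots> \<le> L * norm (y - x)"
      using z \<open>L \<ge> 0\<close> by (intro mult_left_mono) (auto simp: dist_norm norm_minus_commute)
    finally show "onorm (blinfun_apply (D z) - blinfun_apply (D x)) \<le> L * norm (y - x)" .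
  qed simp
  then show ?thesis by (simp add: power2_eq_square mult_ac)
qed

text \<open>The Lipschitz assumptions on \<open>Df\<close> and \<open>Dr\<close> bound only
  differences of derivatives; their size has to be recovered from the Lipschitz bounds for
  \<open>f\<close> and \<open>r\<close>.\<close>

lemma derivative_norm_le_lipschitz:
  fixes F :: "'a::real_normed_vector \<Rightarrow> 'c::real_normed_vector" and D :: "'a \<Rightarrow>\<^sub>L 'c"
  assumes rem: "\<And>y. norm (F y - F x - D (y - x)) \<le> L * (norm (y - x))\<^sup>2"
    and lip: "\<And>y. norm (F y - F x) \<le> L * norm (y - x)" and "L \<ge> 0"
  shows "norm D \<le> L"
proof (rule norm_blinfun_bound[OF \<open>L \<ge> 0\<close>])
  fix h
  have "norm (D h) - L * norm h \<le> 0"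
  proof (rule le_zero_if_le_small_multiples[of 1])
    fix \<theta> :: real assume \<theta>: "0 < \<theta>" "\<theta> < 1"
    have "norm (D (\<theta> *\<^sub>R h)) \<le> norm (F (x + \<theta> *\<^sub>R h) - F x) + norm (F (x + \<theta> *\<^sub>R h) - F x - D (\<theta> *\<^sub>R h))"
      using norm_triangle_sub[of "D (\<theta> *\<^sub>R h)" "F (x + \<theta> *\<^sub>R h) - F x"] by (simp add: norm_minus_commute)
    also have "\<dots> \<le> L * (\<theta> * norm h) + L * (\<theta> * norm h)\<^sup>2"
      using rem[of "x + \<theta> *\<^sub>R h"] lip[of "x + \<theta> *\<^sub>R h"] \<theta> by simp
    also have "\<dots> = \<theta> * (L * norm h + \<theta> * (L * (norm h)\<^sup>2))"
      by (simp add: power2_eq_square algebra_simps)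
    finally have "\<theta> * norm (D h) \<le> \<theta> * (L * norm h + \<theta> * (L * (norm h)\<^sup>2))"
      using \<theta> by (simp add: blinfun.scaleR_right)
    then show "norm (D h) - L * norm h \<le> \<theta> * (L * (norm h)\<^sup>2)" using \<theta> by simp
  qed simp
  then show "norm (D h) \<le> L * norm h" by simp
qed

context exit_time_problem
begin

lemma f_remainder: "\<omega> \<in> U \<Longrightarrow> norm (f y \<omega> - f x \<omega> - Df x \<omega> (y - x)) \<le> L * (norm (y - x))\<^sup>2"
  by (rule quadratic_remainder[of "\<lambda>z. f z \<omega>" "\<lambda>z. Df z \<omega>"]) (use Df Df_lip L_pos in auto)

lemma r_remainder: "\<omega> \<in> U \<Longrightarrow> norm (r y \<omega> - r x \<omega> - Dr x \<omega> (y - x)) \<le> L * (norm (y - x))\<^sup>2"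
  by (rule quadratic_remainder[of "\<lambda>z. r z \<omega>" "\<lambda>z. Dr z \<omega>"]) (use Dr Dr_lip L_pos in auto)

lemma Df_le: "\<omega> \<in> U \<Longrightarrow> norm (Df x \<omega> h) \<le> L * norm h"
  using derivative_norm_le_lipschitz[of "\<lambda>z. f z \<omega>" x "Df x \<omega>" L] f_remainder f_lip L_pos
    norm_blinfun[of "Df x \<omega>" h] mult_right_mono[of "norm (Df x \<omega>)" L "norm h"] by force

lemma Dr_le: "\<omega> \<in> U \<Longrightarrow> norm (Dr x \<omega> h) \<le> L * norm h"
  using derivative_norm_le_lipschitz[of "\<lambda>z. r z \<omega>" x "Dr x \<omega>" L] r_remainder r_lip L_pos
    norm_blinfun[of "Dr x \<omega>" h] mult_right_mono[of "norm (Dr x \<omega>)" L "norm h"] by force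

text \<open>Treats the pair \<open>(y, w)\<close> as one state, so that
  \<open>compose_integrable\<close> covers the integrand of the variational equation.\<close>

lemma blinfun_compose_integrable:
  fixes D :: "'a \<Rightarrow> 'b \<Rightarrow> 'a \<Rightarrow>\<^sub>L 'd::euclidean_space"
  assumes D: "continuous_on (UNIV \<times> U) (\<lambda>(x, \<omega>). D x \<omega>)"
    and "control U u" "continuous_on {0..} y" "continuous_on {0..} w"
  shows "(\<lambda>s. D (y s) (u s) (w s)) integrable_on {0..t}"
proof -
  have "continuous_on (UNIV \<times> U) (\<lambda>z. case (\<lambda>(ca, \<omega>). (fst ca, \<omega>)) z of (x, \<omega>) \<Rightarrow> D x \<omega>)"
    by (rule continuous_on_compose2[OF D]) (auto simp: case_prod_unfold intro!: continuous_intros)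
  moreover have "continuous_on (UNIV \<times> U) (\<lambda>z::('a \<times> 'a) \<times> 'b. snd (fst z))"
    by (intro continuous_intros)
  ultimately have "continuous_on (UNIV \<times> U) (\<lambda>z. blinfun_apply (case (\<lambda>(ca, \<omega>). (fst ca, \<omega>)) z of (x, \<omega>) \<Rightarrow> D x \<omega>) (snd (fst z)))"
    by (rule bounded_bilinear.continuous_on[OF bounded_bilinear_blinfun_apply])
  then have "continuous_on (UNIV \<times> U) (\<lambda>(ca, \<omega>). D (fst ca) \<omega> (snd ca))"
    by (simp add: case_prod_unfold)
  from compose_integrable[OF assms(2) continuous_on_Pair[OF assms(3,4)] this]
  show ?thesis by simp
qed

text \<open>Gronwall for the variational equation with a defect \<open>c\<close>. It is used three
  times: \<open>c = 0\<close> gives uniqueness and hence linearity in the initial vector,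
  \<open>c = norm h\<close> gives growth, and a defect quadratic in \<open>norm h\<close> gives the
  linearisation error.\<close>

lemma variational_growth:
  assumes y: "traj x u y" and w: "continuous_on {0..} w" and "0 \<le> t"
    and le: "\<And>s. 0 \<le> s \<Longrightarrow> s \<le> t \<Longrightarrow> norm (w s - integral {0..s} (\<lambda>\<sigma>. Df (y \<sigma>) (u \<sigma>) (w \<sigma>))) \<le> c"
  shows "norm (w t) \<le> c * exp (L * t)"
proof (rule gronwall)
  show "continuous_on {0..t} (\<lambda>s. norm (w s))"
    by (intro continuous_intros continuous_on_subset[OF w]) auto
  fix s assume s: "0 \<le> s" "s \<le> t"
  have "norm (integral {0..s} (\<lambda>\<sigma>. Df (y \<sigma>) (u \<sigma>) (w \<sigma>))) \<le> integral {0..s} (\<lambda>\<sigma>. L * norm (w \<sigma>))"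
  proof (rule integral_norm_bound_integral)
    show "(\<lambda>\<sigma>. L * norm (w \<sigma>)) integrable_on {0..s}"
      by (intro integrable_continuous_real continuous_intros continuous_on_subset[OF w]) auto
  qed (use blinfun_compose_integrable[OF Df_cont traj_control traj_continuous w] y Df_le control_in[OF traj_control[OF y]] in auto)
  then show "norm (w s) \<le> c + L * integral {0..s} (\<lambda>s. norm (w s))"
    using le[OF s] norm_triangle_sub[of "w s" "integral {0..s} (\<lambda>\<sigma>. Df (y \<sigma>) (u \<sigma>) (w \<sigma>))"] by simp
qed (use L_pos \<open>0 \<le> t\<close> in auto)

text \<open>The first summand is the constant for the state: a remainder of size
  \<open>exp (2 * L * T)\<close> times the Gronwall factor \<open>exp (L * T)\<close>. The second is
  the one for the cost: the remainder of \<open>r\<close> plus \<open>L\<close> times the state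
  error, over a time of at most \<open>T\<close>. The sum serves for both.\<close>

definition lin_const :: "real \<Rightarrow> real" where
  "lin_const T = L * T * exp (3 * L * T) + T * (L * exp (2 * L * T) + L * (L * T * exp (3 * L * T)))"

text \<open>The control is kept and only the initial point moves. All bounds depend on
  \<open>T\<close> alone, which makes the normals below locally uniform; the lower bound on
  \<open>M\<close> keeps a nonzero terminal normal nonzero when it is pulled back.\<close>

lemma flow_linearization:
  assumes y: "traj x u y" and t: "0 \<le> t" "t \<le> T"
  obtains M q where "linear M" "\<And>h. norm (M h) \<le> exp (L * T) * norm h" "\<And>h. norm h \<le> exp (L * T) * norm (M h)"
    "norm q \<le> L * T * exp (L * T)"
    "\<And>x' y'. traj x' u y' \<Longrightarrow> norm (y' t - y t - M (x' - x)) \<le> lin_const T * (norm (x' - x))\<^sup>2"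
    "\<And>x' y'. traj x' u y' \<Longrightarrow> \<bar>rcost u y' t - rcost u y t - q \<bullet> (x' - x)\<bar> \<le> lin_const T * (norm (x' - x))\<^sup>2"
proof -
  have u: "control U u" and yc: "continuous_on {0..} y" using y traj_control traj_continuous by auto
  have uU: "u s \<in> U" if "0 \<le> s" for s using control_in[OF u that] .
  have "T \<ge> 0" using t by simp
  \<comment> \<open>The variational equation along \<open>y\<close> with initial vector
    \<open>h\<close>.\<close>
  have "\<exists>m. continuous_on {0..} m \<and> (\<forall>s\<ge>0. m s = h + integral {0..s} (\<lambda>\<sigma>. Df (y \<sigma>) (u \<sigma>) (m \<sigma>)))" for h
  proof -
    obtain m where "continuous_on {0..} m" "\<And>s. 0 \<le> s \<Longrightarrow> m s = h + integral {0..s} (\<lambda>\<sigma>. Df (y \<sigma>) (u \<sigma>) (m \<sigma>))"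
    proof (rule caratheodory_equation_exists[of "\<lambda>s a. Df (y s) (u s) a" L h "L * norm h"])
      show "norm (Df (y s) (u s) a - Df (y s) (u s) b) \<le> L * norm (a - b)" if "0 \<le> s" for s a b
        using Df_le[OF uU[OF that], of "y s" "a - b"] by (simp add: blinfun.diff_right)
    qed (use blinfun_compose_integrable[OF Df_cont u yc] Df_le uU L_pos in auto)
    then show ?thesis by blast
  qed
  then obtain m where mc: "\<And>h. continuous_on {0..} (m h)"
    and m: "\<And>h s. 0 \<le> s \<Longrightarrow> m h s = h + integral {0..s} (\<lambda>\<sigma>. Df (y \<sigma>) (u \<sigma>) (m h \<sigma>))"
    by metis
  have Di: "(\<lambda>\<sigma>. Df (y \<sigma>) (u \<sigma>) (w \<sigma>)) integrable_on {0..s}" if "continuous_on {0..} w" for w s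
    by (rule blinfun_compose_integrable[OF Df_cont u yc that])
  have Dri: "(\<lambda>\<sigma>. Dr (y \<sigma>) (u \<sigma>) (w \<sigma>)) integrable_on {0..s}" if "continuous_on {0..} w" for w s
    by (rule blinfun_compose_integrable[OF Dr_cont u yc that])
  have m_add: "m (h + k) s = m h s + m k s" if "0 \<le> s" for h k s
  proof -
    define w where "w s = m (h + k) s - (m h s + m k s)" for s
    have wc: "continuous_on {0..} w" unfolding w_def by (intro continuous_intros mc)
    have "norm (w s) \<le> 0 * exp (L * s)"
    proof (rule variational_growth[OF y wc that])
      fix \<sigma> assume \<sigma>: "0 \<le> \<sigma>" "\<sigma> \<le> s"
      have "integral {0..\<sigma>} (\<lambda>\<sigma>. Df (y \<sigma>) (u \<sigma>) (w \<sigma>)) = w \<sigma>"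
        unfolding w_def blinfun.diff_right blinfun.add_right
        using m[OF \<sigma>(1)] Di[OF mc]
        by (simp add: integral_diff integral_add integrable_add algebra_simps)
      then show "norm (w \<sigma> - integral {0..\<sigma>} (\<lambda>\<sigma>. Df (y \<sigma>) (u \<sigma>) (w \<sigma>))) \<le> 0" by simp
    qed
    then show ?thesis by (simp add: w_def)
  qed
  have m_scale: "m (c *\<^sub>R h) s = c *\<^sub>R m h s" if "0 \<le> s" for h c s
  proof -
    define w where "w s = m (c *\<^sub>R h) s - c *\<^sub>R m h s" for s
    have wc: "continuous_on {0..} w" unfolding w_def by (intro continuous_intros mc)
    have "norm (w s) \<le> 0 * exp (L * s)"
    proof (rule variational_growth[OF y wc that])
      fix \<sigma> assume \<sigma>: "0 \<le> \<sigma>" "\<sigma> \<le> s"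
      have "c *\<^sub>R m h \<sigma> = c *\<^sub>R h + c *\<^sub>R integral {0..\<sigma>} (\<lambda>\<sigma>. Df (y \<sigma>) (u \<sigma>) (m h \<sigma>))"
        by (subst m[OF \<sigma>(1)]) (simp add: scaleR_add_right)
      then have "integral {0..\<sigma>} (\<lambda>\<sigma>. Df (y \<sigma>) (u \<sigma>) (w \<sigma>)) = w \<sigma>"
        unfolding w_def blinfun.diff_right blinfun.scaleR_right
        using m[OF \<sigma>(1), of "c *\<^sub>R h"] integral_diff[OF Di[OF mc] integrable_cmul[OF Di[OF mc]]]
        by simp
      then show "norm (w \<sigma> - integral {0..\<sigma>} (\<lambda>\<sigma>. Df (y \<sigma>) (u \<sigma>) (w \<sigma>))) \<le> 0" by simp
    qed
    then show ?thesis by (simp add: w_def)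
  qed
  have m_le: "norm (m h s) \<le> exp (L * T) * norm h" if "0 \<le> s" "s \<le> T" for h s
  proof -
    have "norm (m h s) \<le> norm h * exp (L * s)"
      by (rule variational_growth[OF y mc that(1)]) (simp add: m)
    also have "\<dots> \<le> norm h * exp (L * T)"
      using that L_pos by (intro mult_left_mono) auto
    finally show ?thesis by (simp add: mult.commute)
  qed
  have m_ge: "norm h \<le> exp (L * T) * norm (m h t)" for h
  proof -
    have "norm (m h 0) \<le> norm (m h t) * exp (L * t)"
    proof (rule gronwall_backward)
      show "continuous_on {0..t} (\<lambda>s. norm (m h s))"
        by (intro continuous_intros continuous_on_subset[OF mc]) auto
      fix s assume s: "0 \<le> s" "s \<le> t"
      have i: "(\<lambda>\<sigma>. Df (y \<sigma>) (u \<sigma>) (m h \<sigma>)) integrable_on {s..t}"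
        by (rule integrable_on_subinterval[OF Di[OF mc, of h t]]) (use s in auto)
      have "norm (integral {s..t} (\<lambda>\<sigma>. Df (y \<sigma>) (u \<sigma>) (m h \<sigma>))) \<le> integral {s..t} (\<lambda>\<sigma>. L * norm (m h \<sigma>))"
      proof (rule integral_norm_bound_integral[OF i])
        show "(\<lambda>\<sigma>. L * norm (m h \<sigma>)) integrable_on {s..t}"
          by (intro integrable_continuous_real continuous_intros continuous_on_subset[OF mc]) (use s in auto)
      qed (use Df_le uU s in auto)
      moreover have "m h s = m h t - integral {s..t} (\<lambda>\<sigma>. Df (y \<sigma>) (u \<sigma>) (m h \<sigma>))"
        using Henstock_Kurzweil_Integration.integral_combine[OF s Di[OF mc, of h t]] m[of s h] m[of t h] s t
        by (simp add: algebra_simps)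
      ultimately show "norm (m h s) \<le> norm (m h t) + L * integral {s..t} (\<lambda>s. norm (m h s))"
        using norm_triangle_ineq4[of "m h t" "integral {s..t} (\<lambda>\<sigma>. Df (y \<sigma>) (u \<sigma>) (m h \<sigma>))"] by simp
    qed (use L_pos t in auto)
    also have "m h 0 = h" using m[of 0 h] by simp
    also have "norm (m h t) * exp (L * t) \<le> norm (m h t) * exp (L * T)"
      using t L_pos by (intro mult_left_mono) auto
    finally show ?thesis by (simp add: mult.commute)
  qed
  define M where "M h = m h t" for h
  have "linear M" unfolding M_def by (rule linearI) (simp_all add: m_add m_scale t)
  define ell where "ell h = integral {0..t} (\<lambda>\<sigma>. Dr (y \<sigma>) (u \<sigma>) (m h \<sigma>))" for h
  have "linear ell"
  proof (rule linearI)
    fix h k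
    have "ell (h + k) = integral {0..t} (\<lambda>\<sigma>. Dr (y \<sigma>) (u \<sigma>) (m h \<sigma>) + Dr (y \<sigma>) (u \<sigma>) (m k \<sigma>))"
      unfolding ell_def by (rule Henstock_Kurzweil_Integration.integral_cong) (simp add: m_add blinfun.add_right)
    also have "\<dots> = ell h + ell k" unfolding ell_def by (rule integral_add[OF Dri[OF mc] Dri[OF mc]])
    finally show "ell (h + k) = ell h + ell k" .
  next
    fix c h
    have "ell (c *\<^sub>R h) = integral {0..t} (\<lambda>\<sigma>. c *\<^sub>R Dr (y \<sigma>) (u \<sigma>) (m h \<sigma>))"
      unfolding ell_def by (rule Henstock_Kurzweil_Integration.integral_cong) (simp add: m_scale blinfun.scaleR_right)
    then show "ell (c *\<^sub>R h) = c *\<^sub>R ell h" by (simp add: ell_def)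
  qed
  \<comment> \<open>The vector that represents the derivative of the running cost with respect to
    the initial point.\<close>
  define q where "q = adjoint ell 1"
  have q: "ell h = q \<bullet> h" for h
    using adjoint_works[OF \<open>linear ell\<close>, of h 1] by (simp add: q_def inner_commute)
  have "norm (ell h) \<le> (L * T * exp (L * T)) * norm h" for h
  proof -
    have "norm (ell h) \<le> (L * (exp (L * T) * norm h)) * (t - 0)"
      unfolding ell_def
    proof (rule norm_integral_le_const[OF Dri[OF mc] t(1)])
      fix s assume s: "s \<in> {0..t}"
      have "norm (Dr (y s) (u s) (m h s)) \<le> L * norm (m h s)" using Dr_le uU s by simp
      also have "\<dots> \<le> L * (exp (L * T) * norm h)" using m_le[of s h] s t L_pos by (intro mult_left_mono) auto
      finally show "norm (Dr (y s) (u s) (m h s)) \<le> L * (exp (L * T) * norm h)" .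
    qed
    also have "\<dots> \<le> (L * (exp (L * T) * norm h)) * T" using t L_pos by (intro mult_left_mono) auto
    finally show ?thesis by (simp add: mult_ac)
  qed
  from this[of q] have "norm q * norm q \<le> (L * T * exp (L * T)) * norm q"
    by (simp add: q power2_norm_eq_inner[symmetric] power2_eq_square)
  then have q_le: "norm q \<le> L * T * exp (L * T)"
    using L_pos \<open>T \<ge> 0\<close> by (cases "norm q = 0") auto
  have err: "norm (y' s - y s - m (x' - x) s) \<le> L * T * exp (3 * L * T) * (norm (x' - x))\<^sup>2"
    if y': "traj x' u y'" and s: "0 \<le> s" "s \<le> T" for x' y' s
  proof -
    define h where "h = x' - x"
    define w where "w s = y' s - y s - m h s" for s
    have y'c: "continuous_on {0..} y'" by (rule traj_continuous[OF y'])
    have wc: "continuous_on {0..} w" unfolding w_def by (intro continuous_intros mc yc y'c)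
    have "norm (w s) \<le> (L * exp (2 * L * T) * (norm h)\<^sup>2 * T) * exp (L * s)"
    proof (rule variational_growth[OF y wc s(1)])
      fix \<sigma> assume \<sigma>: "0 \<le> \<sigma>" "\<sigma> \<le> s"
      define \<rho> where "\<rho> \<sigma> = f (y' \<sigma>) (u \<sigma>) - f (y \<sigma>) (u \<sigma>) - Df (y \<sigma>) (u \<sigma>) (y' \<sigma> - y \<sigma>)" for \<sigma>
      have dc: "continuous_on {0..} (\<lambda>s. y' s - y s)" by (intro continuous_intros yc y'c)
      have \<rho>i: "\<rho> integrable_on {0..\<sigma>}"
        unfolding \<rho>_def by (intro integrable_diff f_integrable[OF y] f_integrable[OF y'] \<sigma> Di[OF dc])
      have "w \<sigma> - integral {0..\<sigma>} (\<lambda>\<sigma>. Df (y \<sigma>) (u \<sigma>) (w \<sigma>)) = integral {0..\<sigma>} \<rho>"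
      proof -
        have "integral {0..\<sigma>} (\<lambda>\<sigma>. Df (y \<sigma>) (u \<sigma>) (w \<sigma>))
          = integral {0..\<sigma>} (\<lambda>\<sigma>. Df (y \<sigma>) (u \<sigma>) (y' \<sigma> - y \<sigma>)) - integral {0..\<sigma>} (\<lambda>\<sigma>. Df (y \<sigma>) (u \<sigma>) (m h \<sigma>))"
          unfolding w_def blinfun.diff_right[of _ "y' _ - y _"] by (rule integral_diff[OF Di[OF dc] Di[OF mc]])
        moreover have "integral {0..\<sigma>} \<rho> = integral {0..\<sigma>} (\<lambda>\<sigma>. f (y' \<sigma>) (u \<sigma>)) - integral {0..\<sigma>} (\<lambda>\<sigma>. f (y \<sigma>) (u \<sigma>))
            - integral {0..\<sigma>} (\<lambda>\<sigma>. Df (y \<sigma>) (u \<sigma>) (y' \<sigma> - y \<sigma>))"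
          unfolding \<rho>_def
          using integral_diff[OF integrable_diff[OF f_integrable[OF y' \<sigma>(1)] f_integrable[OF y \<sigma>(1)]] Di[OF dc]]
            integral_diff[OF f_integrable[OF y' \<sigma>(1)] f_integrable[OF y \<sigma>(1)]] by simp
        ultimately show ?thesis
          using traj_eq[OF y \<sigma>(1)] traj_eq[OF y' \<sigma>(1)] m[OF \<sigma>(1), of h] by (simp add: w_def h_def)
      qed
      moreover have "norm (integral {0..\<sigma>} \<rho>) \<le> (L * exp (2 * L * T) * (norm h)\<^sup>2) * (\<sigma> - 0)"
      proof (rule norm_integral_le_const[OF \<rho>i \<sigma>(1)])
        fix a assume a: "a \<in> {0..\<sigma>}"
        have "norm (\<rho> a) \<le> L * (norm (y' a - y a))\<^sup>2" unfolding \<rho>_def by (rule f_remainder) (use a uU in auto)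
        also have "\<dots> \<le> L * (norm h * exp (L * T))\<^sup>2"
          using traj_dependence[OF y y', of a T] a \<sigma> s L_pos
          by (intro mult_left_mono power_mono) (auto simp: h_def)
        also have "\<dots> = L * exp (2 * L * T) * (norm h)\<^sup>2"
          using exp_double[of "L * T"] by (simp add: power_mult_distrib mult.assoc)
        finally show "norm (\<rho> a) \<le> L * exp (2 * L * T) * (norm h)\<^sup>2" .
      qed
      moreover have "(L * exp (2 * L * T) * (norm h)\<^sup>2) * (\<sigma> - 0) \<le> (L * exp (2 * L * T) * (norm h)\<^sup>2) * T"
        using \<sigma> s L_pos by (intro mult_left_mono) auto
      ultimately show "norm (w \<sigma> - integral {0..\<sigma>} (\<lambda>\<sigma>. Df (y \<sigma>) (u \<sigma>) (w \<sigma>))) \<le> L * exp (2 * L * T) * (norm h)\<^sup>2 * T"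
        by simp
    qed
    also have "\<dots> \<le> (L * exp (2 * L * T) * (norm h)\<^sup>2 * T) * exp (L * T)"
      using s L_pos by (intro mult_left_mono) auto
    also have "\<dots> = L * T * (exp (2 * L * T) * exp (L * T)) * (norm h)\<^sup>2" by simp
    also have "exp (2 * L * T) * exp (L * T) = exp (3 * L * T)" by (simp add: mult_exp_exp)
    finally show ?thesis by (simp add: w_def h_def)
  qed
  show ?thesis
  proof (rule that[of M q])
    fix x' y' assume y': "traj x' u y'"
    have y'c: "continuous_on {0..} y'" by (rule traj_continuous[OF y'])
    define h where "h = x' - x"
    define E where "E = L * T * exp (3 * L * T)"
    have "E \<ge> 0" using L_pos \<open>T \<ge> 0\<close> by (simp add: E_def)
    have split: "lin_const T * (norm h)\<^sup>2 = E * (norm h)\<^sup>2 + (L * exp (2 * L * T) * (norm h)\<^sup>2 + L * (E * (norm h)\<^sup>2)) * T"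
      by (simp add: lin_const_def E_def algebra_simps)
    have nn: "0 \<le> E * (norm h)\<^sup>2" "0 \<le> (L * exp (2 * L * T) * (norm h)\<^sup>2 + L * (E * (norm h)\<^sup>2)) * T"
      using \<open>E \<ge> 0\<close> L_pos \<open>T \<ge> 0\<close> by auto
    show "norm (y' t - y t - M (x' - x)) \<le> lin_const T * (norm (x' - x))\<^sup>2"
      using err[OF y' t] split nn by (simp add: M_def h_def E_def)
    define \<rho> where "\<rho> \<sigma> = r (y' \<sigma>) (u \<sigma>) - r (y \<sigma>) (u \<sigma>) - Dr (y \<sigma>) (u \<sigma>) (m h \<sigma>)" for \<sigma>
    have \<rho>i: "\<rho> integrable_on {0..t}"
      unfolding \<rho>_def by (intro integrable_diff r_integrable[OF y] r_integrable[OF y'] Dri[OF mc])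
    have "rcost u y' t - rcost u y t - q \<bullet> h = integral {0..t} \<rho>"
      unfolding \<rho>_def rcost_def q[symmetric] ell_def
      using integral_diff[OF integrable_diff[OF r_integrable[OF y'] r_integrable[OF y]] Dri[OF mc]]
            integral_diff[OF r_integrable[OF y'] r_integrable[OF y]] by simp
    moreover have "norm (integral {0..t} \<rho>) \<le> (L * exp (2 * L * T) * (norm h)\<^sup>2 + L * (E * (norm h)\<^sup>2)) * (t - 0)"
    proof (rule norm_integral_le_const[OF \<rho>i t(1)])
      fix a assume a: "a \<in> {0..t}"
      \<comment> \<open>Two sources of error: the remainder of \<open>r\<close>, and the replacement
        of \<open>y' - y\<close> by its linearisation.\<close>
      have "\<rho> a = (r (y' a) (u a) - r (y a) (u a) - Dr (y a) (u a) (y' a - y a)) + Dr (y a) (u a) (y' a - y a - m h a)"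
        by (simp add: \<rho>_def blinfun.diff_right)
      then have "norm (\<rho> a) \<le> norm (r (y' a) (u a) - r (y a) (u a) - Dr (y a) (u a) (y' a - y a)) + norm (Dr (y a) (u a) (y' a - y a - m h a))"
        by (metis norm_triangle_ineq)
      also have "\<dots> \<le> L * (norm (y' a - y a))\<^sup>2 + L * norm (y' a - y a - m h a)"
        by (intro add_mono r_remainder Dr_le) (use a uU in auto)
      also have "\<dots> \<le> L * (norm h * exp (L * T))\<^sup>2 + L * (E * (norm h)\<^sup>2)"
        using traj_dependence[OF y y', of a T] err[OF y', of a] a t L_pos
        by (intro add_mono mult_left_mono power_mono) (auto simp: h_def E_def)
      also have "L * (norm h * exp (L * T))\<^sup>2 = L * exp (2 * L * T) * (norm h)\<^sup>2"
        using exp_double[of "L * T"] by (simp add: power_mult_distrib mult.assoc)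
      finally show "norm (\<rho> a) \<le> L * exp (2 * L * T) * (norm h)\<^sup>2 + L * (E * (norm h)\<^sup>2)" .
    qed
    moreover have "(L * exp (2 * L * T) * (norm h)\<^sup>2 + L * (E * (norm h)\<^sup>2)) * (t - 0) \<le> (L * exp (2 * L * T) * (norm h)\<^sup>2 + L * (E * (norm h)\<^sup>2)) * T"
      using t L_pos \<open>E \<ge> 0\<close> by (intro mult_left_mono) auto
    ultimately show "\<bar>rcost u y' t - rcost u y t - q \<bullet> (x' - x)\<bar> \<le> lin_const T * (norm (x' - x))\<^sup>2"
      using split nn by (simp add: h_def)
  qed (use \<open>linear M\<close> q_le in \<open>auto simp: M_def intro: m_le[OF t] m_ge\<close>)
qed

lemma lin_const_nonneg: "0 \<le> T \<Longrightarrow> 0 \<le> lin_const T"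
  using L_pos by (simp add: lin_const_def)

section \<open>The value function\<close>

lemma first_hit:
  assumes y: "traj x u y" and "0 \<le> t" "y t \<in> S"
  obtains \<tau> where "0 \<le> \<tau>" "\<tau> \<le> t" "y \<tau> \<in> S" "\<And>\<sigma>. 0 \<le> \<sigma> \<Longrightarrow> \<sigma> < \<tau> \<Longrightarrow> y \<sigma> \<notin> S"
proof -
  have "closed ({0..t} \<inter> y -` S)"
    by (rule continuous_closed_preimage[OF continuous_on_subset[OF traj_continuous[OF y]] _ S_closed]) auto
  then have "compact ({0..t} \<inter> y -` S)"
    using compact_Int_closed[OF compact_Icc[of 0 t]] by (metis Int_absorb2 Int_lower1 inf_commute)
  moreover have "{0..t} \<inter> y -` S \<noteq> {}" using assms by auto
  ultimately obtain \<tau> where "\<tau> \<in> {0..t} \<inter> y -` S" "\<And>\<sigma>. \<sigma> \<in> {0..t} \<inter> y -` S \<Longrightarrow> \<tau> \<le> \<sigma>"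
    using compact_attains_inf by metis
  then show ?thesis by (intro that[of \<tau>]) fastforce+
qed

lemma exit_time_eq:
  assumes "0 \<le> \<tau>" "y \<tau> \<in> S" "\<And>\<sigma>. 0 \<le> \<sigma> \<Longrightarrow> \<sigma> < \<tau> \<Longrightarrow> y \<sigma> \<notin> S"
  shows "exit_time S y = ereal \<tau>"
proof -
  have "(LEAST t. 0 \<le> t \<and> y t \<in> S) = \<tau>"
    by (rule Least_equality) (use assms in \<open>auto simp: not_less[symmetric]\<close>)
  then show ?thesis using assms by (auto simp: exit_time_def)
qed

lemma admissibleE:
  assumes "admissible U S f x u y"
  obtains \<tau> where "traj x u y" "0 \<le> \<tau>" "y \<tau> \<in> S" "\<And>\<sigma>. 0 \<le> \<sigma> \<Longrightarrow> \<sigma> < \<tau> \<Longrightarrow> y \<sigma> \<notin> S"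
    "exit_time S y = ereal \<tau>" "cost S r g u y = rcost u y \<tau> + g (y \<tau>)"
proof -
  have y: "traj x u y" using assms by (simp add: admissible_def traj_def)
  obtain t where "0 \<le> t" "y t \<in> S" using assms by (auto simp: admissible_def exit_time_def split: if_splits)
  then obtain \<tau> where \<tau>: "0 \<le> \<tau>" "y \<tau> \<in> S" "\<And>\<sigma>. 0 \<le> \<sigma> \<Longrightarrow> \<sigma> < \<tau> \<Longrightarrow> y \<sigma> \<notin> S"
    using first_hit[OF y] by metis
  note e = exit_time_eq[of \<tau> y, OF \<tau>]
  show ?thesis by (rule that[OF y \<tau> e]) (simp_all add: cost_def e rcost_def)
qed

lemma V_le_cost:
  assumes "traj x u y" "0 \<le> \<tau>" "y \<tau> \<in> S" "\<And>\<sigma>. 0 \<le> \<sigma> \<Longrightarrow> \<sigma> < \<tau> \<Longrightarrow> y \<sigma> \<notin> S"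
  shows "V x \<le> rcost u y \<tau> + g (y \<tau>)"
proof -
  have e: "exit_time S y = ereal \<tau>" using assms by (intro exit_time_eq) auto
  have "admissible U S f x u y" using assms e by (simp add: admissible_def traj_def)
  then have "value_function U S f r g x \<le> ereal (cost S r g u y)"
    unfolding value_function_def by (intro INF_lower2[of "(u, y)"]) auto
  then show ?thesis by (simp add: value_eq cost_def e rcost_def)
qed

lemma near_optimal:
  assumes "\<epsilon> > 0"
  obtains u y \<tau> where "traj x u y" "0 \<le> \<tau>" "y \<tau> \<in> S" "\<And>\<sigma>. 0 \<le> \<sigma> \<Longrightarrow> \<sigma> < \<tau> \<Longrightarrow> y \<sigma> \<notin> S"
    "rcost u y \<tau> + g (y \<tau>) < V x + \<epsilon>"
proof -
  have "value_function U S f r g x < ereal (V x + \<epsilon>)" using assms by (simp add: value_eq)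
  then obtain u y where uy: "admissible U S f x u y" "ereal (cost S r g u y) < ereal (V x + \<epsilon>)"
    unfolding value_function_def INF_less_iff by auto
  from admissibleE[OF uy(1)] that uy(2) show ?thesis by (metis ereal_less_eq(3) less_ereal.simps(1))
qed

text \<open>Lets the terminal cost be read as a value, so that dynamic programming may end on the
  target.\<close>

lemma V_on_S: assumes "x \<in> S" shows "V x = g x"
proof (rule antisym)
  obtain \<omega> where "\<omega> \<in> U" using U_ne by blast
  obtain y where y: "traj x (\<lambda>_. \<omega>) y" using traj_exists[OF control_const[OF \<open>\<omega> \<in> U\<close>]] .
  show "V x \<le> g x" using V_le_cost[OF y, of 0] traj_0[OF y] assms by simp
  show "g x \<le> V x"
  proof (rule field_le_epsilon)
    fix e :: real assume "e > 0"
    obtain u y \<tau> where *: "traj x u y" "0 \<le> \<tau>" "\<And>\<sigma>. 0 \<le> \<sigma> \<Longrightarrow> \<sigma> < \<tau> \<Longrightarrow> y \<sigma> \<notin> S" "rcost u y \<tau> + g (y \<tau>) < V x + e"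
      using near_optimal[OF \<open>e > 0\<close>, of x] by metis
    have "\<tau> = 0" using *(3)[of 0] *(2) traj_0[OF *(1)] assms by force
    then show "g x \<le> V x + e" using * traj_0[OF *(1)] by simp
  qed
qed

text \<open>Follows the trajectory up to \<open>t\<close> and a near-optimal one from
  \<open>y t\<close> on. Only times before \<open>t\<close> have to avoid the target, so
  \<open>y t\<close> may lie on it; with \<open>V_on_S\<close> this compares \<open>V (y s)\<close>
  with the actual remaining cost.\<close>

lemma dynamic_programming:
  assumes y: "traj x u y" and st: "0 \<le> s" "s \<le> t" and out: "\<And>\<sigma>. s \<le> \<sigma> \<Longrightarrow> \<sigma> < t \<Longrightarrow> y \<sigma> \<notin> S"
  shows "V (y s) \<le> rcost u y t - rcost u y s + V (y t)"
proof (rule field_le_epsilon)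
  fix e :: real assume "e > 0"
  obtain v w \<tau> where w: "traj (y t) v w" "0 \<le> \<tau>" "w \<tau> \<in> S" "\<And>\<sigma>. 0 \<le> \<sigma> \<Longrightarrow> \<sigma> < \<tau> \<Longrightarrow> w \<sigma> \<notin> S" "rcost v w \<tau> + g (w \<tau>) < V (y t) + e"
    using near_optimal[OF \<open>e > 0\<close>, of "y t"] by metis
  define us ys where "us = (\<lambda>\<sigma>. u (s + \<sigma>))" and "ys = (\<lambda>\<sigma>. y (s + \<sigma>))"
  have s1: "traj (y s) us ys" unfolding us_def ys_def by (rule traj_shift[OF y st(1)])
  have w': "traj (ys (t - s)) v w" using w(1) by (simp add: ys_def)
  define uv where "uv = (\<lambda>\<sigma>. if \<sigma> < t - s then us \<sigma> else v (\<sigma> - (t - s)))"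
  define yw where "yw = (\<lambda>\<sigma>. if \<sigma> < t - s then ys \<sigma> else w (\<sigma> - (t - s)))"
  have ts: "0 \<le> t - s" using st by simp
  note c = traj_concat[OF s1 ts w', folded uv_def yw_def]
  have "V (y s) \<le> rcost uv yw (t - s + \<tau>) + g (yw (t - s + \<tau>))"
  proof (rule V_le_cost[OF c(1)])
    show "0 \<le> t - s + \<tau>" using ts w(2) by simp
    show "yw (t - s + \<tau>) \<in> S" using w(2,3) by (simp add: yw_def)
    fix \<sigma> assume \<sigma>: "0 \<le> \<sigma>" "\<sigma> < t - s + \<tau>"
    show "yw \<sigma> \<notin> S"
    proof (cases "\<sigma> < t - s")
      case True then show ?thesis using out[of "s + \<sigma>"] \<sigma> by (simp add: yw_def ys_def)
    next
      case False then show ?thesis using w(4)[of "\<sigma> - (t - s)"] \<sigma> by (simp add: yw_def)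
    qed
  qed
  also have "yw (t - s + \<tau>) = w \<tau>" using w(2) by (simp add: yw_def)
  also have "rcost uv yw (t - s + \<tau>) = rcost us ys (t - s) + rcost v w \<tau>"
    using c(4)[of "t - s + \<tau>"] w(2) by simp
  also have "rcost us ys (t - s) = rcost u y t - rcost u y s"
    unfolding us_def ys_def using rcost_shift[OF y st(1) ts] by simp
  finally show "V (y s) \<le> rcost u y t - rcost u y s + V (y t) + e" using w(5) by simp
qed

lemma first_hit_frontier:
  assumes y: "traj x u y" and "0 < \<tau>" "y \<tau> \<in> S" and out: "\<And>\<sigma>. 0 \<le> \<sigma> \<Longrightarrow> \<sigma> < \<tau> \<Longrightarrow> y \<sigma> \<notin> S"
  shows "y \<tau> \<in> frontier S"
proof -
  have "y \<tau> \<in> closure (- S)"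
    unfolding closure_approachable
  proof (intro allI impI)
    fix e :: real assume "e > 0"
    define \<sigma> where "\<sigma> = max 0 (\<tau> - e / (2 * N))"
    have \<sigma>: "0 \<le> \<sigma>" "\<sigma> < \<tau>" "\<tau> - \<sigma> \<le> e / (2 * N)" using \<open>0 < \<tau>\<close> \<open>e > 0\<close> N_pos by (auto simp: \<sigma>_def)
    have "norm (y \<sigma> - y \<tau>) \<le> N * \<bar>\<sigma> - \<tau>\<bar>" by (rule traj_lipschitz[OF y]) (use \<sigma> in auto)
    also have "\<dots> \<le> N * (e / (2 * N))" using \<sigma> N_pos by (intro mult_left_mono) auto
    also have "\<dots> < e" using N_pos \<open>e > 0\<close> by simp
    finally show "\<exists>z\<in>- S. dist z (y \<tau>) < e" using out[OF \<sigma>(1,2)] by (auto simp: dist_norm)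
  qed
  then show ?thesis using assms(3) by (simp add: frontier_closures S_closed)
qed

text \<open>No trajectory gains by going on after its first hit, since \<open>G * N < r0\<close>.\<close>

lemma V_le_cost_later:
  assumes y: "traj x u y" and "x \<notin> S" "0 \<le> t" "y t \<in> S" "y t \<in> W"
  shows "V x \<le> rcost u y t + g (y t)"
proof -
  obtain \<tau> where \<tau>: "0 \<le> \<tau>" "\<tau> \<le> t" "y \<tau> \<in> S" and out: "\<And>\<sigma>. 0 \<le> \<sigma> \<Longrightarrow> \<sigma> < \<tau> \<Longrightarrow> y \<sigma> \<notin> S"
    using first_hit[OF y assms(3,4)] by metis
  have "\<tau> \<noteq> 0" using \<tau> traj_0[OF y] \<open>x \<notin> S\<close> by auto
  then have "y \<tau> \<in> W" using first_hit_frontier[OF y _ \<tau>(3) out] \<tau> frontier_W by auto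
  then have "g (y \<tau>) \<le> g (y t) + G * norm (y \<tau> - y t)" using g_lip[of "y t" "y \<tau>"] assms by auto
  moreover have "G * norm (y \<tau> - y t) \<le> G * (N * (t - \<tau>))"
    using traj_lipschitz[OF y, of t \<tau>] \<tau> G_nonneg by (intro mult_left_mono) auto
  moreover have "G * (N * (t - \<tau>)) \<le> r0 * (t - \<tau>)"
    using G_less \<tau> mult_right_mono[of "G * N" r0 "t - \<tau>"] by (simp add: mult.assoc)
  ultimately show ?thesis using V_le_cost[OF y \<tau>(1,3) out] rcost_ge[OF y \<tau>(1,2)] by simp
qed

end

section \<open>Approximate normals to the hypograph\<close>

lemma inner_integral_right:
  fixes F :: "real \<Rightarrow> 'a::euclidean_space"
  assumes "F integrable_on A"
  shows "(\<lambda>s. v \<bullet> F s) integrable_on A" "integral A (\<lambda>s. v \<bullet> F s) = v \<bullet> integral A F"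
  using integrable_linear[OF assms bounded_linear_inner_right[of v]]
    integral_linear[OF assms bounded_linear_inner_right[of v]] by (simp_all add: comp_def)

lemma integral_increment_ge:
  fixes \<phi> :: "real \<Rightarrow> real"
  assumes int: "\<phi> integrable_on {0..t}" and st: "0 \<le> s" "s \<le> t" and le: "\<And>x. s \<le> x \<Longrightarrow> x \<le> t \<Longrightarrow> B \<le> \<phi> x"
  shows "B * (t - s) \<le> integral {0..t} \<phi> - integral {0..s} \<phi>"
proof -
  have "integral {0..t} \<phi> - integral {0..s} \<phi> = integral {s..t} \<phi>"
    using Henstock_Kurzweil_Integration.integral_combine[OF st int] by simp
  moreover have "integral {s..t} (\<lambda>_. B) \<le> integral {s..t} \<phi>"
    by (rule integral_le) (use assms in \<open>auto intro: integrable_on_subinterval[OF int]\<close>)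
  ultimately show ?thesis using st by (simp add: mult.commute)
qed

text \<open>The lower bound makes \<open>M\<close> injective, hence surjective in finite dimension,
  so every \<open>v\<close> is some \<open>M h\<close> with \<open>h\<close> controlled; testing the
  adjoint against this \<open>h\<close> gives its lower bound.\<close>

lemma adjoint_bounds:
  fixes M :: "'a::euclidean_space \<Rightarrow> 'a"
  assumes "linear M" and up: "\<And>h. norm (M h) \<le> e * norm h" and low: "\<And>h. norm h \<le> e * norm (M h)" and "e > 0"
  shows "norm (adjoint M v) \<le> e * norm v" "norm v \<le> e * norm (adjoint M v)"
proof -
  let ?w = "adjoint M v"
  have adj: "?w \<bullet> h = v \<bullet> M h" for h
    using adjoint_works[OF \<open>linear M\<close>, of h v] by (simp add: inner_commute)
  have "norm ?w * norm ?w = v \<bullet> M ?w" using adj[of ?w] by (simp add: power2_norm_eq_inner[symmetric] power2_eq_square)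
  also have "\<dots> \<le> norm v * norm (M ?w)" by (rule norm_cauchy_schwarz)
  also have "\<dots> \<le> norm v * (e * norm ?w)" using up by (intro mult_left_mono) auto
  finally have "norm ?w * norm ?w \<le> (e * norm v) * norm ?w" by (simp add: mult_ac)
  then show "norm ?w \<le> e * norm v" using \<open>e > 0\<close> by (cases "norm ?w = 0") auto
  have "inj M"
  proof (rule linear_injective_0[OF \<open>linear M\<close>, THEN iffD2, rule_format])
    fix h assume "M h = 0" then show "h = 0" using low[of h] by simp
  qed
  then have "surj M" by (rule linear_inj_imp_surj[OF \<open>linear M\<close>])
  then obtain h where h: "v = M h" by blast
  have "norm v * norm v = ?w \<bullet> h" using adj[of h] h by (simp add: power2_norm_eq_inner[symmetric] power2_eq_square)
  also have "\<dots> \<le> norm ?w * norm h" by (rule norm_cauchy_schwarz)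
  also have "\<dots> \<le> norm ?w * (e * norm v)" using low[of h] h by (intro mult_left_mono) auto
  finally have "norm v * norm v \<le> (e * norm ?w) * norm v" by (simp add: mult_ac)
  then show "norm v \<le> e * norm ?w" using \<open>e > 0\<close> by (cases "norm v = 0") auto
qed

text \<open>Subtracting \<open>c |y - z|^2\<close> cancels the defect exactly, by the quadratic
  identity for convex combinations; what remains is concave.\<close>

lemma semiconcave_supergradient:
  fixes g :: "'a::euclidean_space \<Rightarrow> real"
  assumes "\<delta> > 0"
    and semi: "\<And>x y l. x \<in> ball z \<delta> \<Longrightarrow> y \<in> ball z \<delta> \<Longrightarrow> 0 \<le> l \<Longrightarrow> l \<le> 1 \<Longrightarrow>
      (1 - l) * g x + l * g y - g ((1 - l) *\<^sub>R x + l *\<^sub>R y) \<le> c * l * (1 - l) * (norm (x - y))\<^sup>2"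
  obtains p where "supergrad_on g (ball z \<delta>) c z p"
proof -
  define h where "h y = g y - c * (norm (y - z))\<^sup>2" for y
  have "(1 - l) * h x + l * h y \<le> h ((1 - l) *\<^sub>R x + l *\<^sub>R y)"
    if "x \<in> ball z \<delta>" "y \<in> ball z \<delta>" "0 \<le> l" "l \<le> 1" for x y l
  proof -
    have "(1 - l) *\<^sub>R x + l *\<^sub>R y - z = (1 - l) *\<^sub>R (x - z) + l *\<^sub>R (y - z)" by (simp add: algebra_simps)
    moreover have "x - y = (x - z) - (y - z)" by simp
    ultimately have "(norm ((1 - l) *\<^sub>R x + l *\<^sub>R y - z))\<^sup>2 = (1 - l) * (norm (x - z))\<^sup>2 + l * (norm (y - z))\<^sup>2 - l * (1 - l) * (norm (x - y))\<^sup>2"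
      unfolding power2_norm_eq_inner
      by (simp only: inner_add_left inner_add_right inner_diff_left inner_diff_right inner_scaleR_left inner_scaleR_right inner_commute[of "y - z" "x - z"])
        (simp add: algebra_simps inner_commute)
    then have "c * (norm ((1 - l) *\<^sub>R x + l *\<^sub>R y - z))\<^sup>2 = c * ((1 - l) * (norm (x - z))\<^sup>2 + l * (norm (y - z))\<^sup>2 - l * (1 - l) * (norm (x - y))\<^sup>2)"
      by simp
    then show ?thesis using semi[OF that] by (simp add: h_def algebra_simps)
  qed
  then obtain v where "\<And>y. y \<in> ball z \<delta> \<Longrightarrow> h y \<le> h z + v \<bullet> (y - z)"
    using concave_supergradient[OF \<open>\<delta> > 0\<close>, of z h] by metis
  then have "supergrad_on g (ball z \<delta>) c z v"
    by (force simp: supergrad_on_def h_def)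
  then show ?thesis by (rule that)
qed

lemma supergradient_norm_le_lipschitz:
  fixes g :: "'a::euclidean_space \<Rightarrow> real"
  assumes p: "supergrad_on g (ball z \<delta>) c z p" and "\<delta> > 0"
    and lip: "\<And>y. y \<in> ball z \<delta> \<Longrightarrow> \<bar>g y - g z\<bar> \<le> G * norm (y - z)" and "G \<ge> 0"
  shows "norm p \<le> G"
proof (cases "p = 0")
  case False
  have "norm p - G \<le> 0"
  proof (rule le_zero_if_le_small_multiples)
    show "\<delta> / norm p > 0" using False \<open>\<delta> > 0\<close> by simp
    fix \<theta> :: real assume \<theta>: "0 < \<theta>" "\<theta> < \<delta> / norm p"
    \<comment> \<open>Moving against \<open>p\<close> forces \<open>g\<close> down at rate
      \<open>norm p\<close>, while the Lipschitz bound allows only the rate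
      \<open>G\<close>.\<close>
    define y where "y = z - \<theta> *\<^sub>R p"
    have "\<theta> * norm p < \<delta>" using \<theta> False by (simp add: less_divide_eq)
    then have y: "y \<in> ball z \<delta>" using \<theta> by (simp add: y_def dist_norm)
    have "g y \<le> g z - \<theta> * (norm p)\<^sup>2 + c * (\<theta> * norm p)\<^sup>2"
      using supergrad_onD[OF p y] \<theta> by (simp add: y_def power2_norm_eq_inner)
    moreover have "g y \<ge> g z - G * (\<theta> * norm p)"
      using lip[OF y] \<theta> by (simp add: y_def abs_le_iff)
    ultimately have "(\<theta> * norm p) * (norm p - G) \<le> (\<theta> * norm p) * (\<theta> * (c * norm p))"
      by (simp add: power2_eq_square algebra_simps)
    then show "norm p - G \<le> \<theta> * (c * norm p)" using \<theta> False by simp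
  qed
  then show ?thesis by simp
qed (use \<open>G \<ge> 0\<close> in simp)

section \<open>Conditions at the end point of a trajectory, and the normal inequality they imply at
  its start\<close>

context exit_time_problem
begin

text \<open>The terminal part of the maximum principle: the Hamiltonian vanishes for the costate
  \<open>l *\<^sub>R pg - (1 - l) *\<^sub>R \<xi>\<close> with cost multiplier \<open>l\<close>, and
  \<omega> attains it. This \<omega> is recorded because the trajectory will be continued past its
  end. Radius \<delta> and constant \<open>c\<close> are parameters so that they can be uniform in
  \<open>z\<close>.\<close>

definition end_data :: "real \<Rightarrow> real \<Rightarrow> 'a \<Rightarrow> 'a \<Rightarrow> 'a \<Rightarrow> real \<Rightarrow> 'b \<Rightarrow> bool" where
  "end_data \<delta> c z \<xi> pg l \<omega> \<longleftrightarrow> norm \<xi> = 1 \<and> (\<forall>y\<in>closure (- S). \<xi> \<bullet> (y - z) \<le> K0 * (norm (y - z))\<^sup>2) \<and>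
    ball z \<delta> \<subseteq> W \<and> norm pg \<le> G \<and> supergrad_on g (ball z \<delta>) c z pg \<and> 0 \<le> l \<and> l \<le> 1 \<and> \<omega> \<in> U \<and>
    (\<forall>w\<in>U. (1 - l) * (\<xi> \<bullet> f z w) \<le> l * (pg \<bullet> f z w + r z w)) \<and>
    (1 - l) * (\<xi> \<bullet> f z \<omega>) = l * (pg \<bullet> f z \<omega> + r z \<omega>)"

text \<open>End points of near-optimal trajectories vary, so one radius and one constant must serve
  for all of them in a compact set; a finite cover provides both.\<close>

lemma terminal_regularity:
  assumes "compact K"
  obtains \<delta> c where "\<delta> > 0" "c > 0"
    "\<And>z. z \<in> K \<Longrightarrow> z \<in> frontier S \<Longrightarrow> ball z \<delta> \<subseteq> W \<and> (\<exists>pg. norm pg \<le> G \<and> supergrad_on g (ball z \<delta>) c z pg)"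
proof -
  have "\<exists>d c. d > 0 \<and> c > 0 \<and> (\<forall>z\<in>ball z0 d. ball z d \<subseteq> W \<and> (\<exists>pg. norm pg \<le> G \<and> supergrad_on g (ball z d) c z pg))"
    if z0: "z0 \<in> frontier S" for z0
  proof -
    obtain \<delta>1 where \<delta>1: "\<delta>1 > 0" "ball z0 \<delta>1 \<subseteq> W"
      using W_open frontier_W z0 open_contains_ball by blast
    obtain \<delta>0 c where \<delta>0: "\<delta>0 > 0" "c > 0" and semi: "\<And>x0 x1 l. x0\<in>ball z0 \<delta>0 \<Longrightarrow> x1\<in>ball z0 \<delta>0 \<Longrightarrow> l\<in>{0..1} \<Longrightarrow>
        (1 - l) * g x0 + l * g x1 - g ((1 - l) *\<^sub>R x0 + l *\<^sub>R x1) \<le> c * l * (1 - l) * (norm (x0 - x1))\<^sup>2"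
      using g_semiconcave unfolding locally_semiconcave_def by metis
    \<comment> \<open>Halved so that a ball of radius \<open>d\<close> about any \<open>z\<close>
      within \<open>d\<close> of \<open>z0\<close> stays inside both balls.\<close>
    define d where "d = min \<delta>0 \<delta>1 / 2"
    have d: "d > 0" "2 * d \<le> \<delta>0" "2 * d \<le> \<delta>1" using \<delta>0 \<delta>1 by (auto simp: d_def)
    have "ball z d \<subseteq> W \<and> (\<exists>pg. norm pg \<le> G \<and> supergrad_on g (ball z d) c z pg)" if z: "z \<in> ball z0 d" for z
    proof -
      have sub: "ball z d \<subseteq> ball z0 \<delta>0" "ball z d \<subseteq> ball z0 \<delta>1"
        using z d by (auto simp: ball_subset_ball_iff dist_commute)
      obtain pg where pg: "supergrad_on g (ball z d) c z pg"
        using semiconcave_supergradient[OF d(1), of z g c] semi sub(1) by (metis atLeastAtMost_iff subsetD)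
      have "norm pg \<le> G"
        by (rule supergradient_norm_le_lipschitz[OF pg d(1) _ G_nonneg])
          (use g_lip sub \<delta>1 d in \<open>auto intro!: g_lip simp: subset_iff\<close>)
      then show ?thesis using pg sub \<delta>1 by blast
    qed
    then show ?thesis using d \<delta>0 by blast
  qed
  then obtain d cc where dc: "\<And>z0. z0 \<in> frontier S \<Longrightarrow> d z0 > 0 \<and> cc z0 > 0 \<and>
      (\<forall>z\<in>ball z0 (d z0). ball z (d z0) \<subseteq> W \<and> (\<exists>pg. norm pg \<le> G \<and> supergrad_on g (ball z (d z0)) (cc z0) z pg))"
    by metis
  have "compact (K \<inter> frontier S)" using assms by (intro compact_Int_closed) auto
  moreover have "K \<inter> frontier S \<subseteq> (\<Union>z0\<in>K \<inter> frontier S. ball z0 (d z0))" using dc by force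
  ultimately obtain D where D: "D \<subseteq> K \<inter> frontier S" "finite D" "K \<inter> frontier S \<subseteq> (\<Union>z0\<in>D. ball z0 (d z0))"
    by (rule compactE_image[OF _ open_ball])
  define \<delta> where "\<delta> = Min (insert 1 (d ` D))"
  define c where "c = Max (insert 1 (cc ` D))"
  show ?thesis
  proof (rule that[of \<delta> c])
    show "\<delta> > 0" unfolding \<delta>_def using D dc by (subst Min_gr_iff) auto
    show "c > 0" unfolding c_def using D by (subst Max_gr_iff) auto
    fix z assume "z \<in> K" "z \<in> frontier S"
    then obtain z0 where z0: "z0 \<in> D" "z \<in> ball z0 (d z0)" using D by blast
    have le: "\<delta> \<le> d z0" "cc z0 \<le> c" using D z0 by (auto simp: \<delta>_def c_def)
    from dc[of z0] z0 D obtain pg where pg: "ball z (d z0) \<subseteq> W" "norm pg \<le> G" "supergrad_on g (ball z (d z0)) (cc z0) z pg"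
      by blast
    have "supergrad_on g (ball z \<delta>) c z pg"
      unfolding supergrad_on_def
    proof
      fix y assume "y \<in> ball z \<delta>"
      then have "g y \<le> g z + pg \<bullet> (y - z) + cc z0 * (norm (y - z))\<^sup>2"
        using le by (intro supergrad_onD[OF pg(3)]) auto
      also have "\<dots> \<le> g z + pg \<bullet> (y - z) + c * (norm (y - z))\<^sup>2"
        using le by (simp add: mult_right_mono)
      finally show "g y \<le> g z + pg \<bullet> (y - z) + c * (norm (y - z))\<^sup>2" .
    qed
    moreover have "ball z \<delta> \<subseteq> W" using pg(1) le by (meson subset_ball subset_trans)
    ultimately show "ball z \<delta> \<subseteq> W \<and> (\<exists>pg. norm pg \<le> G \<and> supergrad_on g (ball z \<delta>) c z pg)" using pg(2) by blast
  qed
qed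

text \<open>To first order \<open>pg \<bullet> f z w + r z w\<close> is the rate at which the total
  cost grows when stopping is delayed. Its positive lower bound makes the stopping time a usable
  parameter.\<close>

lemma terminal_rate_ge:
  assumes "norm pg \<le> G" "w \<in> U"
  shows "r0 - G * N \<le> pg \<bullet> f z w + r z w"
proof -
  have "\<bar>pg \<bullet> f z w\<bar> \<le> norm pg * norm (f z w)" by (rule Cauchy_Schwarz_ineq2)
  also have "\<dots> \<le> G * N" using assms f_le G_nonneg by (intro mult_mono) auto
  finally show ?thesis using r_ge[OF assms(2), of z] by linarith
qed

lemma f_cont_fixed: "continuous_on U (\<lambda>w. f x w)"
proof -
  have "continuous_on U (\<lambda>w. (x, w))" by (intro continuous_intros)
  from continuous_on_compose2[OF f_cont this] show ?thesis by auto
qed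

lemma r_cont_fixed: "continuous_on U (\<lambda>w. r x w)"
proof -
  have "continuous_on U (\<lambda>w. (x, w))" by (intro continuous_intros)
  from continuous_on_compose2[OF r_cont this] show ?thesis by auto
qed

text \<open>A trajectory that arrives from outside cannot be pushed back by every available
  velocity. As the control is only measurable, the velocity at \<tau> need not exist; the integral
  over a short interval before \<tau> is compared with the best velocity at \<open>z\<close>
  instead.\<close>

lemma entering_velocity:
  assumes y: "traj x u y" and "0 < \<tau>" "y \<tau> = z" and out: "\<And>\<sigma>. 0 \<le> \<sigma> \<Longrightarrow> \<sigma> < \<tau> \<Longrightarrow> y \<sigma> \<notin> S"
    and \<xi>: "norm \<xi> = 1" "\<And>y. y \<in> closure (- S) \<Longrightarrow> \<xi> \<bullet> (y - z) \<le> K0 * (norm (y - z))\<^sup>2"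
  obtains w where "w \<in> U" "0 \<le> \<xi> \<bullet> f z w"
proof -
  obtain \<omega> where \<omega>: "\<omega> \<in> U" "\<And>w. w \<in> U \<Longrightarrow> \<xi> \<bullet> f z w \<le> \<xi> \<bullet> f z \<omega>"
    using continuous_attains_sup[OF U_compact U_ne continuous_on_inner[OF continuous_on_const f_cont_fixed], of \<xi> z]
    by blast
  have "- (\<xi> \<bullet> f z \<omega>) \<le> 0"
  proof (rule le_zero_if_le_small_multiples[OF \<open>0 < \<tau>\<close>])
    fix t assume t: "0 < t" "t < \<tau>"
    define s where "s = \<tau> - t"
    have s: "0 \<le> s" "s < \<tau>" using t by (auto simp: s_def)
    have fi: "(\<lambda>\<sigma>. f (y \<sigma>) (u \<sigma>)) integrable_on {0..a}" if "0 \<le> a" for a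
      by (rule f_integrable[OF y that])
    have i\<xi>: "integral {0..a} (\<lambda>\<sigma>. (- \<xi>) \<bullet> f (y \<sigma>) (u \<sigma>)) = (- \<xi>) \<bullet> (y a - x)" if "0 \<le> a" for a
      using inner_integral_right(2)[OF fi[OF that], of "- \<xi>"] traj_eq[OF y that] by (metis add_diff_cancel_left')
    have "(- (\<xi> \<bullet> f z \<omega>) - L * N * t) * (\<tau> - s) \<le> integral {0..\<tau>} (\<lambda>\<sigma>. (- \<xi>) \<bullet> f (y \<sigma>) (u \<sigma>)) - integral {0..s} (\<lambda>\<sigma>. (- \<xi>) \<bullet> f (y \<sigma>) (u \<sigma>))"
    proof (rule integral_increment_ge)
      show "(\<lambda>\<sigma>. (- \<xi>) \<bullet> f (y \<sigma>) (u \<sigma>)) integrable_on {0..\<tau>}"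
        by (rule inner_integral_right(1)[OF fi]) (use s in simp)
      fix \<sigma> assume \<sigma>: "s \<le> \<sigma>" "\<sigma> \<le> \<tau>"
      have uU: "u \<sigma> \<in> U" using control_in[OF traj_control[OF y]] \<sigma> s by simp
      have "\<xi> \<bullet> (f (y \<sigma>) (u \<sigma>) - f z (u \<sigma>)) \<le> norm \<xi> * norm (f (y \<sigma>) (u \<sigma>) - f z (u \<sigma>))" by (rule norm_cauchy_schwarz)
      also have "\<dots> \<le> L * norm (y \<sigma> - z)" using f_lip[OF uU] \<xi> by simp
      also have "\<dots> \<le> L * (N * t)"
      proof (rule mult_left_mono)
        have "norm (y \<sigma> - y \<tau>) \<le> N * \<bar>\<sigma> - \<tau>\<bar>" by (rule traj_lipschitz[OF y]) (use \<sigma> s in auto)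
        also have "\<dots> \<le> N * t" using \<sigma> N_pos by (intro mult_left_mono) (auto simp: s_def)
        finally show "norm (y \<sigma> - z) \<le> N * t" using assms(3) by simp
      qed (use L_pos in simp)
      finally show "- (\<xi> \<bullet> f z \<omega>) - L * N * t \<le> (- \<xi>) \<bullet> f (y \<sigma>) (u \<sigma>)"
        using \<omega>(2)[OF uU] by (simp add: inner_diff_right)
    qed (use s in auto)
    also have "\<dots> = \<xi> \<bullet> (y s - z)"
      unfolding i\<xi>[OF less_imp_le[OF \<open>0 < \<tau>\<close>]] i\<xi>[OF s(1)] by (simp add: assms(3) inner_diff_right)
    also have "\<dots> \<le> K0 * (norm (y s - z))\<^sup>2"
      by (rule \<xi>(2)[OF subsetD[OF closure_subset]]) (use out[OF s] in simp)
    also have "\<dots> \<le> K0 * (N * t)\<^sup>2"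
      using traj_lipschitz[OF y, of \<tau> s] s K0_nonneg assms(3) by (intro mult_left_mono power_mono) (auto simp: s_def)
    finally have "t * (- (\<xi> \<bullet> f z \<omega>)) \<le> t * (t * (L * N + K0 * N\<^sup>2))"
      by (simp add: s_def power2_eq_square algebra_simps)
    then show "- (\<xi> \<bullet> f z \<omega>) \<le> t * (L * N + K0 * N\<^sup>2)"
      using mult_le_cancel_left_pos[OF t(1)] by blast
  qed
  then show ?thesis using that \<omega>(1) by simp
qed

text \<open>With \<kappa> the maximum of \<open>A / B\<close>, the inequality
  \<open>A \<le> \<kappa> * B\<close> is an equality at the maximiser, and
  \<open>l = \<kappa> / (1 + \<kappa>)\<close> normalises the weights \<open>(1, \<kappa>)\<close>
  to sum 1. Positivity of \<open>B\<close> and \<open>entering_velocity\<close> give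
  \<open>\<kappa> \<ge> 0\<close>.\<close>

lemma end_data_exists:
  assumes y: "traj x u y" and "0 < \<tau>" "y \<tau> = z" "z \<in> S" and out: "\<And>\<sigma>. 0 \<le> \<sigma> \<Longrightarrow> \<sigma> < \<tau> \<Longrightarrow> y \<sigma> \<notin> S"
    and W: "ball z \<delta> \<subseteq> W" "norm pg \<le> G" "supergrad_on g (ball z \<delta>) c z pg"
  obtains \<xi> l \<omega> where "end_data \<delta> c z \<xi> pg l \<omega>"
proof -
  have "z \<in> frontier S" using first_hit_frontier[OF y] assms by blast
  then obtain \<xi> where \<xi>: "norm \<xi> = 1" "\<And>y. y \<in> closure (- S) \<Longrightarrow> \<xi> \<bullet> (y - z) \<le> K0 * (norm (y - z))\<^sup>2"
    using inner_normal by blast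
  define A where "A w = \<xi> \<bullet> f z w" for w
  define B where "B w = pg \<bullet> f z w + r z w" for w
  have Bpos: "B w > 0" if "w \<in> U" for w using terminal_rate_ge[OF W(2) that, of z] G_less by (simp add: B_def)
  have "continuous_on U A" "continuous_on U B"
    unfolding A_def B_def by (intro continuous_intros f_cont_fixed r_cont_fixed)+
  then have "continuous_on U (\<lambda>w. A w / B w)" by (intro continuous_on_divide) (use Bpos in force)+
  then obtain \<omega> where \<omega>: "\<omega> \<in> U" "\<And>w. w \<in> U \<Longrightarrow> A w / B w \<le> A \<omega> / B \<omega>"
    using continuous_attains_sup[OF U_compact U_ne] by blast
  define \<kappa> where "\<kappa> = A \<omega> / B \<omega>"
  obtain w0 where "w0 \<in> U" "0 \<le> A w0"
    using entering_velocity[OF y \<open>0 < \<tau>\<close> \<open>y \<tau> = z\<close> out \<xi>] unfolding A_def by metis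
  then have "0 \<le> \<kappa>" using \<omega>(2)[of w0] Bpos[of w0] by (auto simp: \<kappa>_def intro: order_trans[rotated])
  define l where "l = \<kappa> / (1 + \<kappa>)"
  have l: "1 - l = 1 / (1 + \<kappa>)" "0 \<le> l" "l \<le> 1" using \<open>0 \<le> \<kappa>\<close> by (auto simp: l_def field_simps)
  have le: "A w \<le> \<kappa> * B w" if "w \<in> U" for w
    using \<omega>(2)[OF that] Bpos[OF that] by (simp add: \<kappa>_def[symmetric] pos_divide_le_eq)
  have eq: "A \<omega> = \<kappa> * B \<omega>" using Bpos[OF \<omega>(1)] by (simp add: \<kappa>_def)
  have "end_data \<delta> c z \<xi> pg l \<omega>"
    unfolding end_data_def A_def[symmetric] B_def[symmetric] l(1)
  proof (intro conjI ballI)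
    show "1 / (1 + \<kappa>) * A w \<le> l * B w" if "w \<in> U" for w
      using le[OF that] \<open>0 \<le> \<kappa>\<close> by (simp add: l_def divide_right_mono)
    show "1 / (1 + \<kappa>) * A \<omega> = l * B \<omega>" using eq by (simp add: l_def)
  qed (use \<xi> W l \<omega> in auto)
  then show ?thesis by (rule that)
qed

text \<open>The constants precede the quantifiers over end data, trajectory and \<epsilon>; this
  uniformity is what permits limits. \<open>c1 \<le> norm p + l\<close> is nontriviality of the
  normal. The inequality carries information only for increments that are not too small compared
  with \<epsilon>.\<close>

lemma approximate_normal:
  assumes "0 < T" "0 < t0" "0 < \<delta>" "0 \<le> c"
  obtains C \<delta>' c1 P \<epsilon>0 where "C > 0" "\<delta>' > 0" "c1 > 0" "P > 0" "\<epsilon>0 > 0"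
    "\<And>z \<xi> pg l \<omega> x u y \<tau> \<epsilon>. end_data \<delta> c z \<xi> pg l \<omega> \<Longrightarrow> traj x u y \<Longrightarrow> t0 \<le> \<tau> \<Longrightarrow> \<tau> \<le> T \<Longrightarrow> y \<tau> = z \<Longrightarrow>
      0 < \<epsilon> \<Longrightarrow> \<epsilon> \<le> \<epsilon>0 \<Longrightarrow> rcost u y \<tau> + g z \<le> V x + \<epsilon> \<Longrightarrow>
      \<exists>p. norm p \<le> P \<and> c1 \<le> norm p + l \<and> (\<forall>h a. norm h \<le> \<delta>' \<longrightarrow> \<bar>a\<bar> \<le> \<delta>' \<longrightarrow> x + h \<notin> S \<longrightarrow> V x + a \<le> V (x + h) \<longrightarrow>
        l * a - p \<bullet> h \<le> C * ((norm h)\<^sup>2 + a\<^sup>2 + \<epsilon>))"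
proof -
  define e where "e = exp (L * T)"
  have e1: "e \<ge> 1" using L_pos \<open>0 < T\<close> by (simp add: e_def)
  define lc where "lc = lin_const T"
  have lc: "lc \<ge> 0" using lin_const_nonneg \<open>0 < T\<close> by (simp add: lc_def)
  define Q where "Q = L * T * e + e * G"
  have Q: "Q \<ge> 0" using L_pos \<open>0 < T\<close> e1 G_nonneg by (simp add: Q_def)
  define c0 where "c0 = r0 - G * N"
  have c0: "c0 > 0" using G_less by (simp add: c0_def)
  define Cb where "Cb = 4 * (1 + Q\<^sup>2) + 2"
  have Cb: "Cb > 0" by (simp add: Cb_def add_pos_nonneg)
  define Cs where "Cs = Cb / c0\<^sup>2"
  have Cs: "Cs > 0" using Cb c0 by (simp add: Cs_def)
  define CX where "CX = lc + L * N * Cs + L * e * (Cs + 1)"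
  have CX: "CX > 0" using lc L_pos N_pos Cs e1 by (simp add: CX_def add_nonneg_pos add_pos_pos)
  define CZ where "CZ = 2 * N\<^sup>2 * Cs + 2 * e\<^sup>2"
  have CZ: "CZ > 0" using Cs e1 by (simp add: CZ_def add_nonneg_pos)
  define C6 where "C6 = CX + G * CX + c * CZ"
  have C6: "C6 > 0" using CX CZ G_nonneg \<open>0 \<le> c\<close> by (simp add: C6_def add_pos_nonneg)
  \<comment> \<open>\<open>C6\<close> covers the errors in the cost of stopping at time
    \<open>s\<close>; the surplus 2 pays for \<epsilon> and still leaves a strict gain.\<close>
  define K where "K = C6 + 2"
  have K: "K > 0" using C6 by (simp add: K_def)
  define C8 where "C8 = K0 * CZ + CX"
  have C8: "C8 > 0" using K0_nonneg CZ CX by (simp add: C8_def add_nonneg_pos)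
  define m0 where "m0 = min t0 1"
  have m0: "m0 > 0" using assms by (simp add: m0_def)
  \<comment> \<open>In this order the bounds give \<open>(K * E)^2 \<le> E\<close>, a shift of the
    stopping time of at most \<open>m0 \<le> t0\<close>, and a perturbed end point inside the ball
    of radius \<delta>.\<close>
  define \<eta> where "\<eta> = min (1 / K\<^sup>2) (min ((c0 * m0)\<^sup>2 / Cb) (\<delta>\<^sup>2 / (2 * CZ)))"
  have \<eta>: "\<eta> > 0" using K c0 m0 Cb CZ \<open>0 < \<delta>\<close> by (simp add: \<eta>_def)
  \<comment> \<open>\<open>E\<close> below has three summands, each held below
    \<open>\<eta> / 3\<close>.\<close>
  define \<delta>' where "\<delta>' = sqrt (\<eta> / 3)"
  define c1 where "c1 = 1 / (e + e * Q + 1)"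
  have den: "e + e * Q + 1 > 0" using e1 Q by (simp add: add_nonneg_pos)
  have main: "\<exists>p. norm p \<le> Q + e \<and> c1 \<le> norm p + l \<and> (\<forall>h a. norm h \<le> \<delta>' \<longrightarrow> \<bar>a\<bar> \<le> \<delta>' \<longrightarrow> x + h \<notin> S \<longrightarrow> V x + a \<le> V (x + h) \<longrightarrow>
        l * a - p \<bullet> h \<le> (C8 + K) * ((norm h)\<^sup>2 + a\<^sup>2 + \<epsilon>))"
    if ed: "end_data \<delta> c z \<xi> pg l \<omega>" and y0: "traj x u0 y0" and \<tau>: "t0 \<le> \<tau>" "\<tau> \<le> T" and y0z: "y0 \<tau> = z"
      and \<epsilon>: "0 < \<epsilon>" "\<epsilon> \<le> \<eta> / 3" and cost: "rcost u0 y0 \<tau> + g z \<le> V x + \<epsilon>"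
    for z \<xi> pg l \<omega> x u0 y0 \<tau> \<epsilon>
  proof -
    have \<tau>0: "0 \<le> \<tau>" using \<tau> \<open>0 < t0\<close> by simp
    have \<xi>: "norm \<xi> = 1" "\<And>y. y \<in> closure (- S) \<Longrightarrow> \<xi> \<bullet> (y - z) \<le> K0 * (norm (y - z))\<^sup>2"
      and zW: "ball z \<delta> \<subseteq> W" and pg: "norm pg \<le> G" and gsg: "supergrad_on g (ball z \<delta>) c z pg" and l: "0 \<le> l" "l \<le> 1"
      and \<omega>: "\<omega> \<in> U" and Hle: "\<And>w. w \<in> U \<Longrightarrow> (1 - l) * (\<xi> \<bullet> f z w) \<le> l * (pg \<bullet> f z w + r z w)"
      and Heq: "(1 - l) * (\<xi> \<bullet> f z \<omega>) = l * (pg \<bullet> f z \<omega> + r z \<omega>)"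
      using ed unfolding end_data_def by auto
    \<comment> \<open>Past \<tau> the trajectory is continued with the constant control \<omega>, so
      that later stopping times are available as well.\<close>
    obtain w where w: "traj (y0 \<tau>) (\<lambda>_. \<omega>) w" using traj_exists[OF control_const[OF \<omega>]] .
    define u where "u = (\<lambda>\<sigma>. if \<sigma> < \<tau> then u0 \<sigma> else \<omega>)"
    define y where "y = (\<lambda>\<sigma>. if \<sigma> < \<tau> then y0 \<sigma> else w (\<sigma> - \<tau>))"
    note cc = traj_concat[OF y0 \<tau>0 w, folded u_def y_def]
    have y: "traj x u y" by (rule cc(1))
    have y\<tau>: "y \<tau> = z" using cc(2)[of \<tau>] \<tau>0 y0z by (simp add: y_def)
    have cost': "rcost u y \<tau> + g z \<le> V x + \<epsilon>" using cc(3)[of \<tau>] \<tau>0 cost by simp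
    have u: "control U u" by (rule traj_control[OF y])
    have uU: "u s \<in> U" if "0 \<le> s" for s using control_in[OF u that] .
    obtain M q0 where M: "linear M" "\<And>h. norm (M h) \<le> e * norm h" "\<And>h. norm h \<le> e * norm (M h)"
      and q0: "norm q0 \<le> L * T * e"
      and lin1: "\<And>x' y'. traj x' u y' \<Longrightarrow> norm (y' \<tau> - y \<tau> - M (x' - x)) \<le> lc * (norm (x' - x))\<^sup>2"
      and lin2: "\<And>x' y'. traj x' u y' \<Longrightarrow> \<bar>rcost u y' \<tau> - rcost u y \<tau> - q0 \<bullet> (x' - x)\<bar> \<le> lc * (norm (x' - x))\<^sup>2"
      using flow_linearization[OF y \<tau>0 \<tau>(2)] unfolding e_def lc_def by metis
    have adj: "adjoint M v \<bullet> h = v \<bullet> M h" for v h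
      using adjoint_works[OF M(1), of h v] by (simp add: inner_commute)
    have "e > 0" using e1 by simp
    note ab = adjoint_bounds[OF M \<open>e > 0\<close>]
    define q where "q = q0 + adjoint M pg"
    define p where "p = l *\<^sub>R q - (1 - l) *\<^sub>R adjoint M \<xi>"
    have q: "norm q \<le> Q"
    proof -
      have "norm q \<le> norm q0 + norm (adjoint M pg)" unfolding q_def by (rule norm_triangle_ineq)
      also have "norm (adjoint M pg) \<le> e * G" using ab(1)[of pg] pg e1 by (meson \<open>e > 0\<close> less_imp_le mult_left_mono order_trans)
      finally show ?thesis using q0 by (simp add: Q_def)
    qed
    have lq: "norm (l *\<^sub>R q) \<le> l * Q" using q l by (simp add: mult_left_mono)
    have l\<xi>: "norm ((1 - l) *\<^sub>R adjoint M \<xi>) \<le> (1 - l) * e" using ab(1)[of \<xi>] l \<xi> by (simp add: mult_left_mono)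
    have p_le: "norm p \<le> Q + e"
    proof -
      have "norm p \<le> norm (l *\<^sub>R q) + norm ((1 - l) *\<^sub>R adjoint M \<xi>)" unfolding p_def by (rule norm_triangle_ineq4)
      also have "\<dots> \<le> l * Q + (1 - l) * e" using lq l\<xi> by simp
      also have "\<dots> \<le> 1 * Q + 1 * e" using l Q e1 by (intro add_mono mult_right_mono) auto
      finally show ?thesis by simp
    qed
    \<comment> \<open>The pulled back inner normal has norm at least \<open>1 / e\<close>. If its
      weight \<open>1 - l\<close> is small then \<open>l\<close> is large; otherwise it can be
      cancelled in \<open>p\<close> only by a sizeable \<open>l *\<^sub>R q\<close>.\<close>
    have p_ge: "c1 \<le> norm p + l"
    proof -
      have "1 \<le> e * norm (adjoint M \<xi>)" using ab(2)[of \<xi>] \<xi> by simp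
      then have "(1 - l) * 1 \<le> (1 - l) * (e * norm (adjoint M \<xi>))" using l by (intro mult_left_mono) auto
      also have "\<dots> = e * norm ((1 - l) *\<^sub>R adjoint M \<xi>)" using l by simp
      also have "(1 - l) *\<^sub>R adjoint M \<xi> = l *\<^sub>R q - p" by (simp add: p_def)
      also have "e * norm (l *\<^sub>R q - p) \<le> e * (l * Q + norm p)"
        using norm_triangle_ineq4[of "l *\<^sub>R q" p] lq e1 by (intro mult_left_mono) auto
      finally have "1 \<le> e * norm p + l * (e * Q + 1)" by (simp add: algebra_simps)
      also have "\<dots> \<le> (e + e * Q + 1) * norm p + l * (e + e * Q + 1)"
        using e1 Q l by (intro add_mono mult_right_mono mult_left_mono) auto
      also have "\<dots> = (norm p + l) * (e + e * Q + 1)" by (simp add: algebra_simps)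
      finally show ?thesis using den by (simp add: c1_def pos_divide_le_eq)
    qed
    have fi: "(\<lambda>s. f z (u s)) integrable_on {0..t}" for t
      by (rule compose_integrable[OF u continuous_on_const f_cont])
    have ri: "(\<lambda>s. r z (u s)) integrable_on {0..t}" for t
      by (rule compose_integrable[OF u continuous_on_const r_cont])
    \<comment> \<open>State and costs with the dynamics frozen at \<open>z\<close>. Only increments
      between \<tau> and \<open>s\<close> are used, where the true state is close to
      \<open>z\<close>.\<close>
    define \<Phi> where "\<Phi> t = integral {0..t} (\<lambda>s. f z (u s))" for t
    define \<rho> where "\<rho> t = integral {0..t} (\<lambda>s. r z (u s))" for t
    define B where "B t = integral {0..t} (\<lambda>s. pg \<bullet> f z (u s) + r z (u s))" for t
    have Bi: "(\<lambda>s. pg \<bullet> f z (u s) + r z (u s)) integrable_on {0..t}" for t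
      by (intro integrable_add inner_integral_right(1)[OF fi] ri)
    have B: "B t = pg \<bullet> \<Phi> t + \<rho> t" for t
      unfolding B_def \<Phi>_def \<rho>_def
      using integral_add[OF inner_integral_right(1)[OF fi] ri] inner_integral_right(2)[OF fi] by simp
    have B_incr: "c0 * (t - s) \<le> B t - B s" if "0 \<le> s" "s \<le> t" for s t
      unfolding B_def c0_def by (rule integral_increment_ge[OF Bi that]) (use terminal_rate_ge[OF pg uU] that in auto)
    have B_cont: "continuous_on {0..} B"
      unfolding B_def by (rule continuous_on_indefinite_integral_halfline[OF Bi])
    \<comment> \<open>Before \<tau> the integrand \<phi> has a sign by \<open>Hle\<close>; after
      \<tau> the control is \<omega> and \<phi> vanishes by \<open>Heq\<close>. Hence one inequality
      covers shifts in both directions.\<close>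
    have \<psi>: "(1 - l) * (\<xi> \<bullet> (\<Phi> s - \<Phi> \<tau>)) \<ge> l * (B s - B \<tau>)" if "0 \<le> s" for s
    proof -
      define \<phi> where "\<phi> \<sigma> = l * (pg \<bullet> f z (u \<sigma>) + r z (u \<sigma>)) - (1 - l) * (\<xi> \<bullet> f z (u \<sigma>))" for \<sigma>
      have \<phi>i: "\<phi> integrable_on {0..t}" for t
        unfolding \<phi>_def using integrable_on_cmult_left[OF Bi, of l] integrable_on_cmult_left[OF inner_integral_right(1)[OF fi, of \<xi>], of "1 - l"]
        by (intro integrable_diff) auto
      have \<phi>int: "integral {0..t} \<phi> = l * B t - (1 - l) * (\<xi> \<bullet> \<Phi> t)" for t
      proof -
        have "integral {0..t} \<phi> = integral {0..t} (\<lambda>\<sigma>. l * (pg \<bullet> f z (u \<sigma>) + r z (u \<sigma>))) - integral {0..t} (\<lambda>\<sigma>. (1 - l) * (\<xi> \<bullet> f z (u \<sigma>)))"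
          unfolding \<phi>_def using integrable_on_cmult_left[OF Bi, of l] integrable_on_cmult_left[OF inner_integral_right(1)[OF fi, of \<xi>], of "1 - l"]
          by (intro integral_diff) auto
        then show ?thesis using inner_integral_right(2)[OF fi, of t \<xi>] by (simp add: B_def \<Phi>_def)
      qed
      have "integral {0..s} \<phi> \<le> integral {0..\<tau>} \<phi>"
      proof (cases "s \<le> \<tau>")
        case True
        have "0 * (\<tau> - s) \<le> integral {0..\<tau>} \<phi> - integral {0..s} \<phi>"
          by (rule integral_increment_ge[OF \<phi>i that True]) (use Hle uU that in \<open>auto simp: \<phi>_def\<close>)
        then show ?thesis by simp
      next
        case False
        have "norm (integral {0..s} \<phi> - integral {0..\<tau>} \<phi>) \<le> 0 * \<bar>s - \<tau>\<bar>"
          by (rule norm_integral_increment_le[OF \<phi>i \<tau>0 that]) (use Heq False in \<open>auto simp: \<phi>_def u_def\<close>)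
        then show ?thesis by simp
      qed
      then show ?thesis unfolding \<phi>int by (simp add: inner_diff_right algebra_simps)
    qed
    have "l * a - p \<bullet> h \<le> (C8 + K) * ((norm h)\<^sup>2 + a\<^sup>2 + \<epsilon>)"
      if h: "norm h \<le> \<delta>'" and a: "\<bar>a\<bar> \<le> \<delta>'" and xh: "x + h \<notin> S" and hyp: "V x + a \<le> V (x + h)" for h a
    proof -
      define E where "E = (norm h)\<^sup>2 + a\<^sup>2 + \<epsilon>"
      have "E > 0" using \<epsilon> by (simp add: E_def add_nonneg_pos)
      have hE: "(norm h)\<^sup>2 \<le> E" and aE: "a\<^sup>2 \<le> E" and \<epsilon>E: "\<epsilon> \<le> E" using \<epsilon> by (auto simp: E_def)
      have "(norm h)\<^sup>2 \<le> \<delta>'\<^sup>2" "a\<^sup>2 \<le> \<delta>'\<^sup>2" using h a by (auto intro: power_mono simp: abs_le_square_iff[symmetric])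
      moreover have "\<delta>'\<^sup>2 = \<eta> / 3" using \<eta> by (simp add: \<delta>'_def)
      ultimately have E\<eta>: "E \<le> \<eta>" using \<epsilon> by (simp add: E_def)
      \<comment> \<open>The change of frozen cost that the time shift has to produce: the increment
        \<open>a\<close> of the value, minus the first-order effect of moving the initial point by
        \<open>h\<close>, minus a safety margin.\<close>
      define b where "b = a - q \<bullet> h - K * E"
      have b2: "b\<^sup>2 \<le> Cb * E"
      proof -
        have KE: "(K * E)\<^sup>2 \<le> E"
        proof -
          have "E \<le> 1 / K\<^sup>2" using E\<eta> by (simp add: \<eta>_def)
          then have "K\<^sup>2 * E \<le> 1" using K by (simp add: pos_le_divide_eq mult.commute)
          then have "(K\<^sup>2 * E) * E \<le> 1 * E" using \<open>E > 0\<close> by (intro mult_right_mono) auto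
          then show ?thesis by (simp add: power2_eq_square mult_ac)
        qed
        have qh: "(q \<bullet> h)\<^sup>2 \<le> Q\<^sup>2 * E"
        proof -
          have "\<bar>q \<bullet> h\<bar> \<le> Q * norm h"
            using Cauchy_Schwarz_ineq2[of q h] mult_right_mono[OF q, of "norm h"] by simp
          then have "(q \<bullet> h)\<^sup>2 \<le> (Q * norm h)\<^sup>2" by (rule power2_le_iff_abs_le[THEN iffD2, rotated]) (use Q in simp)
          also have "\<dots> = Q\<^sup>2 * (norm h)\<^sup>2" by (simp add: power_mult_distrib)
          also have "\<dots> \<le> Q\<^sup>2 * E" using hE by (intro mult_left_mono) auto
          finally show ?thesis .
        qed
        have two: "(s - t)\<^sup>2 \<le> 2 * s\<^sup>2 + 2 * t\<^sup>2" for s t :: real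
          using zero_le_power2[of "s + t"] by (simp add: power2_eq_square algebra_simps)
        have "b\<^sup>2 \<le> 2 * (a - q \<bullet> h)\<^sup>2 + 2 * (K * E)\<^sup>2" unfolding b_def by (rule two)
        also have "\<dots> \<le> 2 * (2 * a\<^sup>2 + 2 * (q \<bullet> h)\<^sup>2) + 2 * E" using two[of a "q \<bullet> h"] KE by simp
        also have "\<dots> \<le> 2 * (2 * E + 2 * (Q\<^sup>2 * E)) + 2 * E" using qh aE by simp
        also have "\<dots> = Cb * E" by (simp add: Cb_def algebra_simps)
        finally show ?thesis .
      qed
      \<comment> \<open>The longest shift that can be needed, since \<open>B\<close> grows at least
        at rate \<open>c0\<close>.\<close>
      define m where "m = \<bar>b\<bar> / c0"
      have m2: "m\<^sup>2 \<le> Cs * E"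
        using b2 c0 by (simp add: m_def Cs_def power_divide divide_right_mono)
      have "m \<le> m0"
      proof -
        have "E \<le> (c0 * m0)\<^sup>2 / Cb" using E\<eta> by (simp add: \<eta>_def)
        then have "Cb * E \<le> (c0 * m0)\<^sup>2" using Cb by (simp add: pos_le_divide_eq mult.commute)
        then have "b\<^sup>2 \<le> (c0 * m0)\<^sup>2" using b2 by simp
        then have "\<bar>b\<bar> \<le> c0 * m0" using c0 m0 by (simp add: power2_le_iff_abs_le)
        then show ?thesis using c0 by (simp add: m_def pos_divide_le_eq mult.commute)
      qed
      then have m\<tau>: "m \<le> \<tau>" "0 \<le> m" using \<tau> c0 by (auto simp: m0_def m_def)
      have "\<exists>s\<ge>\<tau> - m. s \<le> \<tau> + m \<and> B s = B \<tau> + b"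
      proof (rule IVT')
        have cm: "c0 * m = \<bar>b\<bar>" using c0 by (simp add: m_def)
        show "B (\<tau> - m) \<le> B \<tau> + b" using B_incr[of "\<tau> - m" \<tau>] m\<tau> cm by simp
        show "B \<tau> + b \<le> B (\<tau> + m)" using B_incr[of \<tau> "\<tau> + m"] \<tau>0 m\<tau> cm by simp
      qed (use m\<tau> in \<open>auto intro!: continuous_on_subset[OF B_cont]\<close>)
      then obtain s where s: "\<tau> - m \<le> s" "s \<le> \<tau> + m" and Bs: "B s = B \<tau> + b" by blast
      have s0: "0 \<le> s" using s m\<tau> by simp
      define \<sigma> where "\<sigma> = \<bar>s - \<tau>\<bar>"
      have \<sigma>: "0 \<le> \<sigma>" "\<sigma> \<le> m" using s by (auto simp: \<sigma>_def)
      have \<sigma>2: "\<sigma>\<^sup>2 \<le> Cs * E" using power_mono[OF \<sigma>(2,1), of 2] m2 by simp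
      obtain y' where y': "traj (x + h) u y'" using traj_exists[OF u] .
      \<comment> \<open>Bounds the distance from \<open>z\<close> between \<tau> and
        \<open>s\<close>: the motion during the shift plus the perturbation carried to time
        \<tau>.\<close>
      define D where "D = N * \<sigma> + e * norm h"
      have "D \<ge> 0" using \<sigma> N_pos e1 by (simp add: D_def)
      have close\<tau>: "norm (y' \<tau> - z) \<le> e * norm h"
        using traj_dependence[OF y y' \<tau>0 \<tau>(2)] by (simp add: y\<tau> e_def mult.commute)
      have close: "norm (y' \<sigma>' - z) \<le> D" if "min s \<tau> \<le> \<sigma>'" "\<sigma>' \<le> max s \<tau>" for \<sigma>'
      proof -
        have "0 \<le> \<sigma>'" using that s0 \<tau>0 by auto
        have "norm (y' \<sigma>' - z) \<le> norm (y' \<sigma>' - y' \<tau>) + norm (y' \<tau> - z)"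
          using norm_triangle_ineq[of "y' \<sigma>' - y' \<tau>" "y' \<tau> - z"] by simp
        also have "norm (y' \<sigma>' - y' \<tau>) \<le> N * \<bar>\<sigma>' - \<tau>\<bar>" by (rule traj_lipschitz[OF y' \<tau>0 \<open>0 \<le> \<sigma>'\<close>])
        also have "N * \<bar>\<sigma>' - \<tau>\<bar> \<le> N * \<sigma>" using that N_pos by (intro mult_left_mono) (auto simp: \<sigma>_def)
        finally show ?thesis using close\<tau> by (simp add: D_def)
      qed
      have sh: "\<sigma> * norm h \<le> (Cs + 1) * E"
      proof -
        have "2 * (\<sigma> * norm h) \<le> \<sigma>\<^sup>2 + (norm h)\<^sup>2" using sum_squares_bound[of \<sigma> "norm h"] by simp
        also have "\<dots> \<le> (Cs + 1) * E" using \<sigma>2 hE by (simp add: distrib_right)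
        finally show ?thesis using \<open>E > 0\<close> Cs \<sigma> by (smt (verit) mult_nonneg_nonneg norm_ge_zero)
      qed
      have DX: "lc * (norm h)\<^sup>2 + L * D * \<sigma> \<le> CX * E"
      proof -
        have "L * D * \<sigma> = L * N * \<sigma>\<^sup>2 + L * e * (\<sigma> * norm h)" by (simp add: D_def power2_eq_square algebra_simps)
        also have "\<dots> \<le> L * N * (Cs * E) + L * e * ((Cs + 1) * E)"
          using \<sigma>2 sh L_pos N_pos e1 by (intro add_mono mult_left_mono) auto
        finally have 1: "L * D * \<sigma> \<le> L * N * (Cs * E) + L * e * ((Cs + 1) * E)" .
        have "lc * (norm h)\<^sup>2 \<le> lc * E" using lc hE by (intro mult_left_mono)
        with 1 show ?thesis by (simp add: CX_def algebra_simps)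
      qed
      have DZ: "D\<^sup>2 \<le> CZ * E"
      proof -
        have "D\<^sup>2 \<le> 2 * (N * \<sigma>)\<^sup>2 + 2 * (e * norm h)\<^sup>2"
          unfolding D_def using sum_squares_bound[of "N * \<sigma>" "e * norm h"] by (simp add: power2_sum)
        also have "\<dots> = 2 * N\<^sup>2 * \<sigma>\<^sup>2 + 2 * e\<^sup>2 * (norm h)\<^sup>2" by (simp add: power_mult_distrib)
        also have "\<dots> \<le> 2 * N\<^sup>2 * (Cs * E) + 2 * e\<^sup>2 * E" using \<sigma>2 hE by (intro add_mono mult_left_mono) auto
        also have "\<dots> = CZ * E" by (simp add: CZ_def algebra_simps)
        finally show ?thesis .
      qed
      have "D < \<delta>"
      proof -
        have "E \<le> \<delta>\<^sup>2 / (2 * CZ)" using E\<eta> by (simp add: \<eta>_def)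
        then have "2 * (CZ * E) \<le> \<delta>\<^sup>2" using CZ by (simp add: pos_le_divide_eq mult_ac)
        moreover have "CZ * E > 0" using CZ \<open>E > 0\<close> by simp
        ultimately have "D\<^sup>2 < \<delta>\<^sup>2" using DZ by simp
        then show ?thesis using \<open>0 < \<delta>\<close> by (simp add: power_less_imp_less_base)
      qed
      define zs where "zs = y' s"
      have zsD: "norm (zs - z) \<le> D" using close[of s] by (simp add: zs_def)
      then have zs_ball: "zs \<in> ball z \<delta>" using \<open>D < \<delta>\<close> by (simp add: dist_norm norm_minus_commute)
      have zs2: "(norm (zs - z))\<^sup>2 \<le> CZ * E" using power_mono[OF zsD, of 2] DZ by simp
      have inc_f: "norm (y' s - y' \<tau> - (\<Phi> s - \<Phi> \<tau>)) \<le> L * D * \<sigma>"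
      proof -
        have i: "(\<lambda>\<sigma>. f (y' \<sigma>) (u \<sigma>) - f z (u \<sigma>)) integrable_on {0..t}" if "0 \<le> t" for t
          by (intro integrable_diff f_integrable[OF y' that] fi)
        have "norm (integral {0..s} (\<lambda>\<sigma>. f (y' \<sigma>) (u \<sigma>) - f z (u \<sigma>)) - integral {0..\<tau>} (\<lambda>\<sigma>. f (y' \<sigma>) (u \<sigma>) - f z (u \<sigma>))) \<le> (L * D) * \<bar>s - \<tau>\<bar>"
        proof (rule norm_integral_increment_le[OF i \<tau>0 s0])
          fix \<sigma>' assume \<sigma>': "min \<tau> s \<le> \<sigma>'" "\<sigma>' \<le> max \<tau> s"
          then have "norm (f (y' \<sigma>') (u \<sigma>') - f z (u \<sigma>')) \<le> L * norm (y' \<sigma>' - z)"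
            using s0 \<tau>0 by (intro f_lip uU) auto
          also have "\<dots> \<le> L * D" using close[of \<sigma>'] \<sigma>' L_pos by (intro mult_left_mono) (auto simp: min.commute max.commute)
          finally show "norm (f (y' \<sigma>') (u \<sigma>') - f z (u \<sigma>')) \<le> L * D" .
        qed
        moreover have "integral {0..t} (\<lambda>\<sigma>. f (y' \<sigma>) (u \<sigma>) - f z (u \<sigma>)) = y' t - (x + h) - \<Phi> t" if "0 \<le> t" for t
          using integral_diff[OF f_integrable[OF y' that] fi] traj_eq[OF y' that] by (simp add: \<Phi>_def)
        ultimately show ?thesis using s0 \<tau>0 by (simp add: \<sigma>_def algebra_simps)
      qed
      have inc_r: "\<bar>rcost u y' s - rcost u y' \<tau> - (\<rho> s - \<rho> \<tau>)\<bar> \<le> L * D * \<sigma>"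
      proof -
        have i: "(\<lambda>\<sigma>. r (y' \<sigma>) (u \<sigma>) - r z (u \<sigma>)) integrable_on {0..t}" for t
          by (intro integrable_diff r_integrable[OF y'] ri)
        have "norm (integral {0..s} (\<lambda>\<sigma>. r (y' \<sigma>) (u \<sigma>) - r z (u \<sigma>)) - integral {0..\<tau>} (\<lambda>\<sigma>. r (y' \<sigma>) (u \<sigma>) - r z (u \<sigma>))) \<le> (L * D) * \<bar>s - \<tau>\<bar>"
        proof (rule norm_integral_increment_le[OF i \<tau>0 s0])
          fix \<sigma>' assume \<sigma>': "min \<tau> s \<le> \<sigma>'" "\<sigma>' \<le> max \<tau> s"
          then have "norm (r (y' \<sigma>') (u \<sigma>') - r z (u \<sigma>')) \<le> L * norm (y' \<sigma>' - z)"
            unfolding real_norm_def using s0 \<tau>0 by (intro r_lip uU) auto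
          also have "\<dots> \<le> L * D" using close[of \<sigma>'] \<sigma>' L_pos by (intro mult_left_mono) (auto simp: min.commute max.commute)
          finally show "norm (r (y' \<sigma>') (u \<sigma>') - r z (u \<sigma>')) \<le> L * D" .
        qed
        moreover have "integral {0..t} (\<lambda>\<sigma>. r (y' \<sigma>) (u \<sigma>) - r z (u \<sigma>)) = rcost u y' t - \<rho> t" for t
          using integral_diff[OF r_integrable[OF y'] ri] by (simp add: \<rho>_def rcost_def)
        ultimately show ?thesis by (simp add: \<sigma>_def algebra_simps)
      qed
      have err1: "norm (zs - z - M h - (\<Phi> s - \<Phi> \<tau>)) \<le> CX * E"
      proof -
        have "zs - z - M h - (\<Phi> s - \<Phi> \<tau>) = (y' \<tau> - y \<tau> - M h) + (y' s - y' \<tau> - (\<Phi> s - \<Phi> \<tau>))"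
          by (simp add: zs_def y\<tau>)
        then have "norm (zs - z - M h - (\<Phi> s - \<Phi> \<tau>)) \<le> norm (y' \<tau> - y \<tau> - M h) + norm (y' s - y' \<tau> - (\<Phi> s - \<Phi> \<tau>))"
          by (metis norm_triangle_ineq)
        also have "\<dots> \<le> lc * (norm h)\<^sup>2 + L * D * \<sigma>" using lin1[OF y'] inc_f by simp
        finally show ?thesis using DX by simp
      qed
      have err2: "rcost u y' s \<le> rcost u y \<tau> + q0 \<bullet> h + (\<rho> s - \<rho> \<tau>) + CX * E"
        using lin2[OF y'] inc_r DX by (simp add: abs_le_iff)
      have inner_err: "\<bar>v \<bullet> (zs - z) - v \<bullet> M h - v \<bullet> (\<Phi> s - \<Phi> \<tau>)\<bar> \<le> norm v * (CX * E)" for v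
      proof -
        have "v \<bullet> (zs - z) - v \<bullet> M h - v \<bullet> (\<Phi> s - \<Phi> \<tau>) = v \<bullet> (zs - z - M h - (\<Phi> s - \<Phi> \<tau>))" by (simp add: inner_diff_right)
        also have "\<bar>\<dots>\<bar> \<le> norm v * norm (zs - z - M h - (\<Phi> s - \<Phi> \<tau>))" by (rule Cauchy_Schwarz_ineq2)
        also have "\<dots> \<le> norm v * (CX * E)" using err1 by (intro mult_left_mono) auto
        finally show ?thesis .
      qed
      \<comment> \<open>A hit at \<open>s\<close> would bound \<open>V (x + h)\<close> by
        \<open>V x + a + \<epsilon> - 2 * E\<close>, which is less than
        \<open>V x + a\<close>.\<close>
      have "zs \<notin> S"
      proof
        assume "zs \<in> S"
        then have "V (x + h) \<le> rcost u y' s + g zs"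
          unfolding zs_def using zs_ball zW by (intro V_le_cost_later[OF y' xh s0]) (auto simp: zs_def)
        also have "g zs \<le> g z + pg \<bullet> (zs - z) + c * (norm (zs - z))\<^sup>2" by (rule supergrad_onD[OF gsg zs_ball])
        finally have 1: "V (x + h) \<le> rcost u y' s + g z + pg \<bullet> (zs - z) + c * (norm (zs - z))\<^sup>2" by simp
        have 2: "c * (norm (zs - z))\<^sup>2 \<le> c * (CZ * E)" using zs2 \<open>0 \<le> c\<close> by (rule mult_left_mono)
        have 3: "pg \<bullet> (zs - z) \<le> pg \<bullet> M h + pg \<bullet> (\<Phi> s - \<Phi> \<tau>) + G * (CX * E)"
        proof -
          have "norm pg * (CX * E) \<le> G * (CX * E)" using pg CX \<open>E > 0\<close> by (intro mult_right_mono) auto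
          then show ?thesis using inner_err[of pg] by linarith
        qed
        have 4: "pg \<bullet> (\<Phi> s - \<Phi> \<tau>) + (\<rho> s - \<rho> \<tau>) = b" using Bs by (simp add: B inner_diff_right)
        have 5: "q0 \<bullet> h + pg \<bullet> M h = q \<bullet> h" by (simp add: q_def inner_add_left adj)
        have "V (x + h) \<le> rcost u y \<tau> + g z + q \<bullet> h + b + (CX * E + G * (CX * E) + c * (CZ * E))"
          using 1 2 3 4 5 err2 by linarith
        also have "CX * E + G * (CX * E) + c * (CZ * E) = C6 * E" by (simp add: C6_def algebra_simps)
        also have "rcost u y \<tau> + g z + q \<bullet> h + b + C6 * E \<le> V x + a + \<epsilon> - 2 * E"
          using cost' by (simp add: b_def K_def algebra_simps)
        finally show False using hyp \<epsilon>E \<open>E > 0\<close> by simp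
      qed
      then have "\<xi> \<bullet> (zs - z) \<le> K0 * (norm (zs - z))\<^sup>2" using \<xi>(2) closure_subset[of "- S"] by blast
      also have "\<dots> \<le> K0 * (CZ * E)" using zs2 K0_nonneg by (rule mult_left_mono)
      finally have "\<xi> \<bullet> M h + \<xi> \<bullet> (\<Phi> s - \<Phi> \<tau>) \<le> C8 * E"
        using inner_err[of \<xi>] \<xi>(1) by (simp add: C8_def distrib_right abs_le_iff)
      then have "(1 - l) * (\<xi> \<bullet> M h + \<xi> \<bullet> (\<Phi> s - \<Phi> \<tau>)) \<le> (1 - l) * (C8 * E)" using l by (intro mult_left_mono) auto
      also have "\<dots> \<le> 1 * (C8 * E)" using l C8 \<open>E > 0\<close> by (intro mult_right_mono) auto
      \<comment> \<open>The inequality \<psi> trades the shift term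
        \<open>\<xi> \<bullet> (\<Phi> s - \<Phi> \<tau>)\<close> for \<open>l * b\<close>, which is
        where \<open>a\<close> and \<open>q\<close> enter.\<close>
      finally have "(1 - l) * (\<xi> \<bullet> M h) + l * b \<le> C8 * E"
        using \<psi>[OF s0] Bs by (simp add: distrib_left)
      moreover have "l * (K * E) \<le> 1 * (K * E)" using l K \<open>E > 0\<close> by (intro mult_right_mono) auto
      moreover have "p \<bullet> h = l * (q \<bullet> h) - (1 - l) * (\<xi> \<bullet> M h)" by (simp add: p_def inner_diff_left adj)
      moreover have "l * b = l * a - l * (q \<bullet> h) - l * (K * E)" by (simp add: b_def right_diff_distrib)
      ultimately show ?thesis unfolding E_def[symmetric] by (simp add: distrib_right)
    qed
    then show ?thesis using p_le p_ge by blast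
  qed
  show ?thesis
  proof (rule that[of "C8 + K" \<delta>' c1 "Q + e" "\<eta> / 3"])
    show "C8 + K > 0" "\<delta>' > 0" "c1 > 0" "Q + e > 0" "\<eta> / 3 > 0"
      using C8 K \<eta> den Q e1 by (simp_all add: \<delta>'_def c1_def)
  qed (rule main)
qed

end

lemma mem_proximal_normal_cone_hypo:
  "(w, k) \<in> proximal_normal_cone (hypo S V) (x, V x) \<longleftrightarrow>
    (\<exists>\<sigma>\<ge>0. \<forall>z\<in>closure (- S). \<forall>\<beta>\<le>V z. w \<bullet> (z - x) + k * (\<beta> - V x) \<le> \<sigma> * ((norm (z - x))\<^sup>2 + (\<beta> - V x)\<^sup>2))"
  by (auto simp: proximal_normal_cone_def hypo_def norm_Pair)

text \<open>The norm has a quadratic upper model away from 0, from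
  \<open>2 * n * t \<le> n^2 + t^2\<close>. It turns minimality of \<open>V + K |y - x|\<close> into
  a proximal subgradient of \<open>V\<close>.\<close>

lemma norm_add_le_first_order:
  fixes w k :: "'a::real_inner"
  assumes "w \<noteq> 0"
  shows "norm (w + k) \<le> norm w + (w \<bullet> k) / norm w + (norm k)\<^sup>2 / (2 * norm w)"
proof -
  define n where "n = norm w"
  have "n > 0" using assms by (simp add: n_def)
  have "2 * n * norm (w + k) \<le> n\<^sup>2 + (norm (w + k))\<^sup>2" using sum_squares_bound[of n "norm (w + k)"] by simp
  also have "(norm (w + k))\<^sup>2 = n\<^sup>2 + 2 * (w \<bullet> k) + (norm k)\<^sup>2"
    unfolding n_def power2_norm_eq_inner by (simp add: inner_add_left inner_add_right inner_commute)
  finally have "norm (w + k) * (2 * n) \<le> 2 * n\<^sup>2 + 2 * (w \<bullet> k) + (norm k)\<^sup>2" by (simp add: mult_ac)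
  then have "norm (w + k) \<le> (2 * n\<^sup>2 + 2 * (w \<bullet> k) + (norm k)\<^sup>2) / (2 * n)"
    using \<open>n > 0\<close> by (simp add: pos_le_divide_eq)
  also have "\<dots> = n + (w \<bullet> k) / n + (norm k)\<^sup>2 / (2 * n)"
    using \<open>n > 0\<close> by (simp add: add_divide_distrib power2_eq_square)
  finally show ?thesis by (simp add: n_def)
qed

section \<open>Proximal normals with an error term, their limits, and their relation to
  steepness\<close>

context exit_time_problem
begin

text \<open>Near a point outside the target, \<open>(x + h, V x + a)\<close> runs over the hypograph
  close to \<open>(x, V x)\<close>; so with \<open>\<epsilon> = 0\<close> this says that
  \<open>(- p, l)\<close> is a proximal normal, in local form and with explicit constants.\<close>

definition normal_at :: "real \<Rightarrow> real \<Rightarrow> 'a \<Rightarrow> 'a \<Rightarrow> real \<Rightarrow> real \<Rightarrow> bool" where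
  "normal_at C \<delta> x p l \<epsilon> \<longleftrightarrow> (\<forall>h a. norm h \<le> \<delta> \<longrightarrow> \<bar>a\<bar> \<le> \<delta> \<longrightarrow> V x + a \<le> V (x + h) \<longrightarrow>
     l * a - p \<bullet> h \<le> C * ((norm h)\<^sup>2 + a\<^sup>2 + \<epsilon>))"

text \<open>The end data are fixed once, at the end of a near-optimal trajectory, and applied to its
  shifted pieces, which are \<epsilon>-optimal as well. Hence \<open>l\<close> is the same for all
  \<open>s\<close> while \<open>p\<close> varies.\<close>

lemma trajectory_normals:
  assumes "x0 \<notin> S"
  obtains \<eta> C \<delta> c1 P s0 \<epsilon>0 where "\<eta> > 0" "C > 0" "\<delta> > 0" "c1 > 0" "P > 0" "s0 > 0" "\<epsilon>0 > 0" "cball x0 (2 * \<eta>) \<inter> S = {}"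
    "\<And>x \<epsilon>. x \<in> ball x0 \<eta> \<Longrightarrow> 0 < \<epsilon> \<Longrightarrow> \<epsilon> \<le> \<epsilon>0 \<Longrightarrow> \<exists>u y l. traj x u y \<and> 0 \<le> l \<and> l \<le> 1 \<and>
      (\<forall>s\<in>{0..s0}. dist x0 (y s) \<le> 2 * \<eta> \<and> r0 * s + V (y s) \<le> V x + \<epsilon> \<and>
        (\<exists>p. norm p \<le> P \<and> c1 \<le> norm p + l \<and> normal_at C \<delta> (y s) p l \<epsilon>))"
proof -
  obtain d where "d > 0" and d: "ball x0 d \<inter> S = {}"
    using S_closed assms open_contains_ball[of "- S"] by (auto simp: disjoint_eq_subset_Compl)
  \<comment> \<open>Room for the initial point, the motion up to time \<open>s0\<close> and the
    increment \<open>h\<close>, one \<eta> each, while points closer than \<open>4 * \<eta>\<close>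
    to \<open>x0\<close> are outside the target.\<close>
  define \<eta> where "\<eta> = d / 4"
  have "\<eta> > 0" using \<open>d > 0\<close> by (simp add: \<eta>_def)
  have outside: "x \<notin> S" if "dist x0 x < 4 * \<eta>" for x using d that by (auto simp: \<eta>_def)
  have time: "3 * \<eta> / N \<le> \<tau>" if "traj x u y" "x \<in> ball x0 \<eta>" "0 \<le> \<tau>" "y \<tau> \<in> S" for x u y \<tau>
  proof -
    have "4 * \<eta> \<le> dist x0 (y \<tau>)" using outside[of "y \<tau>"] that(4) by linarith
    also have "\<dots> \<le> dist x0 x + dist x (y \<tau>)" by (rule dist_triangle)
    also have "dist x (y \<tau>) \<le> N * \<tau>"
      using traj_lipschitz[OF that(1), of 0 \<tau>] traj_0[OF that(1)] that(3) by (simp add: dist_norm norm_minus_commute)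
    finally have "3 * \<eta> \<le> N * \<tau>" using that(2) by simp
    then show ?thesis using N_pos by (simp add: pos_divide_le_eq mult.commute)
  qed
  have "compact (V ` cball x0 \<eta>)"
    by (intro compact_continuous_image continuous_on_subset[OF V_cont]) auto
  then obtain Vm where "\<And>v. v \<in> V ` cball x0 \<eta> \<Longrightarrow> norm v \<le> Vm" using compact_imp_bounded bounded_iff by metis
  then have Vm: "V x \<le> Vm" if "x \<in> ball x0 \<eta>" for x
    using that by (smt (verit) ball_subset_cball image_eqI real_norm_def subsetD)
  obtain z0 where z0: "z0 \<in> frontier S"
  proof -
    obtain u y \<tau> where y: "traj x0 u y" "0 \<le> \<tau>" "y \<tau> \<in> S" "\<And>\<sigma>. 0 \<le> \<sigma> \<Longrightarrow> \<sigma> < \<tau> \<Longrightarrow> y \<sigma> \<notin> S"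
      using near_optimal[of 1 x0] by (metis zero_less_one)
    have "\<tau> \<noteq> 0" using y traj_0[OF y(1)] assms by auto
    then show ?thesis using that first_hit_frontier[OF y(1) _ y(3,4)] y(2) by simp
  qed
  define c0 where "c0 = r0 - G * N"
  have c0: "c0 > 0" using G_less by (simp add: c0_def)
  \<comment> \<open>A distant end point can lower \<open>g\<close> at most at rate
    \<open>G * N\<close> in time, but costs at least \<open>r0\<close> per unit of time; so
    near-optimal times are bounded by \<open>T\<close>.\<close>
  define Q where "Q = Vm + 1 - g z0 + G * (\<eta> + dist x0 z0)"
  define T where "T = \<bar>Q\<bar> / c0 + 1"
  have T: "T > 0" using c0 by (simp add: T_def add_nonneg_pos)
  have \<tau>T: "\<tau> \<le> T" if y: "traj x u y" and x: "x \<in> ball x0 \<eta>" and \<tau>: "0 \<le> \<tau>" and z: "y \<tau> \<in> frontier S"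
    and cost: "rcost u y \<tau> + g (y \<tau>) \<le> V x + 1" for x u y \<tau>
  proof -
    have "dist (y \<tau>) z0 \<le> dist (y \<tau>) x + dist x x0 + dist x0 z0"
      by (meson add_right_mono dist_triangle order_trans)
    also have "dist (y \<tau>) x \<le> N * \<tau>" using traj_lipschitz[OF y, of 0 \<tau>] traj_0[OF y] \<tau> by (simp add: dist_norm)
    also have "dist x x0 \<le> \<eta>" using x by (simp add: dist_commute)
    finally have "dist (y \<tau>) z0 \<le> N * \<tau> + \<eta> + dist x0 z0" by simp
    then have "G * norm (y \<tau> - z0) \<le> G * (N * \<tau> + \<eta> + dist x0 z0)" using G_nonneg by (intro mult_left_mono) (simp_all add: dist_norm)
    moreover have "\<bar>g (y \<tau>) - g z0\<bar> \<le> G * norm (y \<tau> - z0)" using g_lip z z0 frontier_W by blast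
    moreover have "r0 * \<tau> \<le> rcost u y \<tau>" using rcost_ge[OF y, of 0 \<tau>] \<tau> by simp
    ultimately have "c0 * \<tau> \<le> Q" using cost Vm[OF x] unfolding Q_def c0_def by (simp add: algebra_simps abs_le_iff)
    then have "\<tau> \<le> \<bar>Q\<bar> / c0" using c0 by (simp add: pos_le_divide_eq mult.commute)
    then show ?thesis by (simp add: T_def)
  qed
  obtain \<delta>1 c where \<delta>1: "\<delta>1 > 0" "c > 0" and reg: "\<And>z. z \<in> cball x0 (\<eta> + N * T) \<Longrightarrow> z \<in> frontier S \<Longrightarrow>
      ball z \<delta>1 \<subseteq> W \<and> (\<exists>pg. norm pg \<le> G \<and> supergrad_on g (ball z \<delta>1) c z pg)"
    using terminal_regularity[of "cball x0 (\<eta> + N * T)"] compact_cball by metis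
  have t0: "\<eta> / N > 0" using \<open>\<eta> > 0\<close> N_pos by simp
  obtain C \<delta>2 c1 P \<epsilon>1 where pos: "C > 0" "\<delta>2 > 0" "c1 > 0" "P > 0" "\<epsilon>1 > 0" and
    an: "\<And>z \<xi> pg l \<omega> x u y \<tau> \<epsilon>. end_data \<delta>1 c z \<xi> pg l \<omega> \<Longrightarrow> traj x u y \<Longrightarrow> \<eta> / N \<le> \<tau> \<Longrightarrow> \<tau> \<le> T \<Longrightarrow> y \<tau> = z \<Longrightarrow>
      0 < \<epsilon> \<Longrightarrow> \<epsilon> \<le> \<epsilon>1 \<Longrightarrow> rcost u y \<tau> + g z \<le> V x + \<epsilon> \<Longrightarrow>
      \<exists>p. norm p \<le> P \<and> c1 \<le> norm p + l \<and> (\<forall>h a. norm h \<le> \<delta>2 \<longrightarrow> \<bar>a\<bar> \<le> \<delta>2 \<longrightarrow> x + h \<notin> S \<longrightarrow> V x + a \<le> V (x + h) \<longrightarrow>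
        l * a - p \<bullet> h \<le> C * ((norm h)\<^sup>2 + a\<^sup>2 + \<epsilon>))"
    using approximate_normal[OF T t0 \<delta>1(1) less_imp_le[OF \<delta>1(2)]] by blast
  define \<delta> where "\<delta> = min \<delta>2 \<eta>"
  show ?thesis
  proof (rule that[of \<eta> C \<delta> c1 P "\<eta> / N" "min \<epsilon>1 1"])
    show "cball x0 (2 * \<eta>) \<inter> S = {}" using outside \<open>\<eta> > 0\<close> by force
    fix x \<epsilon> assume x: "x \<in> ball x0 \<eta>" and \<epsilon>: "0 < \<epsilon>" "\<epsilon> \<le> min \<epsilon>1 1"
    obtain u y \<tau> where y: "traj x u y" and \<tau>: "0 \<le> \<tau>" "y \<tau> \<in> S" and out: "\<And>\<sigma>. 0 \<le> \<sigma> \<Longrightarrow> \<sigma> < \<tau> \<Longrightarrow> y \<sigma> \<notin> S"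
      and cost: "rcost u y \<tau> + g (y \<tau>) < V x + \<epsilon>"
      using near_optimal[OF \<epsilon>(1), of x] by metis
    have \<tau>3: "3 * \<eta> / N \<le> \<tau>" using time[OF y x \<tau>] .
    then have "0 < \<tau>" using \<open>\<eta> > 0\<close> N_pos by (smt (verit) divide_pos_pos)
    have fr: "y \<tau> \<in> frontier S" by (rule first_hit_frontier[OF y \<open>0 < \<tau>\<close> \<tau>(2) out])
    have "\<tau> \<le> T" using \<tau>T[OF y x \<tau>(1) fr] cost \<epsilon> by simp
    have "y \<tau> \<in> cball x0 (\<eta> + N * T)"
    proof -
      have "dist x0 (y \<tau>) \<le> dist x0 x + dist x (y \<tau>)" by (rule dist_triangle)
      also have "dist x (y \<tau>) \<le> N * \<tau>"
        using traj_lipschitz[OF y, of 0 \<tau>] traj_0[OF y] \<tau> by (simp add: dist_norm norm_minus_commute)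
      also have "N * \<tau> \<le> N * T" using \<open>\<tau> \<le> T\<close> N_pos by simp
      finally show ?thesis using x by simp
    qed
    then obtain pg where pg: "ball (y \<tau>) \<delta>1 \<subseteq> W" "norm pg \<le> G" "supergrad_on g (ball (y \<tau>) \<delta>1) c (y \<tau>) pg"
      using reg fr by blast
    obtain \<xi> l \<omega> where ed: "end_data \<delta>1 c (y \<tau>) \<xi> pg l \<omega>"
      using end_data_exists[OF y \<open>0 < \<tau>\<close> refl \<tau>(2) out pg] by metis
    have l: "0 \<le> l" "l \<le> 1" using ed by (auto simp: end_data_def)
    have "dist x0 (y s) \<le> 2 * \<eta> \<and> r0 * s + V (y s) \<le> V x + \<epsilon> \<and> (\<exists>p. norm p \<le> P \<and> c1 \<le> norm p + l \<and> normal_at C \<delta> (y s) p l \<epsilon>)"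
      if s: "s \<in> {0..\<eta> / N}" for s
    proof (intro conjI)
      have s\<tau>: "0 \<le> s" "s \<le> \<tau>" "\<eta> / N \<le> \<tau> - s" using s \<tau>3 t0 by auto
      have "dist x0 (y s) \<le> dist x0 x + dist x (y s)" by (rule dist_triangle)
      also have "dist x (y s) \<le> N * s"
        using traj_lipschitz[OF y, of 0 s] traj_0[OF y] s by (simp add: dist_norm norm_minus_commute)
      also have "N * s \<le> \<eta>" using s N_pos by (simp add: pos_le_divide_eq mult.commute)
      finally show near: "dist x0 (y s) \<le> 2 * \<eta>" using x by simp
      have dp1: "V x \<le> rcost u y s + V (y s)"
        using dynamic_programming[OF y order_refl s\<tau>(1)] out s\<tau> traj_0[OF y] by simp
      have dp2: "V (y s) \<le> rcost u y \<tau> - rcost u y s + g (y \<tau>)"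
        using dynamic_programming[OF y s\<tau>(1,2)] out s\<tau> V_on_S[OF \<tau>(2)] by simp
      show "r0 * s + V (y s) \<le> V x + \<epsilon>" using dp2 cost rcost_ge[OF y order_refl s\<tau>(1)] by simp
      have sh: "traj (y s) (\<lambda>\<sigma>. u (s + \<sigma>)) (\<lambda>\<sigma>. y (s + \<sigma>))" by (rule traj_shift[OF y s\<tau>(1)])
      have "rcost (\<lambda>\<sigma>. u (s + \<sigma>)) (\<lambda>\<sigma>. y (s + \<sigma>)) (\<tau> - s) = rcost u y \<tau> - rcost u y s"
        using rcost_shift[OF y s\<tau>(1), of "\<tau> - s"] s\<tau> by simp
      then have "rcost (\<lambda>\<sigma>. u (s + \<sigma>)) (\<lambda>\<sigma>. y (s + \<sigma>)) (\<tau> - s) + g (y \<tau>) \<le> V (y s) + \<epsilon>"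
        using dp1 cost by simp
      from an[OF ed sh s\<tau>(3) _ _ \<epsilon>(1) _ this]
      obtain p where p: "norm p \<le> P" "c1 \<le> norm p + l" and
        n: "\<And>h a. norm h \<le> \<delta>2 \<Longrightarrow> \<bar>a\<bar> \<le> \<delta>2 \<Longrightarrow> y s + h \<notin> S \<Longrightarrow> V (y s) + a \<le> V (y s + h) \<Longrightarrow>
          l * a - p \<bullet> h \<le> C * ((norm h)\<^sup>2 + a\<^sup>2 + \<epsilon>)"
        using s\<tau> \<epsilon> \<open>\<tau> \<le> T\<close> by auto
      have "normal_at C \<delta> (y s) p l \<epsilon>"
        unfolding normal_at_def
      proof (intro allI impI)
        fix h a assume h: "norm h \<le> \<delta>" "\<bar>a\<bar> \<le> \<delta>" "V (y s) + a \<le> V (y s + h)"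
        have "dist x0 (y s + h) \<le> dist x0 (y s) + dist (y s) (y s + h)" by (rule dist_triangle)
        also have "\<dots> < 4 * \<eta>" using near h(1) \<open>\<eta> > 0\<close> by (simp add: \<delta>_def dist_norm)
        finally show "l * a - p \<bullet> h \<le> C * ((norm h)\<^sup>2 + a\<^sup>2 + \<epsilon>)"
          using n[of h a] outside h by (simp add: \<delta>_def)
      qed
      then show "\<exists>p. norm p \<le> P \<and> c1 \<le> norm p + l \<and> normal_at C \<delta> (y s) p l \<epsilon>" using p by blast
    qed
    then show "\<exists>u y l. traj x u y \<and> 0 \<le> l \<and> l \<le> 1 \<and>
      (\<forall>s\<in>{0..\<eta> / N}. dist x0 (y s) \<le> 2 * \<eta> \<and> r0 * s + V (y s) \<le> V x + \<epsilon> \<and>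
        (\<exists>p. norm p \<le> P \<and> c1 \<le> norm p + l \<and> normal_at C \<delta> (y s) p l \<epsilon>))"
      using y l by blast
  qed (use pos \<open>\<eta> > 0\<close> t0 in \<open>auto simp: \<delta>_def\<close>)
qed

lemma normal_at_limit:
  assumes x: "xn \<longlonglongrightarrow> x" and p: "pn \<longlonglongrightarrow> p" and l: "lm \<longlonglongrightarrow> l" and \<epsilon>: "en \<longlonglongrightarrow> 0" and "\<delta> > 0"
    and n: "\<And>n. normal_at C \<delta> (xn n) (pn n) (lm n) (en n)"
  shows "normal_at C (\<delta> / 2) x p l 0"
  unfolding normal_at_def
proof (intro allI impI)
  fix h a assume h: "norm h \<le> \<delta> / 2" "\<bar>a\<bar> \<le> \<delta> / 2" "V x + a \<le> V (x + h)"
  \<comment> \<open>Lowering \<open>a\<close> keeps the pair in the hypograph at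
    \<open>xn n\<close>, and continuity of \<open>V\<close> gives convergence back to
    \<open>a\<close>. The slack between \<open>\<delta> / 2\<close> and \<delta> allows for the
    change.\<close>
  define an where "an n = min a (V (xn n + h) - V (xn n))" for n
  have "(\<lambda>n. V (xn n + h)) \<longlonglongrightarrow> V (x + h)" "(\<lambda>n. V (xn n)) \<longlonglongrightarrow> V x"
    by (rule continuous_on_tendsto_compose[OF V_cont], intro tendsto_intros x, simp_all)+
  then have "an \<longlonglongrightarrow> min a (V (x + h) - V x)" unfolding an_def by (intro tendsto_intros)
  then have an: "an \<longlonglongrightarrow> a" using h by (simp add: min_def)
  have "\<forall>\<^sub>F n in sequentially. \<bar>an n\<bar> < \<delta>"
    using order_tendstoD(2)[OF tendsto_rabs[OF an], of \<delta>] h \<open>\<delta> > 0\<close> by simp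
  then have ev: "\<forall>\<^sub>F n in sequentially. lm n * an n - pn n \<bullet> h \<le> C * ((norm h)\<^sup>2 + (an n)\<^sup>2 + en n)"
  proof eventually_elim
    case (elim n)
    show ?case
      using n[of n, unfolded normal_at_def, rule_format, of h "an n"] elim h \<open>\<delta> > 0\<close> by (simp add: an_def)
  qed
  have "l * a - p \<bullet> h \<le> C * ((norm h)\<^sup>2 + a\<^sup>2 + 0)"
  proof (rule tendsto_le[OF sequentially_bot _ _ ev])
    show "(\<lambda>n. C * ((norm h)\<^sup>2 + (an n)\<^sup>2 + en n)) \<longlonglongrightarrow> C * ((norm h)\<^sup>2 + a\<^sup>2 + 0)"
      by (intro tendsto_intros an \<epsilon>)
    show "(\<lambda>n. lm n * an n - pn n \<bullet> h) \<longlonglongrightarrow> l * a - p \<bullet> h"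
      by (intro tendsto_intros an l p)
  qed
  then show "l * a - p \<bullet> h \<le> C * ((norm h)\<^sup>2 + a\<^sup>2 + 0)" .
qed

lemma normal_at_subseq_limit:
  assumes "xn \<longlonglongrightarrow> x" "\<And>n. norm (pn n) \<le> P" "lm \<longlonglongrightarrow> l" "en \<longlonglongrightarrow> 0" "\<delta> > 0"
    and n: "\<And>n. normal_at C \<delta> (xn n) (pn n) (lm n) (en n)" and c1: "\<And>n. c1 \<le> norm (pn n) + lm n"
  obtains p where "norm p \<le> P" "c1 \<le> norm p + l" "normal_at C (\<delta> / 2) x p l 0"
proof -
  obtain p k where k: "strict_mono k" and p: "(pn \<circ> k) \<longlonglongrightarrow> p"
    using bounded_sequence_convergent_subseq[of pn P] assms(2) by blast
  have sub: "(\<lambda>n. s (k n)) \<longlonglongrightarrow> b" if "s \<longlonglongrightarrow> b" for s and b :: "'z::topological_space"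
    using LIMSEQ_subseq_LIMSEQ[OF that k] by (simp add: comp_def)
  have pk: "(\<lambda>n. pn (k n)) \<longlonglongrightarrow> p" using p by (simp add: comp_def)
  show ?thesis
  proof (rule that[of p])
    show "norm p \<le> P" by (rule LIMSEQ_le_const2[OF tendsto_norm[OF pk]]) (use assms(2) in auto)
    show "c1 \<le> norm p + l"
      by (rule LIMSEQ_le_const[OF tendsto_add[OF tendsto_norm[OF pk] sub[OF assms(3)]]]) (use c1 in auto)
    show "normal_at C (\<delta> / 2) x p l 0"
      by (rule normal_at_limit[OF sub[OF assms(1)] pk sub[OF assms(3)] sub[OF assms(4)] \<open>\<delta> > 0\<close> n])
  qed
qed

text \<open>The normal cone asks for the inequality on the whole hypograph. Outside the box of size
  \<delta> one has \<open>\<delta> * norm h \<le> |h|^2 + a^2\<close>, so a larger constant absorbs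
  the linear term.\<close>

lemma horizon_superdiffI:
  assumes n: "normal_at C \<delta> x p 0 0" and "\<delta> > 0" "C \<ge> 0"
  shows "p \<in> horizon_superdiff S V x"
  unfolding horizon_superdiff_def mem_Collect_eq mem_proximal_normal_cone_hypo
proof (intro exI conjI ballI allI impI)
  show "0 \<le> C + norm p / \<delta>" using assms by simp
  fix z \<beta> assume "z \<in> closure (- S)" and \<beta>: "\<beta> \<le> V z"
  define h a where "h = z - x" and "a = \<beta> - V x"
  have sq: "0 \<le> (norm h)\<^sup>2 + a\<^sup>2" by simp
  have "- (p \<bullet> h) \<le> (C + norm p / \<delta>) * ((norm h)\<^sup>2 + a\<^sup>2)"
  proof (cases "norm h \<le> \<delta> \<and> \<bar>a\<bar> \<le> \<delta>")
    case True
    then have "- (p \<bullet> h) \<le> C * ((norm h)\<^sup>2 + a\<^sup>2)"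
      using n[unfolded normal_at_def, rule_format, of h a] \<beta> by (simp add: h_def a_def)
    also have "\<dots> \<le> (C + norm p / \<delta>) * ((norm h)\<^sup>2 + a\<^sup>2)"
      using assms by (intro mult_right_mono sq) auto
    finally show ?thesis .
  next
    case False
    have "- (p \<bullet> h) \<le> norm p * norm h" using Cauchy_Schwarz_ineq2[of p h] by simp
    also have "\<delta> * norm h \<le> (norm h)\<^sup>2 + a\<^sup>2"
    proof (cases "\<delta> < norm h")
      case True
      then have "\<delta> * norm h \<le> norm h * norm h" by (intro mult_right_mono) auto
      then show ?thesis by (simp add: power2_eq_square add_increasing2)
    next
      case F: False
      with False have "\<delta> < \<bar>a\<bar>" by simp
      then have "\<delta> * norm h \<le> \<bar>a\<bar> * \<bar>a\<bar>" using F \<open>\<delta> > 0\<close> by (intro mult_mono) auto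
      also have "\<dots> = a\<^sup>2" by (simp add: power2_eq_square)
      finally show ?thesis by (simp add: add_increasing)
    qed
    then have "norm p * norm h \<le> norm p * (((norm h)\<^sup>2 + a\<^sup>2) / \<delta>)"
      using \<open>\<delta> > 0\<close> by (intro mult_left_mono) (auto simp: pos_le_divide_eq mult.commute)
    then have "norm p * norm h \<le> norm p / \<delta> * ((norm h)\<^sup>2 + a\<^sup>2)" by simp
    also have "\<dots> \<le> (C + norm p / \<delta>) * ((norm h)\<^sup>2 + a\<^sup>2)"
      using assms by (intro mult_right_mono sq) auto
    finally show ?thesis .
  qed
  then show "- p \<bullet> (z - x) + 0 * (\<beta> - V x) \<le> (C + norm p / \<delta>) * ((norm (z - x))\<^sup>2 + (\<beta> - V x)\<^sup>2)"
    by (simp add: h_def a_def)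
qed

text \<open>Differentiability bounds the increment of \<open>V\<close> linearly in \<open>h\<close>.
  Along \<open>h = - \<theta> *\<^sub>R p\<close> with \<open>a\<close> this increment, the
  inequality compares a term linear in \<theta> with a quadratic one.\<close>

lemma horizontal_normal_not_differentiable:
  assumes n: "normal_at C \<delta> x p 0 0" and "\<delta> > 0" "C \<ge> 0" "p \<noteq> 0"
  shows "\<not> V differentiable (at x)"
proof
  assume "V differentiable (at x)"
  then obtain D where D: "(V has_derivative D) (at x)" by (auto simp: differentiable_def)
  obtain B where B: "\<And>h. norm (D h) \<le> norm h * B" "B \<ge> 0"
    using bounded_linear.nonneg_bounded[OF has_derivative_bounded_linear[OF D]] by metis
  obtain d where d: "d > 0" "\<And>y. norm (y - x) < d \<Longrightarrow> norm (V y - V x - D (y - x)) \<le> 1 * norm (y - x)"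
    using D unfolding has_derivative_at_alt by (metis zero_less_one)
  have lip: "\<bar>V (x + h) - V x\<bar> \<le> (B + 1) * norm h" if "norm h < d" for h
    using d(2)[of "x + h"] B(1)[of h] that by (simp add: algebra_simps abs_le_iff)
  have np: "norm p > 0" using \<open>p \<noteq> 0\<close> by simp
  have "(norm p)\<^sup>2 \<le> 0"
  proof (rule le_zero_if_le_small_multiples)
    show "min d (min \<delta> (\<delta> / (B + 1))) / norm p > 0" using d(1) \<open>\<delta> > 0\<close> B(2) np by simp
    fix \<theta> assume \<theta>: "0 < \<theta>" "\<theta> < min d (min \<delta> (\<delta> / (B + 1))) / norm p"
    define h where "h = - \<theta> *\<^sub>R p"
    define a where "a = V (x + h) - V x"
    have nh: "norm h = \<theta> * norm p" using \<theta> by (simp add: h_def)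
    then have "norm h < min d (min \<delta> (\<delta> / (B + 1)))" using \<theta> np by (simp add: pos_less_divide_eq)
    then have h: "norm h < d" "norm h \<le> \<delta>" "(B + 1) * norm h \<le> \<delta>"
      using B(2) by (auto simp: pos_less_divide_eq mult.commute)
    have a: "\<bar>a\<bar> \<le> (B + 1) * norm h" using lip[OF h(1)] by (simp add: a_def)
    have "- (p \<bullet> h) \<le> C * ((norm h)\<^sup>2 + a\<^sup>2)"
      using n[unfolded normal_at_def, rule_format, of h a] h a by (simp add: a_def)
    also have "a\<^sup>2 \<le> ((B + 1) * norm h)\<^sup>2" using a by (metis abs_ge_zero power2_abs power_mono)
    then have "C * ((norm h)\<^sup>2 + a\<^sup>2) \<le> C * ((norm h)\<^sup>2 + ((B + 1) * norm h)\<^sup>2)" using \<open>C \<ge> 0\<close> by (intro mult_left_mono) auto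
    also have "\<dots> = \<theta> * (\<theta> * (C * ((norm p)\<^sup>2 + ((B + 1) * norm p)\<^sup>2)))"
      by (simp add: nh power_mult_distrib power2_eq_square algebra_simps)
    finally have "\<theta> * (norm p)\<^sup>2 \<le> \<theta> * (\<theta> * (C * ((norm p)\<^sup>2 + ((B + 1) * norm p)\<^sup>2)))"
      by (simp add: h_def power2_norm_eq_inner)
    then show "(norm p)\<^sup>2 \<le> \<theta> * (C * ((norm p)\<^sup>2 + ((B + 1) * norm p)\<^sup>2))" using \<theta> by simp
  qed
  then show False using np by simp
qed

text \<open>A lower bound \<open>V x - K |y - x|\<close> near \<open>x\<close> would put the points
  \<open>(z, V x - K' |z - x|)\<close>, with \<open>z = x - \<theta> *\<^sub>R v\<close>, into the
  hypograph, and there the normal inequality compares a term linear in \<theta> with a quadratic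
  one.\<close>

lemma horizon_superdiff_steep:
  assumes v: "v \<in> horizon_superdiff S V x" "v \<noteq> 0" and "x \<notin> S" "R > 0"
  obtains y where "y \<in> cball x R" "V y + K * norm (y - x) < V x"
proof -
  obtain \<sigma> where \<sigma>: "\<sigma> \<ge> 0" and le: "\<And>z \<beta>. z \<in> closure (- S) \<Longrightarrow> \<beta> \<le> V z \<Longrightarrow> - v \<bullet> (z - x) \<le> \<sigma> * ((norm (z - x))\<^sup>2 + (\<beta> - V x)\<^sup>2)"
    using v(1) unfolding horizon_superdiff_def mem_Collect_eq mem_proximal_normal_cone_hypo by auto
  obtain d where "d > 0" and d: "ball x d \<subseteq> - S"
    using S_closed \<open>x \<notin> S\<close> open_contains_ball[of "- S"] by auto
  define n where "n = norm v"
  have n: "n > 0" using v by (simp add: n_def)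
  define K' where "K' = \<bar>K\<bar> + 1"
  have K': "K' > 0" by (simp add: K'_def)
  show ?thesis
  proof (rule ccontr)
    assume "\<not> thesis"
    with that have notsteep: "V x \<le> V y + K * norm (y - x)" if "y \<in> cball x R" for y using that by (meson not_less)
    have "n \<le> 0"
    proof (rule le_zero_if_le_small_multiples)
      show "min R d / n > 0" using \<open>R > 0\<close> \<open>d > 0\<close> n by simp
      fix \<theta> assume \<theta>: "0 < \<theta>" "\<theta> < min R d / n"
      define z where "z = x - \<theta> *\<^sub>R v"
      have nz: "norm (z - x) = \<theta> * n" using \<theta> by (simp add: z_def n_def)
      then have "norm (z - x) < min R d" using \<theta> n by (simp add: pos_less_divide_eq)
      then have z: "z \<in> cball x R" "z \<in> ball x d" by (auto simp: dist_norm norm_minus_commute)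
      have "z \<in> closure (- S)" using z d closure_subset by blast
      moreover have "V x - K' * (\<theta> * n) \<le> V z"
      proof -
        have "K * (\<theta> * n) \<le> K' * (\<theta> * n)" using \<theta> n by (intro mult_right_mono) (auto simp: K'_def)
        then show ?thesis using notsteep[OF z(1)] nz by simp
      qed
      ultimately have "- v \<bullet> (z - x) \<le> \<sigma> * ((\<theta> * n)\<^sup>2 + (K' * (\<theta> * n))\<^sup>2)"
        using le[of z "V x - K' * (\<theta> * n)"] nz by simp
      moreover have "- v \<bullet> (z - x) = \<theta> * n\<^sup>2" by (simp add: z_def n_def power2_norm_eq_inner)
      ultimately have "(\<theta> * n) * n \<le> (\<theta> * n) * (\<theta> * (\<sigma> * (n + K'\<^sup>2 * n)))"
        by (simp add: power2_eq_square algebra_simps)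
      then show "n \<le> \<theta> * (\<sigma> * (n + K'\<^sup>2 * n))" using \<theta> n by simp
    qed
    then show False using n by simp
  qed
qed

text \<open>Minimising \<open>V + K |y - x|\<close> produces a point with a proximal subgradient of norm \<open>K\<close>.\<close>

lemma steep_subgradient:
  assumes v: "v \<in> horizon_superdiff S V x" "v \<noteq> 0" and "x \<notin> S" "R > 0" "K0' > 0"
  obtains y \<zeta> :: 'a and K \<sigma> d :: real where "norm (y - x) < R" "K \<ge> K0'" "norm \<zeta> = K" "d > 0" "\<sigma> \<ge> 0"
    "\<And>h. norm h \<le> d \<Longrightarrow> V y + \<zeta> \<bullet> h - \<sigma> * (norm h)\<^sup>2 \<le> V (y + h)"
proof -
  have "compact (V ` cball x R)"
    by (intro compact_continuous_image continuous_on_subset[OF V_cont]) auto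
  then obtain B where B: "\<And>y. y \<in> cball x R \<Longrightarrow> \<bar>V y\<bar> \<le> B" using compact_imp_bounded bounded_iff
    by (metis imageI real_norm_def)
  \<comment> \<open>The second bound forces the minimiser to within \<open>R / 2\<close> of
    \<open>x\<close>, so that a neighbourhood of it stays in \<open>cball x R\<close>.\<close>
  define K where "K = max K0' (2 * (2 * \<bar>B\<bar> + 1) / R)"
  have K: "K > 0" "K \<ge> K0'" "2 * (2 * \<bar>B\<bar> + 1) \<le> K * R"
    using \<open>K0' > 0\<close> \<open>R > 0\<close> by (auto simp: K_def pos_divide_le_eq[symmetric] less_max_iff_disj)
  have "\<exists>y\<in>cball x R. \<forall>z\<in>cball x R. V y + K * norm (y - x) \<le> V z + K * norm (z - x)"
    by (rule continuous_attains_inf) (use \<open>R > 0\<close> in \<open>auto intro!: continuous_intros continuous_on_subset[OF V_cont]\<close>)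
  then obtain y where y: "y \<in> cball x R" and min: "\<And>z. z \<in> cball x R \<Longrightarrow> V y + K * norm (y - x) \<le> V z + K * norm (z - x)"
    by blast
  \<comment> \<open>Steepness excludes \<open>x\<close> as the minimiser, the only point where the
    penalty \<open>|y - x|\<close> is not smooth.\<close>
  obtain y1 where "y1 \<in> cball x R" "V y1 + K * norm (y1 - x) < V x"
    using horizon_superdiff_steep[OF v \<open>x \<notin> S\<close> \<open>R > 0\<close>] by metis
  then have yx: "V y + K * norm (y - x) < V x" using min by fastforce
  then have "y \<noteq> x" by auto
  have "K * norm (y - x) \<le> 2 * \<bar>B\<bar>" using yx B[OF y] B[of x] \<open>R > 0\<close> by (simp add: abs_le_iff)
  then have "K * (2 * norm (y - x)) < K * R" using K(3) by simp
  then have near: "norm (y - x) < R / 2" using K(1) by simp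
  define w where "w = y - x"
  have "w \<noteq> 0" using \<open>y \<noteq> x\<close> by (simp add: w_def)
  show ?thesis
  proof (rule that[of y K "- (K / norm w) *\<^sub>R w" "R / 2" "K / (2 * norm w)"])
    show "norm (- (K / norm w) *\<^sub>R w) = K" using K \<open>w \<noteq> 0\<close> by simp
    fix h :: 'a assume h: "norm h \<le> R / 2"
    have "norm (y + h - x) \<le> norm (y - x) + norm h" using norm_triangle_ineq[of "y - x" h] by (simp add: algebra_simps)
    then have "y + h \<in> cball x R" using h near by (simp add: dist_norm norm_minus_commute)
    then have "V y + K * norm w \<le> V (y + h) + K * norm (w + h)" using min[of "y + h"] by (simp add: w_def algebra_simps)
    also have "K * norm (w + h) \<le> K * (norm w + (w \<bullet> h) / norm w + (norm h)\<^sup>2 / (2 * norm w))"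
      using K norm_add_le_first_order[OF \<open>w \<noteq> 0\<close>] by (intro mult_left_mono) auto
    finally show "V y + (- (K / norm w) *\<^sub>R w) \<bullet> h - K / (2 * norm w) * (norm h)\<^sup>2 \<le> V (y + h)"
      by (simp add: algebra_simps)
  qed (use K near \<open>R > 0\<close> in auto)
qed

text \<open>At a point with a proximal subgradient \<open>\<zeta>\<close> the only normal direction is \<open>(- \<zeta>, 1)\<close>.\<close>

lemma normal_at_subgradient:
  assumes "d > 0" "\<sigma> \<ge> 0" "C > 0" "\<delta> > 0" "\<epsilon>0 > 0"
    and sub: "\<And>h. norm h \<le> d \<Longrightarrow> V y + \<zeta> \<bullet> h - \<sigma> * (norm h)\<^sup>2 \<le> V (y + h)"
  obtains \<epsilon> where "0 < \<epsilon>" "\<epsilon> \<le> \<epsilon>0" "\<And>p l. 0 \<le> l \<Longrightarrow> l \<le> 1 \<Longrightarrow> normal_at C \<delta> y p l \<epsilon> \<Longrightarrow> norm (l *\<^sub>R \<zeta> - p) \<le> 1"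
proof -
  define A where "A = norm \<zeta> + \<sigma>"
  have A: "A \<ge> 0" using assms by (simp add: A_def)
  define C' where "C' = \<sigma> + C * (1 + A\<^sup>2)"
  have C': "C' > 0" using assms by (simp add: C'_def add_nonneg_pos mult_pos_pos add_pos_nonneg)
  \<comment> \<open>Step length along \<open>l *\<^sub>R \<zeta> - p\<close>. The gain is linear in
    \<theta>; \<open>C' * \<theta> \<le> 1 / 2\<close> and the choice of \<epsilon> keep the error
    below \<theta>. The other bounds keep \<open>h\<close> and \<open>a\<close> where the
    inequalities hold.\<close>
  define \<theta> where "\<theta> = min (min 1 d) (min (min \<delta> (\<delta> / (A + 1))) (1 / (2 * C')))"
  have \<theta>: "\<theta> > 0" using assms C' A by (simp add: \<theta>_def)
  have \<theta>le: "\<theta> \<le> 1" "\<theta> \<le> d" "\<theta> \<le> \<delta>" "\<theta> \<le> \<delta> / (A + 1)" "\<theta> \<le> 1 / (2 * C')" by (auto simp: \<theta>_def)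
  have A\<theta>: "A * \<theta> \<le> \<delta>"
  proof -
    have "(A + 1) * \<theta> \<le> \<delta>" using \<theta>le(4) A by (simp add: pos_le_divide_eq mult.commute)
    then show ?thesis using \<theta> by (simp add: distrib_right)
  qed
  have C\<theta>: "C' * \<theta> \<le> 1 / 2" using \<theta>le(5) C' by (simp add: pos_le_divide_eq mult_ac)
  define \<epsilon> where "\<epsilon> = min \<epsilon>0 (\<theta> / (2 * C))"
  show ?thesis
  proof (rule that[of \<epsilon>])
    show "0 < \<epsilon>" "\<epsilon> \<le> \<epsilon>0" using assms \<theta> by (auto simp: \<epsilon>_def)
    have C\<epsilon>: "C * \<epsilon> \<le> \<theta> / 2"
    proof -
      have "C * \<epsilon> \<le> C * (\<theta> / (2 * C))" using \<open>C > 0\<close> by (intro mult_left_mono) (auto simp: \<epsilon>_def)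
      then show ?thesis using \<open>C > 0\<close> by simp
    qed
    fix p l assume l: "0 \<le> l" "l \<le> (1::real)" and n: "normal_at C \<delta> y p l \<epsilon>"
    define w where "w = l *\<^sub>R \<zeta> - p"
    show "norm (l *\<^sub>R \<zeta> - p) \<le> 1"
    proof (cases "w = 0")
      case False
      define h where "h = (\<theta> / norm w) *\<^sub>R w"
      have nh: "norm h = \<theta>" using False \<theta> by (simp add: h_def)
      define a where "a = \<zeta> \<bullet> h - \<sigma> * (norm h)\<^sup>2"
      have "\<bar>a\<bar> \<le> A * \<theta>"
      proof -
        have "\<bar>\<zeta> \<bullet> h\<bar> \<le> norm \<zeta> * \<theta>" using Cauchy_Schwarz_ineq2[of \<zeta> h] nh by simp
        moreover have "\<sigma> * \<theta>\<^sup>2 \<le> \<sigma> * \<theta>" using assms \<theta> \<theta>le(1) by (intro mult_left_mono) (auto simp: power2_eq_square mult_left_le)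
        moreover have "0 \<le> \<sigma> * \<theta>\<^sup>2" using assms by simp
        ultimately show ?thesis unfolding a_def nh A_def distrib_right by linarith
      qed
      then have a\<delta>: "\<bar>a\<bar> \<le> \<delta>" and a2: "a\<^sup>2 \<le> (A * \<theta>)\<^sup>2" using A\<theta> by (auto intro: order_trans simp: abs_le_square_iff[symmetric])
      have "V y + a \<le> V (y + h)" using sub[of h] \<theta>le nh by (simp add: a_def)
      then have "l * a - p \<bullet> h \<le> C * ((norm h)\<^sup>2 + a\<^sup>2 + \<epsilon>)"
        using n[unfolded normal_at_def, rule_format, of h a] nh \<theta>le a\<delta> by simp
      also have "\<dots> \<le> C * (\<theta>\<^sup>2 + (A * \<theta>)\<^sup>2 + \<epsilon>)" using a2 nh \<open>C > 0\<close> by simp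
      finally have "l * a - p \<bullet> h \<le> C * (1 + A\<^sup>2) * \<theta>\<^sup>2 + C * \<epsilon>" by (simp add: power_mult_distrib algebra_simps)
      moreover have "w \<bullet> h = l * a - p \<bullet> h + l * (\<sigma> * \<theta>\<^sup>2)"
        by (simp add: w_def a_def nh inner_diff_left right_diff_distrib)
      moreover have "l * (\<sigma> * \<theta>\<^sup>2) \<le> 1 * (\<sigma> * \<theta>\<^sup>2)" using l assms by (intro mult_right_mono) auto
      ultimately have "w \<bullet> h \<le> C' * \<theta>\<^sup>2 + C * \<epsilon>" by (simp add: C'_def distrib_right)
      also have "C' * \<theta>\<^sup>2 \<le> 1 / 2 * \<theta>" using mult_right_mono[OF C\<theta>, of \<theta>] \<theta> by (simp add: power2_eq_square)
      finally have "w \<bullet> h \<le> \<theta>" using C\<epsilon> by simp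
      moreover have "w \<bullet> h = \<theta> * norm w" using False by (simp add: h_def power2_norm_eq_inner[symmetric] power2_eq_square)
      ultimately show ?thesis using \<theta> by (simp add: w_def)
    qed (simp add: w_def)
  qed
qed


section \<open>Points with horizontal normals\<close>

text \<open>The multiplier is estimated only at the starting points, where \<open>l\<close> times
  the norm of a steep subgradient is at most \<open>1 + P\<close>. Since \<open>l\<close> is
  constant along each trajectory, every point of the limit curve gets a normal with multiplier
  0.\<close>

lemma horizontal_arc:
  assumes x: "x \<notin> S" and v: "v \<in> horizon_superdiff S V x" "v \<noteq> 0"
  obtains \<sigma> :: real and arc where "\<sigma> > 0" "N-lipschitz_on {0..\<sigma>} arc" "arc 0 = x"
    "\<And>s. s \<in> {0<..\<sigma>} \<Longrightarrow> arc s \<in> singular_set S V - {x}"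
proof -
  obtain \<eta> C \<delta> c1 P s0 \<epsilon>0 where pos: "\<eta> > 0" "C > 0" "\<delta> > 0" "c1 > 0" "P > 0" "s0 > 0" "\<epsilon>0 > 0"
    and outside: "cball x (2 * \<eta>) \<inter> S = {}"
    and tn: "\<And>x' \<epsilon>. x' \<in> ball x \<eta> \<Longrightarrow> 0 < \<epsilon> \<Longrightarrow> \<epsilon> \<le> \<epsilon>0 \<Longrightarrow> \<exists>u y l. traj x' u y \<and> 0 \<le> l \<and> l \<le> 1 \<and>
      (\<forall>s\<in>{0..s0}. dist x (y s) \<le> 2 * \<eta> \<and> r0 * s + V (y s) \<le> V x' + \<epsilon> \<and>
        (\<exists>p. norm p \<le> P \<and> c1 \<le> norm p + l \<and> normal_at C \<delta> (y s) p l \<epsilon>))"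
    using trajectory_normals[OF x] by metis
  have "\<exists>x' y l \<epsilon>. norm (x' - x) < 1 / real (Suc n) \<and> 0 < \<epsilon> \<and> \<epsilon> \<le> 1 / real (Suc n) \<and> (\<exists>u. traj x' u y) \<and> 0 \<le> l \<and> l \<le> (1 + P) / real (Suc n) \<and>
      (\<forall>s\<in>{0..s0}. dist x (y s) \<le> 2 * \<eta> \<and> r0 * s + V (y s) \<le> V x' + \<epsilon> \<and>
        (\<exists>p. norm p \<le> P \<and> c1 \<le> norm p + l \<and> normal_at C \<delta> (y s) p l \<epsilon>))" for n :: nat
  proof -
    have R: "min \<eta> (1 / real (Suc n)) > 0" using pos by simp
    have K: "real (Suc n) > 0" by simp
    obtain x' \<zeta> K \<sigma> d where x': "norm (x' - x) < min \<eta> (1 / real (Suc n))" and K: "K \<ge> real (Suc n)" "norm \<zeta> = K"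
      and d: "d > 0" "\<sigma> \<ge> 0" and sub: "\<And>h. norm h \<le> d \<Longrightarrow> V x' + \<zeta> \<bullet> h - \<sigma> * (norm h)\<^sup>2 \<le> V (x' + h)"
      using steep_subgradient[OF v x R K] by metis
    have "min \<epsilon>0 (1 / real (Suc n)) > 0" using pos by simp
    then obtain \<epsilon> where \<epsilon>: "0 < \<epsilon>" "\<epsilon> \<le> min \<epsilon>0 (1 / real (Suc n))"
      and dir: "\<And>p l. 0 \<le> l \<Longrightarrow> l \<le> 1 \<Longrightarrow> normal_at C \<delta> x' p l \<epsilon> \<Longrightarrow> norm (l *\<^sub>R \<zeta> - p) \<le> 1"
      using normal_at_subgradient[OF d pos(2,3) _ sub] by metis
    have "x' \<in> ball x \<eta>" using x' by (simp add: dist_norm norm_minus_commute)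
    then obtain u y l where y: "traj x' u y" "0 \<le> l" "l \<le> 1" and nrm: "\<forall>s\<in>{0..s0}. dist x (y s) \<le> 2 * \<eta> \<and> r0 * s + V (y s) \<le> V x' + \<epsilon> \<and>
        (\<exists>p. norm p \<le> P \<and> c1 \<le> norm p + l \<and> normal_at C \<delta> (y s) p l \<epsilon>)"
      using tn[of x' \<epsilon>] \<epsilon> by auto
    obtain p where p: "norm p \<le> P" "normal_at C \<delta> x' p l \<epsilon>"
      using nrm[rule_format, of 0] pos traj_0[OF y(1)] by auto
    have "l * K = norm (l *\<^sub>R \<zeta>)" using K y by simp
    also have "\<dots> \<le> norm (l *\<^sub>R \<zeta> - p) + norm p" using norm_triangle_sub[of "l *\<^sub>R \<zeta>" p] by simp
    finally have "l * K \<le> 1 + P" using dir[OF y(2,3) p(2)] p(1) by simp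
    moreover have "l * real (Suc n) \<le> l * K" using K y by (intro mult_left_mono) auto
    ultimately have "l \<le> (1 + P) / real (Suc n)" by (subst pos_le_divide_eq) auto
    then show ?thesis using x' \<epsilon> y nrm by (intro exI[of _ x'] exI[of _ y] exI[of _ l] exI[of _ \<epsilon>]) auto
  qed
  then obtain xn yn lm en where
    xn: "\<And>n. norm (xn n - x) < 1 / real (Suc n)" and en: "\<And>n. 0 < en n" "\<And>n. en n \<le> 1 / real (Suc n)"
    and tr: "\<And>n. \<exists>u. traj (xn n) u (yn n)" and lm: "\<And>n. 0 \<le> lm n" "\<And>n. lm n \<le> (1 + P) / real (Suc n)"
    and nrm: "\<And>n s. s \<in> {0..s0} \<Longrightarrow> dist x (yn n s) \<le> 2 * \<eta> \<and> r0 * s + V (yn n s) \<le> V (xn n) + en n \<and>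
        (\<exists>p. norm p \<le> P \<and> c1 \<le> norm p + lm n \<and> normal_at C \<delta> (yn n s) p (lm n) (en n))"
    by metis
  have inv0: "(\<lambda>n. c / real (Suc n)) \<longlonglongrightarrow> 0" for c
    using tendsto_mult_right_zero[OF LIMSEQ_inverse_real_of_nat, of c] by (simp add: inverse_eq_divide)
  have "(\<lambda>n. norm (xn n - x)) \<longlonglongrightarrow> 0"
    by (rule tendsto_sandwich[OF _ _ tendsto_const inv0[of 1]]) (auto intro!: always_eventually less_imp_le[OF xn] simp del: of_nat_Suc)
  then have xn_lim: "xn \<longlonglongrightarrow> x" using tendsto_norm_zero_iff LIM_zero_iff by blast
  have en_lim: "en \<longlonglongrightarrow> 0"
    by (rule tendsto_sandwich[OF _ _ tendsto_const inv0[of 1]]) (auto intro!: always_eventually less_imp_le[OF en(1)] en(2) simp del: of_nat_Suc)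
  have lm_lim: "lm \<longlonglongrightarrow> 0"
    by (rule tendsto_sandwich[OF _ _ tendsto_const inv0[of "1 + P"]]) (auto intro!: always_eventually lm simp del: of_nat_Suc)
  have lip: "norm (yn n t - yn n s) \<le> N * \<bar>t - s\<bar>" if "0 \<le> s" "0 \<le> t" for n s t
    using tr[of n] traj_lipschitz that by blast
  have yn0: "yn n 0 = xn n" for n using tr[of n] traj_0 by blast
  obtain arc k where arc: "continuous_on {0..s0} arc" and k: "strict_mono (k :: nat \<Rightarrow> nat)"
    and conv: "\<And>e. 0 < e \<Longrightarrow> \<exists>M. \<forall>n t. n \<ge> M \<and> t \<in> {0..s0} \<longrightarrow> norm (yn (k n) t - arc t) < e"
  proof (rule Arzela_Ascoli[of "{0..s0}" yn "norm x + 2 * \<eta>"])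
    show "norm (yn n t) \<le> norm x + 2 * \<eta>" if "t \<in> {0..s0}" for n t
      using nrm[OF that, of n] norm_triangle_sub[of "yn n t" x] by (simp add: dist_norm norm_minus_commute)
    fix t e :: real assume t: "t \<in> {0..s0}" and "0 < e"
    show "\<exists>d>0. \<forall>n s. s \<in> {0..s0} \<and> norm (t - s) < d \<longrightarrow> norm (yn n t - yn n s) < e"
    proof (intro exI[of _ "e / N"] conjI allI impI)
      show "0 < e / N" using \<open>0 < e\<close> N_pos by simp
      fix n s assume s: "s \<in> {0..s0} \<and> norm (t - s) < e / N"
      then have "N * \<bar>t - s\<bar> < e" using N_pos by (simp add: pos_less_divide_eq mult.commute)
      then show "norm (yn n t - yn n s) < e" using lip[of s t n] s t by simp
    qed
  qed auto
  have lim: "(\<lambda>n. yn (k n) t) \<longlonglongrightarrow> arc t" if "t \<in> {0..s0}" for t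
    unfolding LIMSEQ_iff using conv that by blast
  have sub: "(\<lambda>n. s (k n)) \<longlonglongrightarrow> b" if "s \<longlonglongrightarrow> b" for s and b :: "'z::topological_space"
    using LIMSEQ_subseq_LIMSEQ[OF that k] by (simp add: comp_def)
  have arc0: "arc 0 = x"
    using LIMSEQ_unique[OF lim[of 0]] sub[OF xn_lim] pos by (simp add: yn0)
  have sing: "arc s \<in> singular_set S V - {x}" if s: "s \<in> {0<..s0}" for s
  proof -
    have s': "s \<in> {0..s0}" using s by auto
    have "dist x (arc s) \<le> 2 * \<eta>"
      by (rule LIMSEQ_le_const2[OF tendsto_dist[OF tendsto_const lim[OF s']]]) (use nrm[OF s'] in auto)
    then have "arc s \<notin> S" using outside by auto
    \<comment> \<open>The cost rate \<open>r0\<close> makes \<open>V\<close> strictly smaller than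
      at \<open>x\<close>, so the curve never returns there.\<close>
    have "r0 * s + V (arc s) \<le> V x + 0"
    proof (rule LIMSEQ_le)
      show "(\<lambda>n. r0 * s + V (yn (k n) s)) \<longlonglongrightarrow> r0 * s + V (arc s)"
        by (intro tendsto_intros continuous_on_tendsto_compose[OF V_cont lim[OF s']]) auto
      show "(\<lambda>n. V (xn (k n)) + en (k n)) \<longlonglongrightarrow> V x + 0"
        by (intro tendsto_intros continuous_on_tendsto_compose[OF V_cont sub[OF xn_lim]] sub[OF en_lim]) auto
    qed (use nrm[OF s'] in blast)
    moreover have "0 < r0 * s" using r0_pos s by simp
    ultimately have "arc s \<noteq> x" by auto
    have "\<forall>n. \<exists>p. norm p \<le> P \<and> c1 \<le> norm p + lm (k n) \<and> normal_at C \<delta> (yn (k n) s) p (lm (k n)) (en (k n))"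
      using nrm[OF s'] by blast
    from choice[OF this] obtain pn where pn: "\<And>n. norm (pn n) \<le> P" "\<And>n. c1 \<le> norm (pn n) + lm (k n)"
      "\<And>n. normal_at C \<delta> (yn (k n) s) (pn n) (lm (k n)) (en (k n))" by blast
    obtain p where p: "c1 \<le> norm p + 0" "normal_at C (\<delta> / 2) (arc s) p 0 0"
      using normal_at_subseq_limit[OF lim[OF s'] pn(1) sub[OF lm_lim] sub[OF en_lim] pos(3) pn(3,2)] by metis
    then have "\<not> V differentiable (at (arc s))"
      by (intro horizontal_normal_not_differentiable[of C "\<delta> / 2" "arc s" p]) (use pos p in auto)
    then show ?thesis using \<open>arc s \<notin> S\<close> \<open>arc s \<noteq> x\<close> by (simp add: singular_set_def)
  qed
  show ?thesis
  proof (rule that[of s0 arc])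
    show "N-lipschitz_on {0..s0} arc"
    proof (rule lipschitz_onI)
      fix s t assume st: "s \<in> {0..s0}" "t \<in> {0..s0}"
      show "dist (arc s) (arc t) \<le> N * dist s t"
        by (rule LIMSEQ_le_const2[OF tendsto_dist[OF lim[OF st(1)] lim[OF st(2)]]])
          (use lip st in \<open>auto simp: dist_norm\<close>)
    qed (use N_pos in simp)
  qed (use pos arc0 sing in auto)
qed

section \<open>Points without horizontal normals\<close>

text \<open>Near \<open>x\<close> the multipliers stay above some \<open>l0\<close>, since otherwise
  a limit would be a nonzero horizontal normal at \<open>x\<close>. Dividing by \<open>l\<close>
  leaves quadratic bounds that still contain the squared increment of \<open>V\<close>; small
  oscillation turns them into a Lipschitz bound, and this into semiconcavity.\<close>

lemma locally_semiconcave_value: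
  assumes x: "x \<notin> S" and nh: "horizon_superdiff S V x \<subseteq> {0}"
  obtains R K C where "R > 0" "C \<ge> 0" "cball x R \<inter> S = {}"
    "\<And>y. y \<in> cball x R \<Longrightarrow> \<exists>p. norm p \<le> K \<and> supergrad_on V (cball x R) C y p"
proof -
  obtain \<eta> C \<delta> c1 P s0 \<epsilon>0 where pos: "\<eta> > 0" "C > 0" "\<delta> > 0" "c1 > 0" "P > 0" "s0 > 0" "\<epsilon>0 > 0"
    and outside: "cball x (2 * \<eta>) \<inter> S = {}"
    and tn: "\<And>x' \<epsilon>. x' \<in> ball x \<eta> \<Longrightarrow> 0 < \<epsilon> \<Longrightarrow> \<epsilon> \<le> \<epsilon>0 \<Longrightarrow> \<exists>u y l. traj x' u y \<and> 0 \<le> l \<and> l \<le> 1 \<and>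
      (\<forall>s\<in>{0..s0}. dist x (y s) \<le> 2 * \<eta> \<and> r0 * s + V (y s) \<le> V x' + \<epsilon> \<and>
        (\<exists>p. norm p \<le> P \<and> c1 \<le> norm p + l \<and> normal_at C \<delta> (y s) p l \<epsilon>))"
    using trajectory_normals[OF x] by metis
  define \<delta>1 where "\<delta>1 = \<delta> / 2"
  have \<delta>1: "\<delta>1 > 0" using pos by (simp add: \<delta>1_def)
  have inv0: "(\<lambda>n. c / real (Suc n)) \<longlonglongrightarrow> 0" for c
    using tendsto_mult_right_zero[OF LIMSEQ_inverse_real_of_nat, of c] by (simp add: inverse_eq_divide)
  \<comment> \<open>Letting \<epsilon> tend to 0 at a fixed point removes the error and keeps the
    uniform constants.\<close>
  have exact: "\<exists>p l. norm p \<le> P \<and> 0 \<le> l \<and> c1 \<le> norm p + l \<and> normal_at C \<delta>1 x' p l 0" if x': "x' \<in> ball x \<eta>" for x'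
  proof -
    have "\<exists>p l. norm p \<le> P \<and> 0 \<le> l \<and> l \<le> 1 \<and> c1 \<le> norm p + l \<and> normal_at C \<delta> x' p l (\<epsilon>0 / real (Suc n))" for n :: nat
    proof -
      have "0 < \<epsilon>0 / real (Suc n)" "\<epsilon>0 / real (Suc n) \<le> \<epsilon>0" using pos by (auto simp: divide_simps mult_le_cancel_left1)
      then obtain u y l where y: "traj x' u y" "0 \<le> l" "l \<le> 1" and nn: "\<forall>s\<in>{0..s0}. dist x (y s) \<le> 2 * \<eta> \<and> r0 * s + V (y s) \<le> V x' + \<epsilon>0 / real (Suc n) \<and>
        (\<exists>p. norm p \<le> P \<and> c1 \<le> norm p + l \<and> normal_at C \<delta> (y s) p l (\<epsilon>0 / real (Suc n)))"
        using tn[OF x'] by blast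
      have "(0::real) \<in> {0..s0}" using pos by simp
      from nn[rule_format, OF this] show ?thesis using y traj_0[OF y(1)] by auto
    qed
    then obtain pn lm where pl: "\<And>n. norm (pn n) \<le> P" "\<And>n. 0 \<le> lm n" "\<And>n. lm n \<le> (1::real)" "\<And>n. c1 \<le> norm (pn n) + lm n"
      "\<And>n. normal_at C \<delta> x' (pn n) (lm n) (\<epsilon>0 / real (Suc n))" by metis
    have "norm (lm n) \<le> 1" for n using pl(2,3)[of n] by simp
    then obtain l k where k: "strict_mono k" and l: "(lm \<circ> k) \<longlonglongrightarrow> l"
      using bounded_sequence_convergent_subseq[of lm 1] by blast
    have e0: "(\<lambda>n. \<epsilon>0 / real (Suc (k n))) \<longlonglongrightarrow> 0"
      using LIMSEQ_subseq_LIMSEQ[OF inv0[of \<epsilon>0] k] by (simp add: comp_def)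
    obtain p where "norm p \<le> P" "c1 \<le> norm p + l" "normal_at C (\<delta> / 2) x' p l 0"
      using normal_at_subseq_limit[of "\<lambda>_. x'" x' "\<lambda>n. pn (k n)" P "\<lambda>n. lm (k n)" l "\<lambda>n. \<epsilon>0 / real (Suc (k n))" \<delta> C c1]
        l pl e0 pos(3) by (auto simp: comp_def)
    moreover have "0 \<le> l" by (rule LIMSEQ_le_const[OF l]) (use pl in auto)
    ultimately show ?thesis unfolding \<delta>1_def by blast
  qed
  have "\<exists>d>0. \<exists>l0>0. \<forall>x' p l. dist x x' < d \<longrightarrow> norm p \<le> P \<longrightarrow> 0 \<le> l \<longrightarrow> c1 \<le> norm p + l \<longrightarrow> normal_at C \<delta>1 x' p l 0 \<longrightarrow> l0 \<le> l"
  proof (rule ccontr)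
    assume neg: "\<not> ?thesis"
    have "\<exists>x' p l. dist x x' < 1 / real (Suc n) \<and> norm p \<le> P \<and> 0 \<le> l \<and> c1 \<le> norm p + l \<and> normal_at C \<delta>1 x' p l 0 \<and> l < 1 / real (Suc n)" for n :: nat
    proof -
      have "1 / real (Suc n) > 0" by simp
      with neg show ?thesis by (meson not_less)
    qed
    then obtain xn pn lm where s: "\<And>n. dist x (xn n) < 1 / real (Suc n)" "\<And>n. norm (pn n) \<le> P" "\<And>n. 0 \<le> lm n" "\<And>n. c1 \<le> norm (pn n) + lm n"
      "\<And>n. normal_at C \<delta>1 (xn n) (pn n) (lm n) 0" "\<And>n. lm n < 1 / real (Suc n)" by metis
    have "(\<lambda>n. dist (xn n) x) \<longlonglongrightarrow> 0"
      by (rule tendsto_sandwich[OF _ _ tendsto_const inv0[of 1]]) (auto intro!: always_eventually less_imp_le[OF s(1)] simp: dist_commute[of _ x] simp del: of_nat_Suc)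
    then have xl: "xn \<longlonglongrightarrow> x" using tendsto_dist_iff by blast
    have ll: "lm \<longlonglongrightarrow> 0"
      by (rule tendsto_sandwich[OF _ _ tendsto_const inv0[of 1]]) (auto intro!: always_eventually less_imp_le[OF s(6)] s(3) simp del: of_nat_Suc)
    obtain p where p: "c1 \<le> norm p + 0" "normal_at C (\<delta>1 / 2) x p 0 0"
      using normal_at_subseq_limit[OF xl s(2) ll tendsto_const \<delta>1 s(5,4)] by metis
    have "p \<in> horizon_superdiff S V x"
      by (rule horizon_superdiffI[OF p(2)]) (use \<delta>1 pos in auto)
    then have "p = 0" using nh by blast
    then show False using p(1) pos by simp
  qed
  then obtain d l0 where "d > 0" "l0 > 0" and l0: "\<And>x' p l. dist x x' < d \<Longrightarrow> norm p \<le> P \<Longrightarrow> 0 \<le> l \<Longrightarrow> c1 \<le> norm p + l \<Longrightarrow> normal_at C \<delta>1 x' p l 0 \<Longrightarrow> l0 \<le> l"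
    by metis
  define P' where "P' = P / l0"
  define C' where "C' = C / l0"
  have PC: "P' > 0" "C' > 0" using pos \<open>l0 > 0\<close> by (auto simp: P'_def C'_def)
  have grad: "\<exists>q. norm q \<le> P' \<and> (\<forall>h a. norm h \<le> \<delta>1 \<longrightarrow> \<bar>a\<bar> \<le> \<delta>1 \<longrightarrow> V y + a \<le> V (y + h) \<longrightarrow> a \<le> q \<bullet> h + C' * ((norm h)\<^sup>2 + a\<^sup>2))"
    if y: "dist x y < min d \<eta>" for y
  proof -
    obtain p l where pl: "norm p \<le> P" "0 \<le> l" "c1 \<le> norm p + l" "normal_at C \<delta>1 y p l 0"
      using exact[of y] y by auto
    have l: "l0 \<le> l" using l0[of y p l] y pl by simp
    then have "l > 0" using \<open>l0 > 0\<close> by simp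
    have "a \<le> ((1 / l) *\<^sub>R p) \<bullet> h + C' * ((norm h)\<^sup>2 + a\<^sup>2)" if "norm h \<le> \<delta>1" "\<bar>a\<bar> \<le> \<delta>1" "V y + a \<le> V (y + h)" for h a
    proof -
      have "l * a - p \<bullet> h \<le> C * ((norm h)\<^sup>2 + a\<^sup>2)" using pl(4) that by (simp add: normal_at_def)
      then have "a \<le> (p \<bullet> h + C * ((norm h)\<^sup>2 + a\<^sup>2)) / l" using \<open>l > 0\<close> by (simp add: pos_le_divide_eq algebra_simps)
      also have "\<dots> = ((1 / l) *\<^sub>R p) \<bullet> h + C / l * ((norm h)\<^sup>2 + a\<^sup>2)" by (simp add: add_divide_distrib)
      also have "C / l * ((norm h)\<^sup>2 + a\<^sup>2) \<le> C' * ((norm h)\<^sup>2 + a\<^sup>2)"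
        unfolding C'_def using l \<open>l0 > 0\<close> pos by (intro mult_right_mono divide_left_mono) auto
      finally show ?thesis by simp
    qed
    moreover have "norm ((1 / l) *\<^sub>R p) \<le> P'"
    proof -
      have "norm p / l \<le> P / l0" using pl(1) l \<open>l0 > 0\<close> pos by (intro frac_le) auto
      then show ?thesis using \<open>l > 0\<close> by (simp add: P'_def)
    qed
    ultimately show ?thesis by blast
  qed
  \<comment> \<open>Makes \<open>V\<close> oscillate by at most \<open>1 / (2 * C')\<close> on the
    ball, so that a positive increment \<open>a\<close> satisfies
    \<open>C' * a^2 \<le> a / 2\<close>.\<close>
  define m where "m = min \<delta>1 (1 / (2 * C')) / 2"
  have "m > 0" using \<delta>1 PC by (simp add: m_def)
  obtain d1 where "d1 > 0" and d1: "\<And>y. dist y x < d1 \<Longrightarrow> dist (V y) (V x) < m"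
    using V_cont \<open>m > 0\<close> unfolding continuous_on_iff by (metis UNIV_I)
  define R where "R = min (min d \<eta>) (min d1 \<delta>1) / 2"
  have R: "R > 0" using \<open>d > 0\<close> pos \<open>d1 > 0\<close> \<delta>1 by (simp add: R_def)
  have Rle: "R < min d \<eta>" "R < d1" "2 * R \<le> \<delta>1" using R \<open>d > 0\<close> pos \<open>d1 > 0\<close> \<delta>1 by (auto simp: R_def)
  define B where "B = cball x R"
  have osc: "\<bar>V z - V y\<bar> \<le> min \<delta>1 (1 / (2 * C'))" "norm (z - y) \<le> 2 * R" if "y \<in> B" "z \<in> B" for y z
  proof -
    have "dist (V y) (V x) < m" by (rule d1) (use that(1) Rle in \<open>auto simp: B_def dist_commute[of y x]\<close>)
    moreover have "dist (V z) (V x) < m" by (rule d1) (use that(2) Rle in \<open>auto simp: B_def dist_commute[of z x]\<close>)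
    moreover have "min \<delta>1 (1 / (2 * C')) = 2 * m" by (simp add: m_def)
    ultimately show "\<bar>V z - V y\<bar> \<le> min \<delta>1 (1 / (2 * C'))"
      unfolding dist_real_def abs_le_iff abs_less_iff by linarith
    show "norm (z - y) \<le> 2 * R" using that dist_triangle2[of z y x] by (simp add: B_def dist_norm norm_minus_commute)
  qed
  \<comment> \<open>The outer 2 comes from absorbing \<open>a / 2\<close>; \<open>2 * R\<close>
    bounds the distance of two points of the ball.\<close>
  define K1 where "K1 = 2 * (P' + 2 * R * C')"
  have K1: "K1 \<ge> 0" using PC R by (simp add: K1_def)
  have main: "\<exists>q. norm q \<le> P' \<and> (\<forall>z\<in>B. V z - V y \<le> q \<bullet> (z - y) + C' * ((norm (z - y))\<^sup>2 + (V z - V y)\<^sup>2))" if y: "y \<in> B" for y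
  proof -
    have "dist x y < min d \<eta>" using y Rle by (simp add: B_def)
    from grad[OF this] obtain q where q: "norm q \<le> P'" and le: "\<And>h a. norm h \<le> \<delta>1 \<Longrightarrow> \<bar>a\<bar> \<le> \<delta>1 \<Longrightarrow> V y + a \<le> V (y + h) \<Longrightarrow> a \<le> q \<bullet> h + C' * ((norm h)\<^sup>2 + a\<^sup>2)"
      by blast
    have "V z - V y \<le> q \<bullet> (z - y) + C' * ((norm (z - y))\<^sup>2 + (V z - V y)\<^sup>2)" if z: "z \<in> B" for z
      by (rule le) (use osc[OF y z] Rle in auto)
    then show ?thesis using q by blast
  qed
  have half: "V z - V y \<le> K1 * norm (z - y)" if y: "y \<in> B" and z: "z \<in> B" for y z
  proof (cases "V z - V y \<le> 0")
    case True
    then show ?thesis using mult_nonneg_nonneg[OF K1 norm_ge_zero[of "z - y"]] by linarith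
  next
    case False
    define a where "a = V z - V y"
    obtain q where q: "norm q \<le> P'" "a \<le> q \<bullet> (z - y) + C' * ((norm (z - y))\<^sup>2 + a\<^sup>2)"
      using main[OF y] z unfolding a_def by blast
    have a: "0 < a" "a \<le> 1 / (2 * C')" using False osc[OF y z] by (auto simp: a_def)
    then have "C' * a \<le> 1 / 2" using PC by (simp add: pos_le_divide_eq mult_ac)
    then have "(C' * a) * a \<le> 1 / 2 * a" using a by (intro mult_right_mono) auto
    then have 1: "C' * a\<^sup>2 \<le> a / 2" by (simp add: power2_eq_square)
    have 2: "q \<bullet> (z - y) \<le> P' * norm (z - y)"
      using norm_cauchy_schwarz[of q "z - y"] mult_right_mono[OF q(1), of "norm (z - y)"] by simp
    have "C' * (norm (z - y) * norm (z - y)) \<le> C' * (2 * R * norm (z - y))"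
      using PC osc(2)[OF y z] by (intro mult_left_mono mult_right_mono) auto
    then have "a / 2 \<le> P' * norm (z - y) + C' * (2 * R * norm (z - y))"
      using q(2) 1 2 by (simp add: distrib_left power2_eq_square)
    then show ?thesis unfolding a_def[symmetric] by (simp add: K1_def algebra_simps)
  qed
  have lip: "(V z - V y)\<^sup>2 \<le> K1\<^sup>2 * (norm (z - y))\<^sup>2" if "y \<in> B" "z \<in> B" for y z
  proof -
    have "\<bar>V z - V y\<bar> \<le> K1 * norm (z - y)"
      using half[OF that] half[OF that(2,1)] by (simp add: abs_le_iff norm_minus_commute)
    then have "\<bar>V z - V y\<bar>\<^sup>2 \<le> (K1 * norm (z - y))\<^sup>2" by (intro power_mono) auto
    then show ?thesis by (simp add: power_mult_distrib)
  qed
  show ?thesis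
  proof (rule that[of R "C' * (1 + K1\<^sup>2)" P'])
    show "R > 0" by fact
    show "C' * (1 + K1\<^sup>2) \<ge> 0" using PC by simp
    have "cball x R \<subseteq> cball x (2 * \<eta>)" using Rle pos by (intro subset_cball) auto
    then show "cball x R \<inter> S = {}" using outside by blast
    fix y assume "y \<in> cball x R"
    then have y: "y \<in> B" by (simp add: B_def)
    obtain q where q: "norm q \<le> P'" "\<And>z. z \<in> B \<Longrightarrow> V z - V y \<le> q \<bullet> (z - y) + C' * ((norm (z - y))\<^sup>2 + (V z - V y)\<^sup>2)"
      using main[OF y] by blast
    have "supergrad_on V B (C' * (1 + K1\<^sup>2)) y q"
      unfolding supergrad_on_def
    proof
      fix z assume z: "z \<in> B"
      have "C' * ((norm (z - y))\<^sup>2 + (V z - V y)\<^sup>2) \<le> C' * ((norm (z - y))\<^sup>2 + K1\<^sup>2 * (norm (z - y))\<^sup>2)"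
        using lip[OF y z] PC by (intro mult_left_mono) auto
      also have "\<dots> = C' * (1 + K1\<^sup>2) * (norm (z - y))\<^sup>2" by (simp add: algebra_simps)
      finally show "V z \<le> V y + q \<bullet> (z - y) + C' * (1 + K1\<^sup>2) * (norm (z - y))\<^sup>2" using q(2)[OF z] by linarith
    qed
    then show "\<exists>p. norm p \<le> P' \<and> supergrad_on V (cball x R) (C' * (1 + K1\<^sup>2)) y p" using q(1) unfolding B_def by blast
  qed
qed

lemma supergrad_imp_proximal_superdiff:
  assumes p: "supergrad_on V (cball x R) C x p" and "R > 0" "C \<ge> 0"
  shows "p \<in> proximal_superdiff S V x"
  unfolding proximal_superdiff_def mem_Collect_eq mem_proximal_normal_cone_hypo
proof (intro exI conjI ballI allI impI)
  \<comment> \<open>Outside the ball the linear terms are absorbed by means of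
    \<open>1 \<le> |h|^2 / R^2\<close> and \<open>a \<le> 1 + a^2\<close>.\<close>
  define \<sigma> where "\<sigma> = C + norm p / R + 1 / R\<^sup>2 + 1"
  show "0 \<le> C + norm p / R + 1 / R\<^sup>2 + 1" using assms by simp
  fix z \<beta> assume \<beta>: "\<beta> \<le> V z"
  define h a where "h = z - x" and "a = \<beta> - V x"
  have "a - p \<bullet> h \<le> \<sigma> * ((norm h)\<^sup>2 + a\<^sup>2)"
  proof (cases "norm h \<le> R")
    case True
    then have "z \<in> cball x R" by (simp add: h_def dist_norm norm_minus_commute)
    from supergrad_onD[OF p this] have "a - p \<bullet> h \<le> C * (norm h)\<^sup>2" using \<beta> by (simp add: a_def h_def)
    also have "\<dots> \<le> C * ((norm h)\<^sup>2 + a\<^sup>2)" using \<open>C \<ge> 0\<close> by (intro mult_left_mono) auto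
    also have "\<dots> \<le> \<sigma> * ((norm h)\<^sup>2 + a\<^sup>2)" using assms by (intro mult_right_mono) (auto simp: \<sigma>_def)
    finally show ?thesis .
  next
    case False
    have "2 * a \<le> a\<^sup>2 + 1" using sum_squares_bound[of a 1] by simp
    then have "a \<le> 1 + a\<^sup>2" using zero_le_power2[of a] by linarith
    moreover have "1 \<le> (norm h)\<^sup>2 / R\<^sup>2" using False \<open>R > 0\<close> by (simp add: power_mono)
    moreover have "- (p \<bullet> h) \<le> norm p / R * (norm h)\<^sup>2"
    proof -
      have "- (p \<bullet> h) \<le> norm p * norm h" using Cauchy_Schwarz_ineq2[of p h] by simp
      also have "norm h \<le> (norm h)\<^sup>2 / R"
        using False \<open>R > 0\<close> by (simp add: pos_le_divide_eq power2_eq_square mult_left_mono)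
      then have "norm p * norm h \<le> norm p * ((norm h)\<^sup>2 / R)" by (intro mult_left_mono) auto
      finally show ?thesis by simp
    qed
    ultimately have "a - p \<bullet> h \<le> norm p / R * (norm h)\<^sup>2 + 1 / R\<^sup>2 * (norm h)\<^sup>2 + a\<^sup>2" by simp
    also have "\<dots> \<le> \<sigma> * (norm h)\<^sup>2 + \<sigma> * a\<^sup>2"
    proof (rule add_mono)
      show "norm p / R * (norm h)\<^sup>2 + 1 / R\<^sup>2 * (norm h)\<^sup>2 \<le> \<sigma> * (norm h)\<^sup>2"
        unfolding distrib_right[symmetric] using assms by (intro mult_right_mono) (auto simp: \<sigma>_def)
      have "1 * a\<^sup>2 \<le> \<sigma> * a\<^sup>2" using assms by (intro mult_right_mono) (auto simp: \<sigma>_def)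
      then show "a\<^sup>2 \<le> \<sigma> * a\<^sup>2" by simp
    qed
    finally show ?thesis by (simp add: distrib_left)
  qed
  then show "- p \<bullet> (z - x) + 1 * (\<beta> - V x) \<le> (C + norm p / R + 1 / R\<^sup>2 + 1) * ((norm (z - x))\<^sup>2 + (\<beta> - V x)\<^sup>2)"
    by (simp add: h_def a_def \<sigma>_def)
qed

section \<open>The Hamilton-Jacobi equation\<close>

text \<open>Compares the rate along \<open>y\<close> with the rate frozen at \<open>x1\<close>, at
  the price of \<open>(1 + norm p) * (L * D)\<close>. The sign \<open>c\<close> lets one statement
  give lower and upper bounds.\<close>

lemma rate_lower:
  assumes y: "traj x u y" and st: "0 \<le> s" "s \<le> t"
    and D: "\<And>\<sigma>. s \<le> \<sigma> \<Longrightarrow> \<sigma> \<le> t \<Longrightarrow> norm (y \<sigma> - x1) \<le> D"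
    and m: "\<And>\<sigma>. s \<le> \<sigma> \<Longrightarrow> \<sigma> \<le> t \<Longrightarrow> m \<le> c * (p \<bullet> f x1 (u \<sigma>) + r x1 (u \<sigma>))" and c: "\<bar>c\<bar> = 1"
  shows "(m - (1 + norm p) * (L * D)) * (t - s) \<le> c * (rcost u y t - rcost u y s + p \<bullet> (y t - y s))"
proof -
  have fi: "(\<lambda>\<sigma>. f (y \<sigma>) (u \<sigma>)) integrable_on {0..a}" if "0 \<le> a" for a by (rule f_integrable[OF y that])
  have ri: "(\<lambda>\<sigma>. r (y \<sigma>) (u \<sigma>)) integrable_on {0..a}" for a by (rule r_integrable[OF y])
  have si: "(\<lambda>\<sigma>. c * (p \<bullet> f (y \<sigma>) (u \<sigma>) + r (y \<sigma>) (u \<sigma>))) integrable_on {0..a}" if "0 \<le> a" for a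
    by (intro integrable_on_mult_right integrable_add inner_integral_right(1) fi ri that)
  have int: "integral {0..a} (\<lambda>\<sigma>. c * (p \<bullet> f (y \<sigma>) (u \<sigma>) + r (y \<sigma>) (u \<sigma>))) = c * (p \<bullet> (y a - x) + rcost u y a)" if "0 \<le> a" for a
  proof -
    have "integral {0..a} (\<lambda>\<sigma>. p \<bullet> f (y \<sigma>) (u \<sigma>) + r (y \<sigma>) (u \<sigma>)) = p \<bullet> integral {0..a} (\<lambda>\<sigma>. f (y \<sigma>) (u \<sigma>)) + rcost u y a"
      using integral_add[OF inner_integral_right(1)[OF fi[OF that]] ri] inner_integral_right(2)[OF fi[OF that]] by (simp add: rcost_def)
    then show ?thesis using traj_eq[OF y that] by simp
  qed
  have "0 \<le> t" using st by simp
  have "(m - (1 + norm p) * (L * D)) * (t - s) \<le> integral {0..t} (\<lambda>\<sigma>. c * (p \<bullet> f (y \<sigma>) (u \<sigma>) + r (y \<sigma>) (u \<sigma>))) - integral {0..s} (\<lambda>\<sigma>. c * (p \<bullet> f (y \<sigma>) (u \<sigma>) + r (y \<sigma>) (u \<sigma>)))"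
  proof (rule integral_increment_ge[OF si[OF \<open>0 \<le> t\<close>] st])
    fix \<sigma> assume \<sigma>: "s \<le> \<sigma>" "\<sigma> \<le> t"
    have uU: "u \<sigma> \<in> U" using control_in[OF traj_control[OF y]] \<sigma> st by simp
    have LD: "L * norm (y \<sigma> - x1) \<le> L * D" using D[OF \<sigma>] L_pos by simp
    have 1: "\<bar>r (y \<sigma>) (u \<sigma>) - r x1 (u \<sigma>)\<bar> \<le> L * D" using r_lip[OF uU, of "y \<sigma>" x1] LD by simp
    have "\<bar>p \<bullet> (f (y \<sigma>) (u \<sigma>) - f x1 (u \<sigma>))\<bar> \<le> norm p * norm (f (y \<sigma>) (u \<sigma>) - f x1 (u \<sigma>))" by (rule Cauchy_Schwarz_ineq2)
    also have "\<dots> \<le> norm p * (L * D)" using f_lip[OF uU, of "y \<sigma>" x1] LD by (intro mult_left_mono) auto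
    finally have 2: "\<bar>p \<bullet> f (y \<sigma>) (u \<sigma>) - p \<bullet> f x1 (u \<sigma>)\<bar> \<le> norm p * (L * D)" by (simp add: inner_diff_right)
    have "c = 1 \<or> c = - 1" using c by auto
    then show "m - (1 + norm p) * (L * D) \<le> c * (p \<bullet> f (y \<sigma>) (u \<sigma>) + r (y \<sigma>) (u \<sigma>))"
      using m[OF \<sigma>] 1 2 unfolding distrib_right abs_le_iff by auto
  qed
  also have "\<dots> = c * (rcost u y t - rcost u y s + p \<bullet> (y t - y s))"
    unfolding int[OF \<open>0 \<le> t\<close>] int[OF st(1)] by (simp add: inner_diff_right algebra_simps)
  finally show ?thesis .
qed

lemma rate_attains_min:
  obtains w where "w \<in> U" "\<And>w'. w' \<in> U \<Longrightarrow> p \<bullet> f x w + r x w \<le> p \<bullet> f x w' + r x w'"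
proof -
  have "continuous_on U (\<lambda>w. p \<bullet> f x w + r x w)" by (intro continuous_intros f_cont_fixed r_cont_fixed)
  from continuous_attains_inf[OF U_compact U_ne this] show ?thesis using that by blast
qed

text \<open>The subsolution half \<open>H(x, p) \<le> 0\<close>: dynamic programming is tested with
  the constant control \<open>w\<close> for a short time, and the supergradient bounds
  \<open>V\<close> at the new point.\<close>

lemma supergrad_rate_nonneg:
  assumes x: "x \<notin> S" and p: "supergrad_on V (cball x R) C x p" and "R > 0" "C \<ge> 0" and w: "w \<in> U"
  shows "0 \<le> p \<bullet> f x w + r x w"
proof -
  obtain d where "d > 0" and d: "ball x d \<subseteq> - S"
    using S_closed x open_contains_ball[of "- S"] by auto
  obtain y where y: "traj x (\<lambda>_. w) y" using traj_exists[OF control_const[OF w]] .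
  have "- (p \<bullet> f x w + r x w) \<le> 0"
  proof (rule le_zero_if_le_small_multiples)
    show "min R d / N > 0" using \<open>R > 0\<close> \<open>d > 0\<close> N_pos by simp
    fix t assume t: "0 < t" "t < min R d / N"
    have Nt: "N * t < R" "N * t < d" using t N_pos by (auto simp: pos_less_divide_eq mult.commute)
    have near: "norm (y \<sigma> - x) \<le> N * t" if "0 \<le> \<sigma>" "\<sigma> \<le> t" for \<sigma>
    proof -
      have "norm (y \<sigma> - x) \<le> N * \<sigma>" using traj_lipschitz[OF y, of 0 \<sigma>] traj_0[OF y] that by simp
      also have "\<dots> \<le> N * t" using that N_pos by simp
      finally show ?thesis .
    qed
    have out: "y \<sigma> \<notin> S" if "0 \<le> \<sigma>" "\<sigma> \<le> t" for \<sigma>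
      using near[OF that] Nt d by (auto simp: subset_iff dist_norm norm_minus_commute)
    have "V x \<le> rcost (\<lambda>_. w) y t + V (y t)"
      using dynamic_programming[OF y order_refl] out t traj_0[OF y] by simp
    also have "V (y t) \<le> V x + p \<bullet> (y t - x) + C * (norm (y t - x))\<^sup>2"
      using near[of t] t Nt by (intro supergrad_onD[OF p]) (auto simp: dist_norm norm_minus_commute)
    also have "C * (norm (y t - x))\<^sup>2 \<le> C * (N * t)\<^sup>2" using near[of t] t \<open>C \<ge> 0\<close> by (intro mult_left_mono power_mono) auto
    finally have 1: "- C * (N * t)\<^sup>2 \<le> rcost (\<lambda>_. w) y t + p \<bullet> (y t - x)" by simp
    have "(- (p \<bullet> f x w + r x w) - (1 + norm p) * (L * (N * t))) * (t - 0) \<le> - 1 * (rcost (\<lambda>_. w) y t - rcost (\<lambda>_. w) y 0 + p \<bullet> (y t - y 0))"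
      by (rule rate_lower[OF y]) (use t near in auto)
    with 1 have "t * (- (p \<bullet> f x w + r x w)) \<le> t * (t * ((1 + norm p) * (L * N) + C * N\<^sup>2))"
      using traj_0[OF y] by (simp add: power2_eq_square algebra_simps)
    then show "- (p \<bullet> f x w + r x w) \<le> t * ((1 + norm p) * (L * N) + C * N\<^sup>2)"
      using mult_le_cancel_left_pos[OF t(1)] by blast
  qed
  then show ?thesis by simp
qed

text \<open>The supersolution half at a gradient: if all rates were at least \<open>m > 0\<close>,
  every short piece of a trajectory would cost about \<open>m * t\<close> more than \<open>V\<close>
  drops along it, against near-optimality.\<close>

lemma derivative_rate_nonpos:
  assumes x: "x \<notin> S" and D: "(V has_derivative (\<lambda>h. p \<bullet> h)) (at x)"
  obtains w where "w \<in> U" "p \<bullet> f x w + r x w \<le> 0"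
proof -
  obtain w where w: "w \<in> U" and min: "\<And>w'. w' \<in> U \<Longrightarrow> p \<bullet> f x w + r x w \<le> p \<bullet> f x w' + r x w'"
    using rate_attains_min by blast
  define m where "m = p \<bullet> f x w + r x w"
  have "m \<le> 0"
  proof (rule ccontr)
    assume "\<not> m \<le> 0"
    then have m: "m > 0" by simp
    obtain d0 where "d0 > 0" and d0: "ball x d0 \<subseteq> - S"
      using S_closed x open_contains_ball[of "- S"] by auto
    have "m / (2 * N) > 0" using m N_pos by simp
    then obtain d where "d > 0" and d: "\<And>y. norm (y - x) < d \<Longrightarrow> norm (V y - V x - p \<bullet> (y - x)) \<le> m / (2 * N) * norm (y - x)"
      using D unfolding has_derivative_at_alt by metis
    have "m / 2 \<le> 0"
    proof (rule le_zero_if_le_small_multiples)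
      show "min d0 d / N > 0" using \<open>d0 > 0\<close> \<open>d > 0\<close> N_pos by simp
      fix t assume t: "0 < t" "t < min d0 d / N"
      have Nt: "N * t < d0" "N * t < d" using t N_pos by (auto simp: pos_less_divide_eq mult.commute)
      \<comment> \<open>An optimality gap of order \<open>t^2\<close> is negligible against
        \<open>m * t\<close>.\<close>
      have "t\<^sup>2 > 0" using t by simp
      then obtain u y \<tau> where y: "traj x u y" and \<tau>: "0 \<le> \<tau>" "y \<tau> \<in> S" and out: "\<And>\<sigma>. 0 \<le> \<sigma> \<Longrightarrow> \<sigma> < \<tau> \<Longrightarrow> y \<sigma> \<notin> S"
        and cost: "rcost u y \<tau> + g (y \<tau>) < V x + t\<^sup>2"
        using near_optimal by metis
      have near: "norm (y \<sigma> - x) \<le> N * t" if "0 \<le> \<sigma>" "\<sigma> \<le> t" for \<sigma>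
      proof -
        have "norm (y \<sigma> - x) \<le> N * \<sigma>" using traj_lipschitz[OF y, of 0 \<sigma>] traj_0[OF y] that by simp
        also have "\<dots> \<le> N * t" using that N_pos by simp
        finally show ?thesis .
      qed
      have "t < \<tau>"
      proof (rule ccontr)
        assume "\<not> t < \<tau>"
        then have "norm (y \<tau> - x) \<le> N * t" using near \<tau> by simp
        then have "y \<tau> \<in> ball x d0" using Nt by (simp add: dist_norm norm_minus_commute)
        then show False using d0 \<tau> by blast
      qed
      have "V (y t) \<le> rcost u y \<tau> - rcost u y t + V (y \<tau>)"
        using dynamic_programming[OF y, of t \<tau>] out t \<open>t < \<tau>\<close> by simp
      then have 1: "rcost u y t + V (y t) \<le> V x + t\<^sup>2" using cost V_on_S[OF \<tau>(2)] by simp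
      have 2: "V x + p \<bullet> (y t - x) - m / 2 * t \<le> V (y t)"
      proof -
        have "norm (y t - x) < d" using near[of t] t Nt by simp
        then have "V x + p \<bullet> (y t - x) - m / (2 * N) * norm (y t - x) \<le> V (y t)" using d by (fastforce simp: abs_le_iff)
        moreover have "m / (2 * N) * norm (y t - x) \<le> m / (2 * N) * (N * t)"
          using near[of t] t m N_pos by (intro mult_left_mono) auto
        ultimately show ?thesis using N_pos by simp
      qed
      have "(m - (1 + norm p) * (L * (N * t))) * (t - 0) \<le> 1 * (rcost u y t - rcost u y 0 + p \<bullet> (y t - y 0))"
        by (rule rate_lower[OF y]) (use t near min control_in[OF traj_control[OF y]] in \<open>auto simp: m_def\<close>)
      with 1 2 have "t * (m / 2) \<le> t * (t * (1 + (1 + norm p) * (L * N)))"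
        using traj_0[OF y] by (simp add: power2_eq_square algebra_simps)
      then show "m / 2 \<le> t * (1 + (1 + norm p) * (L * N))"
        using mult_le_cancel_left_pos[OF t(1)] by blast
    qed
    then show False using m by simp
  qed
  then show ?thesis using that w by (simp add: m_def)
qed

text \<open>A supergradient bounds \<open>V\<close> from above, which does not help forwards in
  time. Looking back from \<open>t\<close>, it bounds \<open>V (y s)\<close> at earlier times, where
  optimality makes \<open>V\<close> exceed \<open>V (y t)\<close> by the cost. This needs a piece of
  trajectory arriving at \<open>y t\<close>, hence \<open>0 < t\<close>.\<close>

lemma optimal_trajectory_rate_nonpos:
  assumes y: "traj x u y" and "0 < t" and opt: "\<And>s. 0 \<le> s \<Longrightarrow> s \<le> t \<Longrightarrow> rcost u y t - rcost u y s + V (y t) \<le> V (y s)"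
    and p: "supergrad_on V (cball (y t) R) C (y t) p" and "R > 0" "C \<ge> 0"
  obtains w where "w \<in> U" "p \<bullet> f (y t) w + r (y t) w \<le> 0"
proof -
  obtain w where w: "w \<in> U" and min: "\<And>w'. w' \<in> U \<Longrightarrow> p \<bullet> f (y t) w + r (y t) w \<le> p \<bullet> f (y t) w' + r (y t) w'"
    using rate_attains_min by blast
  define m where "m = p \<bullet> f (y t) w + r (y t) w"
  have "m \<le> 0"
  proof (rule le_zero_if_le_small_multiples)
    show "min t (R / N) > 0" using \<open>0 < t\<close> \<open>R > 0\<close> N_pos by simp
    fix e assume e: "0 < e" "e < min t (R / N)"
    define s where "s = t - e"
    have s: "0 \<le> s" "s \<le> t" "t - s = e" using e by (auto simp: s_def)
    have Ne: "N * e < R" using e N_pos by (auto simp: pos_less_divide_eq mult.commute)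
    have near: "norm (y \<sigma> - y t) \<le> N * e" if "s \<le> \<sigma>" "\<sigma> \<le> t" for \<sigma>
    proof -
      have "norm (y \<sigma> - y t) \<le> N * \<bar>\<sigma> - t\<bar>" by (rule traj_lipschitz[OF y]) (use that s in auto)
      also have "\<dots> \<le> N * e" using that s N_pos by (intro mult_left_mono) auto
      finally show ?thesis .
    qed
    have "V (y s) \<le> V (y t) + p \<bullet> (y s - y t) + C * (norm (y s - y t))\<^sup>2"
      using near[of s] s Ne by (intro supergrad_onD[OF p]) (auto simp: dist_norm norm_minus_commute)
    moreover have "C * (norm (y s - y t))\<^sup>2 \<le> C * (N * e)\<^sup>2"
      using near[of s] s \<open>C \<ge> 0\<close> by (intro mult_left_mono power_mono) auto
    ultimately have 1: "rcost u y t - rcost u y s + p \<bullet> (y t - y s) \<le> C * (N * e)\<^sup>2"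
      using opt[OF s(1,2)] by (simp add: inner_diff_right)
    have "(m - (1 + norm p) * (L * (N * e))) * (t - s) \<le> 1 * (rcost u y t - rcost u y s + p \<bullet> (y t - y s))"
      by (rule rate_lower[OF y s(1,2)]) (use near s min control_in[OF traj_control[OF y]] in \<open>auto simp: m_def\<close>)
    with 1 have "e * m \<le> e * (e * ((1 + norm p) * (L * N) + C * N\<^sup>2))"
      unfolding s(3) by (simp add: power2_eq_square algebra_simps)
    then show "m \<le> e * ((1 + norm p) * (L * N) + C * N\<^sup>2)"
      using mult_le_cancel_left_pos[OF e(1)] by blast
  qed
  then show ?thesis using that w by (simp add: m_def)
qed

text \<open>All rates are nonnegative on the whole segment. If no point of it made all of them
  positive, the Hamiltonian would vanish on the segment, which nondegeneracy forbids.\<close>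

lemma strict_convex_combination:
  assumes "p1 \<noteq> p2" and ge: "\<And>w. w \<in> U \<Longrightarrow> 0 \<le> p1 \<bullet> f x w + r x w" "\<And>w. w \<in> U \<Longrightarrow> 0 \<le> p2 \<bullet> f x w + r x w"
  obtains \<theta> where "0 \<le> \<theta>" "\<theta> \<le> 1" "\<And>w. w \<in> U \<Longrightarrow> 0 < ((1 - \<theta>) *\<^sub>R p1 + \<theta> *\<^sub>R p2) \<bullet> f x w + r x w"
proof (rule ccontr)
  assume "\<not> thesis"
  with that have neg: "\<exists>w\<in>U. ((1 - \<theta>) *\<^sub>R p1 + \<theta> *\<^sub>R p2) \<bullet> f x w + r x w \<le> 0" if "0 \<le> \<theta>" "\<theta> \<le> 1" for \<theta>
    using that by (meson not_less)
  have "hamiltonian U f r x p = 0" if p: "p \<in> closed_segment p1 p2" for p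
  proof -
    obtain \<theta> where \<theta>: "0 \<le> \<theta>" "\<theta> \<le> 1" "p = (1 - \<theta>) *\<^sub>R p1 + \<theta> *\<^sub>R p2"
      using p by (auto simp: in_segment)
    have le: "- (p \<bullet> f x w) - r x w \<le> 0" if "w \<in> U" for w
    proof -
      have "0 \<le> (1 - \<theta>) * (p1 \<bullet> f x w + r x w) + \<theta> * (p2 \<bullet> f x w + r x w)"
        using ge[OF that] \<theta> by simp
      then show ?thesis by (simp add: \<theta>(3) inner_add_left algebra_simps)
    qed
    obtain w where w: "w \<in> U" "p \<bullet> f x w + r x w \<le> 0" using neg[OF \<theta>(1,2)] \<theta>(3) by auto
    then have "- (p \<bullet> f x w) - r x w = 0" using le[OF w(1)] by simp
    then show ?thesis
      unfolding hamiltonian_def using w(1) le by (intro cSup_eq_maximum) (auto simp: image_iff intro!: bexI[of _ w])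
  qed
  then have "is_singleton (closed_segment p1 p2)"
    using nondegenerate unfolding nondegenerate_hamiltonian_hyp_def by (metis convex_closed_segment ends_in_segment(1) empty_iff)
  then show False using \<open>p1 \<noteq> p2\<close> by (metis ends_in_segment is_singletonE singletonD)
qed

lemma supergrad_on_convex_combination:
  assumes "supergrad_on V B C x p1" "supergrad_on V B C x p2" "0 \<le> \<theta>" "\<theta> \<le> 1"
  shows "supergrad_on V B C x ((1 - \<theta>) *\<^sub>R p1 + \<theta> *\<^sub>R p2)"
  unfolding supergrad_on_def
proof
  fix z assume z: "z \<in> B"
  have "(1 - \<theta>) * V z + \<theta> * V z \<le> (1 - \<theta>) * (V x + p1 \<bullet> (z - x) + C * (norm (z - x))\<^sup>2) + \<theta> * (V x + p2 \<bullet> (z - x) + C * (norm (z - x))\<^sup>2)"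
    using supergrad_onD[OF assms(1) z] supergrad_onD[OF assms(2) z] assms(3,4) by (intro add_mono mult_left_mono) auto
  then show "V z \<le> V x + ((1 - \<theta>) *\<^sub>R p1 + \<theta> *\<^sub>R p2) \<bullet> (z - x) + C * (norm (z - x))\<^sup>2"
    by (simp add: inner_add_left algebra_simps)
qed

text \<open>The strict inequality is what contradicts an optimal arrival at \<open>x\<close>, and
  also gradients close to \<open>p\<close> at nearby points.\<close>

lemma interior_supergradient_of_singular_point:
  assumes "x \<notin> S" "\<not> V differentiable (at x)" "R > 0" "C \<ge> 0"
    and semi: "\<And>y. y \<in> cball x R \<Longrightarrow> \<exists>p. norm p \<le> K \<and> supergrad_on V (cball x R) C y p"
  obtains p where "supergrad_on V (cball x R) C x p" "\<And>w. w \<in> U \<Longrightarrow> 0 < p \<bullet> f x w + r x w"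
proof -
  obtain p1 p2 where p: "p1 \<noteq> p2" "supergrad_on V (cball x R) C x p1" "supergrad_on V (cball x R) C x p2"
    using supergrad_on_two_if_not_differentiable[OF V_cont \<open>R > 0\<close> semi assms(2)] by blast
  obtain \<theta> where \<theta>: "0 \<le> \<theta>" "\<theta> \<le> 1" "\<And>w. w \<in> U \<Longrightarrow> 0 < ((1 - \<theta>) *\<^sub>R p1 + \<theta> *\<^sub>R p2) \<bullet> f x w + r x w"
    using strict_convex_combination[OF p(1)] supergrad_rate_nonneg[OF assms(1) _ assms(3,4)] p by metis
  show ?thesis by (rule that[OF supergrad_on_convex_combination[OF p(2,3) \<theta>(1,2)] \<theta>(3)])
qed

section \<open>Propagation of singularities\<close>

theorem singularities_propagate:
  assumes x: "x \<in> singular_set S V"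
    and dim: "dim_union (proximal_superdiff S V x) (horizon_superdiff S V x) < int DIM('a)"
  obtains \<sigma> K :: real and arc where "\<sigma> > 0" "K-lipschitz_on {0..\<sigma>} arc" "arc 0 = x"
    "\<And>s. s \<in> {0<..\<sigma>} \<Longrightarrow> arc s \<in> singular_set S V - {x}"
proof (cases "horizon_superdiff S V x \<subseteq> {0}")
  case False
  then obtain v where "v \<in> horizon_superdiff S V x" "v \<noteq> 0" by blast
  moreover have "x \<notin> S" using x by (simp add: singular_set_def)
  ultimately show ?thesis using horizontal_arc that by metis
next
  case True
  have xS: "x \<notin> S" and nd: "\<not> V differentiable (at x)" using x by (auto simp: singular_set_def)
  obtain R K C where R: "R > 0" "C \<ge> 0" "cball x R \<inter> S = {}"
    and semi: "\<And>y. y \<in> cball x R \<Longrightarrow> \<exists>p. norm p \<le> K \<and> supergrad_on V (cball x R) C y p"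
    using locally_semiconcave_value[OF xS True] by metis
  obtain p0 where p0: "supergrad_on V (cball x R) C x p0" and strict: "\<And>w. w \<in> U \<Longrightarrow> 0 < p0 \<bullet> f x w + r x w"
    using interior_supergradient_of_singular_point[OF xS nd R(1,2) semi] by metis
  have "aff_dim (proximal_superdiff S V x) < int DIM('a)" using dim by (simp add: dim_union_def)
  then obtain q b where q: "q \<noteq> 0" "proximal_superdiff S V x \<subseteq> {p. q \<bullet> p = b}"
    using aff_lowdim_subset_hyperplane by metis
  have orth: "q \<bullet> (p - p0) = 0" if "supergrad_on V (cball x R) C x p" for p
    using supergrad_imp_proximal_superdiff[OF that R(1,2)] supergrad_imp_proximal_superdiff[OF p0 R(1,2)] q(2)
    by (auto simp: inner_diff_right)
  have semi': "\<exists>p. supergrad_on V (cball x R) C y p" if "y \<in> cball x R" for y using semi[OF that] by blast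
  obtain \<sigma> K' :: real and arc P where \<sigma>: "\<sigma> > 0" and lip: "K'-lipschitz_on {0..\<sigma>} arc" and arc0: "arc 0 = x"
    and arc: "\<And>s. s \<in> {0<..\<sigma>} \<Longrightarrow> arc s \<noteq> x \<and> arc s \<in> ball x R \<and> supergrad_on V (cball x R) C (arc s) (P s)"
    and lim: "\<And>s. (\<forall>n. s n \<in> {0<..\<sigma>}) \<Longrightarrow> s \<longlonglongrightarrow> 0 \<Longrightarrow> \<exists>k. strict_mono k \<and> (P \<circ> s \<circ> k) \<longlonglongrightarrow> p0"
  proof (rule supergradient_arc[OF V_cont R(1,2) q(1) _ p0])
    show "\<exists>p. supergrad_on V (cball x R) C y p" if "y \<in> cball x R" for y by (rule semi'[OF that])
    show "q \<bullet> (p - p0) = 0" if "supergrad_on V (cball x R) C x p" for p by (rule orth[OF that])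
  qed (rule that; assumption)
  \<comment> \<open>Where \<open>V\<close> is differentiable, the supergradient \<open>P s\<close>
    is the gradient, so the supersolution half applies to it.\<close>
  have gradient: "\<exists>w\<in>U. P s \<bullet> f (arc s) w + r (arc s) w \<le> 0" if s: "s \<in> {0<..\<sigma>}" and df: "V differentiable (at (arc s))" for s
  proof -
    obtain D where D: "(V has_derivative D) (at (arc s))" using df by (auto simp: differentiable_def)
    have sgP: "supergrad_on V (cball x R) C (arc s) (P s)" and inb: "arc s \<in> ball x R" using arc[OF s] by auto
    have "arc s \<in> cball x R" using inb by simp
    then have "arc s \<notin> S" using R(3) by blast
    define \<rho> where "\<rho> = R - dist x (arc s)"
    have "\<rho> > 0" using inb by (simp add: \<rho>_def)
    \<comment> \<open>One-sided difference quotients give \<open>D h \<le> P s \<bullet> h\<close>;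
      the same for \<open>- h\<close> and linearity give equality.\<close>
    have "D h = P s \<bullet> h" for h
    proof -
      have upper: "D h \<le> P s \<bullet> h" for h
      proof -
        have lin: "linear D" using D has_derivative_linear by blast
        have "((\<lambda>t. (V (arc s + t *\<^sub>R h) - V (arc s)) / t) \<longlongrightarrow> D h) (at_right 0)"
        proof -
          have "((\<lambda>t. V (arc s + t *\<^sub>R h)) has_derivative (\<lambda>t. D (t *\<^sub>R h))) (at 0)"
            by (rule has_derivative_compose[of "\<lambda>t. arc s + t *\<^sub>R h" "\<lambda>t. t *\<^sub>R h" 0 UNIV V D, simplified])
              (auto intro!: derivative_eq_intros D)
          moreover have "(\<lambda>t. D (t *\<^sub>R h)) = (*) (D h)"
            by (rule ext) (simp add: linear_cmul[OF lin])
          ultimately have "((\<lambda>t. V (arc s + t *\<^sub>R h)) has_real_derivative D h) (at 0)"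
            by (simp only: has_field_derivative_def)
          then have "((\<lambda>t. (V (arc s + t *\<^sub>R h) - V (arc s)) / t) \<longlongrightarrow> D h) (at 0)"
            by (simp add: has_field_derivative_iff)
          then show ?thesis by (rule tendsto_within_subset) simp
        qed
        moreover have "((\<lambda>t. P s \<bullet> h + t * (C * (norm h)\<^sup>2)) \<longlongrightarrow> P s \<bullet> h + 0 * (C * (norm h)\<^sup>2)) (at_right 0)"
          by (intro tendsto_intros)
        moreover have "\<forall>\<^sub>F t in at_right 0. (V (arc s + t *\<^sub>R h) - V (arc s)) / t \<le> P s \<bullet> h + t * (C * (norm h)\<^sup>2)"
        proof (rule eventually_mono[OF eventually_at_right_real[of 0 "\<rho> / (norm h + 1)"]])
          show "0 < \<rho> / (norm h + 1)" using \<open>\<rho> > 0\<close> by (simp add: add_nonneg_pos)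
          fix t assume "t \<in> {0<..<\<rho> / (norm h + 1)}"
          then have t: "0 < t" "t * (norm h + 1) < \<rho>" by (auto simp: pos_less_divide_eq add_nonneg_pos)
          have "dist x (arc s + t *\<^sub>R h) \<le> dist x (arc s) + t * norm h"
            using dist_triangle[of x "arc s + t *\<^sub>R h" "arc s"] t by (simp add: dist_norm)
          also have "t * norm h < \<rho>" using t by (simp add: distrib_left)
          finally have "arc s + t *\<^sub>R h \<in> cball x R" by (simp add: \<rho>_def)
          from supergrad_onD[OF sgP this] have "V (arc s + t *\<^sub>R h) - V (arc s) \<le> t * (P s \<bullet> h + t * (C * (norm h)\<^sup>2))"
            using t by (simp add: power2_eq_square algebra_simps)
          then show "(V (arc s + t *\<^sub>R h) - V (arc s)) / t \<le> P s \<bullet> h + t * (C * (norm h)\<^sup>2)"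
            using t by (simp add: pos_divide_le_eq mult.commute)
        qed
        ultimately have "D h \<le> P s \<bullet> h + 0 * (C * (norm h)\<^sup>2)"
          by (intro tendsto_le[OF trivial_limit_at_right_real]) auto
        then show ?thesis by simp
      qed
      have "D (- h) = - D h" using linear_neg[OF has_derivative_linear[OF D]] .
      then show ?thesis using upper[of h] upper[of "- h"] by simp
    qed
    then have "(V has_derivative (\<lambda>h. P s \<bullet> h)) (at (arc s))" using D by (simp add: ext[of D "\<lambda>h. P s \<bullet> h"])
    then show ?thesis using derivative_rate_nonpos[OF \<open>arc s \<notin> S\<close>] by metis
  qed
  \<comment> \<open>Otherwise such times accumulate at 0. Along a subsequence \<open>P\<close> tends
    to \<open>p0\<close> and, \<open>U\<close> being compact, the control values with nonpositive
    rate converge; the limit contradicts \<open>strict\<close>.\<close>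
  have "\<exists>\<sigma>'>0. \<sigma>' \<le> \<sigma> \<and> (\<forall>s\<in>{0<..\<sigma>'}. \<not> V differentiable (at (arc s)))"
  proof (rule ccontr)
    assume neg: "\<not> ?thesis"
    have "\<exists>s. 0 < s \<and> s \<le> \<sigma> \<and> s \<le> 1 / real (Suc n) \<and> V differentiable (at (arc s))" for n :: nat
    proof -
      have "min \<sigma> (1 / real (Suc n)) > 0" "min \<sigma> (1 / real (Suc n)) \<le> \<sigma>" using \<sigma> by auto
      then obtain s where "s \<in> {0<..min \<sigma> (1 / real (Suc n))}" "V differentiable (at (arc s))" using neg by blast
      then show ?thesis by auto
    qed
    then obtain s where s: "\<And>n. 0 < s n" "\<And>n. s n \<le> \<sigma>" "\<And>n. s n \<le> 1 / real (Suc n)" "\<And>n. V differentiable (at (arc (s n)))"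
      by metis
    have inv0: "(\<lambda>n. 1 / real (Suc n)) \<longlonglongrightarrow> 0" using LIMSEQ_inverse_real_of_nat by (simp add: inverse_eq_divide)
    have s0: "s \<longlonglongrightarrow> 0"
      by (rule tendsto_sandwich[OF _ _ tendsto_const inv0])
        (auto intro!: always_eventually less_imp_le[OF s(1)] s(3) simp del: of_nat_Suc)
    obtain k where k: "strict_mono k" and Pk: "(P \<circ> s \<circ> k) \<longlonglongrightarrow> p0" using lim[OF _ s0] s by auto
    obtain wn where wn: "\<And>n. wn n \<in> U" "\<And>n. P (s n) \<bullet> f (arc (s n)) (wn n) + r (arc (s n)) (wn n) \<le> 0"
    proof -
      have "\<forall>n. \<exists>w. w \<in> U \<and> P (s n) \<bullet> f (arc (s n)) w + r (arc (s n)) w \<le> 0"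
      proof
        fix n
        have "s n \<in> {0<..\<sigma>}" using s(1,2)[of n] by simp
        from gradient[OF this s(4)] show "\<exists>w. w \<in> U \<and> P (s n) \<bullet> f (arc (s n)) w + r (arc (s n)) w \<le> 0" by blast
      qed
      from choice[OF this] show ?thesis using that by blast
    qed
    obtain w j where w: "w \<in> U" and j: "strict_mono j" and wj: "((\<lambda>n. wn (k n)) \<circ> j) \<longlonglongrightarrow> w"
      using U_compact wn(1) unfolding compact_def by metis
    define i where "i n = k (j n)" for n
    have i: "strict_mono i" using k j by (simp add: i_def strict_mono_def)
    have si: "(\<lambda>n. s (i n)) \<longlonglongrightarrow> 0" using LIMSEQ_subseq_LIMSEQ[OF s0 i] by (simp add: comp_def)
    have Pi: "(\<lambda>n. P (s (i n))) \<longlonglongrightarrow> p0" using LIMSEQ_subseq_LIMSEQ[OF Pk j] by (simp add: comp_def i_def)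
    have wi: "(\<lambda>n. wn (i n)) \<longlonglongrightarrow> w" using wj by (simp add: comp_def i_def)
    have ai: "(\<lambda>n. arc (s (i n))) \<longlonglongrightarrow> x"
    proof -
      have "continuous_on {0..\<sigma>} arc" by (rule lipschitz_on_continuous_on[OF lip])
      moreover have "\<forall>\<^sub>F n in sequentially. s (i n) \<in> {0..\<sigma>}"
        using s(1,2) by (auto intro!: always_eventually less_imp_le[OF s(1)])
      ultimately show ?thesis using continuous_on_tendsto_compose[OF _ si] \<sigma> arc0 by fastforce
    qed
    have pair: "(\<lambda>n. (arc (s (i n)), wn (i n))) \<longlonglongrightarrow> (x, w)" by (rule tendsto_Pair[OF ai wi])
    have fl: "(\<lambda>n. f (arc (s (i n))) (wn (i n))) \<longlonglongrightarrow> f x w"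
      using continuous_on_tendsto_compose[OF f_cont pair] w wn(1) by simp
    have rl: "(\<lambda>n. r (arc (s (i n))) (wn (i n))) \<longlonglongrightarrow> r x w"
      using continuous_on_tendsto_compose[OF r_cont pair] w wn(1) by simp
    have "p0 \<bullet> f x w + r x w \<le> 0"
      by (rule LIMSEQ_le_const2[OF tendsto_add[OF tendsto_inner[OF Pi fl] rl]]) (use wn(2) in auto)
    then show False using strict[OF w] by simp
  qed
  then obtain \<sigma>' where \<sigma>': "\<sigma>' > 0" "\<sigma>' \<le> \<sigma>" and sing: "\<And>s. s \<in> {0<..\<sigma>'} \<Longrightarrow> \<not> V differentiable (at (arc s))" by blast
  show ?thesis
  proof (rule that[of \<sigma>' K' arc])
    show "\<sigma>' > 0" "arc 0 = x" by fact+
    show "K'-lipschitz_on {0..\<sigma>'} arc" by (rule lipschitz_on_subset[OF lip]) (use \<sigma>' in auto)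
    fix s assume s: "s \<in> {0<..\<sigma>'}"
    then have "arc s \<noteq> x" "arc s \<in> cball x R" using arc[of s] \<sigma>' by auto
    moreover from this have "arc s \<notin> S" using R(3) by blast
    ultimately show "arc s \<in> singular_set S V - {x}" using sing[OF s] by (simp add: singular_set_def)
  qed
qed

section \<open>Differentiability along optimal trajectories\<close>

text \<open>With the control kept, subtracting the running cost carries points of the hypograph near
  \<open>(x, V x)\<close> to points near \<open>(y t, V (y t))\<close>, and dynamic programming
  keeps them in the hypograph. So the adjoint of the linearised flow pulls \<open>v\<close> back to
  a horizontal normal at \<open>x\<close>, and this adjoint is injective.\<close>

lemma horizon_superdiff_pullback:
  assumes y: "traj x u y" and "0 \<le> t" and out: "\<And>s. 0 \<le> s \<Longrightarrow> s \<le> t \<Longrightarrow> y s \<notin> S"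
    and opt: "rcost u y t + V (y t) \<le> V x"
    and nh: "horizon_superdiff S V x \<subseteq> {0}" and v: "v \<in> horizon_superdiff S V (y t)"
  shows "v = 0"
proof -
  obtain M q where M: "linear M" "\<And>h. norm (M h) \<le> exp (L * t) * norm h" "\<And>h. norm h \<le> exp (L * t) * norm (M h)"
    and lin1: "\<And>x' y'. traj x' u y' \<Longrightarrow> norm (y' t - y t - M (x' - x)) \<le> lin_const t * (norm (x' - x))\<^sup>2"
    and lin2: "\<And>x' y'. traj x' u y' \<Longrightarrow> \<bar>rcost u y' t - rcost u y t - q \<bullet> (x' - x)\<bar> \<le> lin_const t * (norm (x' - x))\<^sup>2"
    using flow_linearization[OF y \<open>0 \<le> t\<close> order_refl] by metis
  define e where "e = exp (L * t)"
  have "e > 0" by (simp add: e_def)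
  define lc where "lc = lin_const t"
  have lc: "lc \<ge> 0" unfolding lc_def by (rule lin_const_nonneg[OF \<open>0 \<le> t\<close>])
  obtain \<sigma> where \<sigma>: "\<sigma> \<ge> 0" and vn: "\<And>z \<beta>. z \<in> closure (- S) \<Longrightarrow> \<beta> \<le> V z \<Longrightarrow> - v \<bullet> (z - y t) \<le> \<sigma> * ((norm (z - y t))\<^sup>2 + (\<beta> - V (y t))\<^sup>2)"
    using v unfolding horizon_superdiff_def mem_Collect_eq mem_proximal_normal_cone_hypo by auto
  have "compact (y ` {0..t})"
    by (intro compact_continuous_image continuous_on_subset[OF traj_continuous[OF y]]) auto
  moreover have "y ` {0..t} \<inter> S = {}" using out by auto
  \<comment> \<open>A positive distance from the target keeps the perturbed trajectories outside up
    to time \<open>t\<close>, as dynamic programming requires.\<close>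
  ultimately obtain d where "d > 0" and d: "\<And>a b. a \<in> y ` {0..t} \<Longrightarrow> b \<in> S \<Longrightarrow> d \<le> dist a b"
    using separate_compact_closed S_closed by metis
  define \<delta> where "\<delta> = min 1 (d / (2 * e))"
  have \<delta>: "\<delta> > 0" using \<open>d > 0\<close> \<open>e > 0\<close> by (simp add: \<delta>_def)
  define Q where "Q = norm q + lc"
  define C where "C = \<sigma> * (e\<^sup>2 + 2 * Q\<^sup>2 + 2) + norm v * lc"
  have C: "C \<ge> 0" using \<sigma> lc by (simp add: C_def)
  have "normal_at C \<delta> x (adjoint M v) 0 0"
    unfolding normal_at_def
  proof (intro allI impI)
    fix h a assume h: "norm h \<le> \<delta>" "\<bar>a\<bar> \<le> \<delta>" and hyp: "V x + a \<le> V (x + h)"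
    obtain y' where y': "traj (x + h) u y'" using traj_exists[OF traj_control[OF y]] .
    have close: "norm (y' s - y s) \<le> e * norm h" if "0 \<le> s" "s \<le> t" for s
      using traj_dependence[OF y y' that] by (simp add: e_def mult.commute)
    have "norm h \<le> d / (2 * e)" using h(1) by (simp add: \<delta>_def)
    then have "e * norm h < d" using \<open>e > 0\<close> \<open>d > 0\<close> by (simp add: pos_le_divide_eq mult_ac)
    then have out': "y' s \<notin> S" if "0 \<le> s" "s \<le> t" for s
      using close[OF that] d[of "y s" "y' s"] that by (force simp: dist_norm norm_minus_commute)
    have dp: "V (x + h) \<le> rcost u y' t + V (y' t)"
      using dynamic_programming[OF y' order_refl \<open>0 \<le> t\<close>] out' traj_0[OF y'] by simp
    define z where "z = y' t"
    \<comment> \<open>The image of the height \<open>V x + a\<close>. As \<open>v\<close> is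
      horizontal, heights enter the inequality only quadratically.\<close>
    define \<beta> where "\<beta> = V x + a - rcost u y' t"
    have "z \<in> closure (- S)" using out'[of t] \<open>0 \<le> t\<close> closure_subset[of "- S"] by (auto simp: z_def)
    moreover have "\<beta> \<le> V z" using hyp dp by (simp add: \<beta>_def z_def)
    ultimately have 1: "- v \<bullet> (z - y t) \<le> \<sigma> * ((norm (z - y t))\<^sup>2 + (\<beta> - V (y t))\<^sup>2)" by (rule vn)
    \<comment> \<open>Equality is where optimality is used: it makes
      \<open>\<beta> - V (y t)\<close> small of the order of \<open>norm h\<close> and
      \<open>a\<close>.\<close>
    have Vx: "V x = rcost u y t + V (y t)"
      using dynamic_programming[OF y order_refl \<open>0 \<le> t\<close>] out traj_0[OF y] opt by fastforce
    define b where "b = rcost u y' t - rcost u y t"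
    have \<beta>: "\<beta> - V (y t) = a - b" by (simp add: \<beta>_def Vx b_def)
    have h1: "norm h \<le> 1" using h(1) by (simp add: \<delta>_def)
    have "lc * (norm h)\<^sup>2 \<le> lc * norm h" using lc h1 by (intro mult_left_mono) (auto simp: power2_eq_square mult_left_le)
    moreover have "\<bar>q \<bullet> h\<bar> \<le> norm q * norm h" by (rule Cauchy_Schwarz_ineq2)
    moreover have "\<bar>b - q \<bullet> h\<bar> \<le> lc * (norm h)\<^sup>2" using lin2[OF y'] by (simp add: b_def lc_def)
    ultimately have "\<bar>b\<bar> \<le> Q * norm h" unfolding Q_def distrib_right by linarith
    then have "\<bar>b\<bar>\<^sup>2 \<le> (Q * norm h)\<^sup>2" by (intro power_mono) auto
    then have b2: "b\<^sup>2 \<le> Q\<^sup>2 * (norm h)\<^sup>2" by (simp add: power_mult_distrib)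
    have "(a - b)\<^sup>2 \<le> 2 * a\<^sup>2 + 2 * b\<^sup>2"
      using zero_le_power2[of "a + b"] by (simp add: power2_eq_square algebra_simps)
    then have ab: "(a - b)\<^sup>2 \<le> 2 * a\<^sup>2 + 2 * (Q\<^sup>2 * (norm h)\<^sup>2)" using b2 by simp
    have zy: "(norm (z - y t))\<^sup>2 \<le> e\<^sup>2 * (norm h)\<^sup>2"
      using power_mono[OF close[OF \<open>0 \<le> t\<close> order_refl] norm_ge_zero, of 2] by (simp add: z_def power_mult_distrib)
    have "(norm (z - y t))\<^sup>2 + (\<beta> - V (y t))\<^sup>2 \<le> (e\<^sup>2 + 2 * Q\<^sup>2 + 2) * ((norm h)\<^sup>2 + a\<^sup>2)"
    proof -
      have "0 \<le> (e\<^sup>2 + 2 * Q\<^sup>2) * a\<^sup>2 + 2 * (norm h)\<^sup>2" by simp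
      moreover have "(e\<^sup>2 + 2 * Q\<^sup>2 + 2) * ((norm h)\<^sup>2 + a\<^sup>2)
          = e\<^sup>2 * (norm h)\<^sup>2 + (2 * a\<^sup>2 + 2 * (Q\<^sup>2 * (norm h)\<^sup>2)) + ((e\<^sup>2 + 2 * Q\<^sup>2) * a\<^sup>2 + 2 * (norm h)\<^sup>2)"
        by (simp add: algebra_simps)
      ultimately show ?thesis using zy ab unfolding \<beta> by linarith
    qed
    then have 2: "\<sigma> * ((norm (z - y t))\<^sup>2 + (\<beta> - V (y t))\<^sup>2) \<le> \<sigma> * ((e\<^sup>2 + 2 * Q\<^sup>2 + 2) * ((norm h)\<^sup>2 + a\<^sup>2))"
      using \<sigma> by (rule mult_left_mono)
    have "\<bar>v \<bullet> (z - y t - M h)\<bar> \<le> norm v * norm (z - y t - M h)" by (rule Cauchy_Schwarz_ineq2)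
    also have "\<dots> \<le> norm v * (lc * (norm h)\<^sup>2)" using lin1[OF y'] by (intro mult_left_mono) (auto simp: z_def lc_def)
    also have "\<dots> \<le> norm v * lc * ((norm h)\<^sup>2 + a\<^sup>2)" using lc by (simp add: mult_left_mono mult.assoc)
    finally have 3: "\<bar>v \<bullet> (z - y t - M h)\<bar> \<le> norm v * lc * ((norm h)\<^sup>2 + a\<^sup>2)" .
    have "adjoint M v \<bullet> h = v \<bullet> M h" using adjoint_works[OF M(1), of h v] by (simp add: inner_commute)
    moreover have "v \<bullet> (z - y t - M h) = v \<bullet> (z - y t) - v \<bullet> M h" by (simp add: inner_diff_right)
    moreover have "C * ((norm h)\<^sup>2 + a\<^sup>2) = \<sigma> * ((e\<^sup>2 + 2 * Q\<^sup>2 + 2) * ((norm h)\<^sup>2 + a\<^sup>2)) + norm v * lc * ((norm h)\<^sup>2 + a\<^sup>2)"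
      by (simp add: C_def distrib_right mult.assoc)
    ultimately show "0 * a - adjoint M v \<bullet> h \<le> C * ((norm h)\<^sup>2 + a\<^sup>2 + 0)"
      using 1 2 3 by (simp add: abs_le_iff)
  qed
  then have "adjoint M v \<in> horizon_superdiff S V x" by (rule horizon_superdiffI[OF _ \<delta> C])
  then have "adjoint M v = 0" using nh by blast
  then show "v = 0" using adjoint_bounds(2)[OF M exp_gt_zero, of v] by simp
qed

theorem differentiable_along_optimal_trajectory:
  assumes x: "x \<in> - S - singular_set_inf S V" and opt: "optimal_trajectory U S f r g x y"
    and t: "0 < t" "ereal t < exit_time S y"
  shows "V differentiable (at (y t))"
proof (rule ccontr)
  assume nd: "\<not> V differentiable (at (y t))"
  obtain u where adm: "admissible U S f x u y" and cost: "ereal (cost S r g u y) = value_function U S f r g x"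
    using opt by (auto simp: optimal_trajectory_def)
  obtain \<tau> where y: "traj x u y" and \<tau>: "0 \<le> \<tau>" "y \<tau> \<in> S" and out: "\<And>\<sigma>. 0 \<le> \<sigma> \<Longrightarrow> \<sigma> < \<tau> \<Longrightarrow> y \<sigma> \<notin> S"
    and ex: "exit_time S y = ereal \<tau>" and c: "cost S r g u y = rcost u y \<tau> + g (y \<tau>)"
    using admissibleE[OF adm] by metis
  have "t < \<tau>" using t ex by simp
  have Vx: "V x = rcost u y \<tau> + g (y \<tau>)" using cost c by (simp add: value_eq)
  have dp: "V (y s) \<le> rcost u y t - rcost u y s + V (y t)" if "0 \<le> s" "s \<le> t" for s
    by (rule dynamic_programming[OF y that]) (use out \<open>t < \<tau>\<close> that in auto)
  have dp\<tau>: "V (y t) \<le> rcost u y \<tau> - rcost u y t + g (y \<tau>)"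
    using dynamic_programming[OF y, of t \<tau>] out t \<open>t < \<tau>\<close> V_on_S[OF \<tau>(2)] by simp
  \<comment> \<open>Optimality of the whole trajectory passes to its pieces, because dynamic
    programming loses nothing before \<open>s\<close> or after \<open>t\<close>.\<close>
  have opt_t: "rcost u y t - rcost u y s + V (y t) \<le> V (y s)" if "0 \<le> s" "s \<le> t" for s
  proof -
    have "V x \<le> rcost u y s + V (y s)"
      using dynamic_programming[OF y order_refl that(1)] out that \<open>t < \<tau>\<close> traj_0[OF y] by simp
    then show ?thesis using Vx dp\<tau> by simp
  qed
  have yt: "y t \<notin> S" using out t \<open>t < \<tau>\<close> by simp
  have nhx: "horizon_superdiff S V x \<subseteq> {0}" using x by (auto simp: singular_set_inf_def)
  have "horizon_superdiff S V (y t) \<subseteq> {0}"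
  proof
    fix v assume v: "v \<in> horizon_superdiff S V (y t)"
    have "v = 0"
      by (rule horizon_superdiff_pullback[OF y _ _ _ nhx v])
        (use t out \<open>t < \<tau>\<close> opt_t[of 0] traj_0[OF y] in auto)
    then show "v \<in> {0}" by simp
  qed
  then obtain R K C where R: "R > 0" "C \<ge> 0" "cball (y t) R \<inter> S = {}"
    and semi: "\<And>z. z \<in> cball (y t) R \<Longrightarrow> \<exists>p. norm p \<le> K \<and> supergrad_on V (cball (y t) R) C z p"
    using locally_semiconcave_value[OF yt] by metis
  obtain p where p: "supergrad_on V (cball (y t) R) C (y t) p" and strict: "\<And>w. w \<in> U \<Longrightarrow> 0 < p \<bullet> f (y t) w + r (y t) w"
    using interior_supergradient_of_singular_point[OF yt nd R(1,2) semi] by metis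
  obtain w where "w \<in> U" "p \<bullet> f (y t) w + r (y t) w \<le> 0"
    using optimal_trajectory_rate_nonpos[OF y t(1) opt_t p R(1,2)] by metis
  then show False using strict by force
qed

end

theorem theorem5p7:
  fixes U :: "(real ^ 'm) set"
    and S :: "(real ^ 'd) set"
    and f :: "real ^ 'd \<Rightarrow> real ^ 'm \<Rightarrow> real ^ 'd"
    and r :: "real ^ 'd \<Rightarrow> real ^ 'm \<Rightarrow> real"
    and g :: "real ^ 'd \<Rightarrow> real"
    and V :: "real ^ 'd \<Rightarrow> real"
    and N L r0 \<rho>0 :: real
  assumes "U \<noteq> {}" and "compact U"
    and "S \<noteq> {}" and "closed S"
    and "N > 0" and "L > 0" and "r0 > 0" and "\<rho>0 > 0"
    and "convexity_hyp U f r"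
    and "dynamics_hyp U f N L"
    and "running_cost_hyp U r L r0"
    and "terminal_cost_hyp S g N r0"
    and "inner_ball_hyp S \<rho>0"
    and "nondegenerate_hamiltonian_hyp U f r"
    and "locally_semiconcave g"
    and "\<And>x. value_function U S f r g x = ereal (V x)"
    and "continuous_on UNIV V"
  shows "(\<forall>x \<in> singular_set S V.
            dim_union (proximal_superdiff S V x) (horizon_superdiff S V x) < int CARD('d) \<longrightarrow>
            (\<exists>\<sigma>>0. \<exists>xbar :: real \<Rightarrow> real ^ 'd.
               (\<exists>K. K-lipschitz_on {0..\<sigma>} xbar) \<and> xbar 0 = x \<and>
               (\<forall>s \<in> {0<..\<sigma>}. xbar s \<in> singular_set S V - {x}))) \<and>
         (\<forall>x \<in> - S - singular_set_inf S V.
            \<forall>y. optimal_trajectory U S f r g x y \<longrightarrow>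
              (\<forall>t>0. ereal t < exit_time S y \<longrightarrow> V differentiable (at (y t))))"
proof -
  note hyps = assms
  obtain Df :: "real ^ 'd \<Rightarrow> real ^ 'm \<Rightarrow> (real ^ 'd) \<Rightarrow>\<^sub>L (real ^ 'd)" where Df:
      "\<And>x \<omega>. \<omega> \<in> U \<Longrightarrow> ((\<lambda>z. f z \<omega>) has_derivative blinfun_apply (Df x \<omega>)) (at x)"
      "continuous_on (UNIV \<times> U) (\<lambda>(x, \<omega>). Df x \<omega>)"
      "\<And>x y \<omega>. \<omega> \<in> U \<Longrightarrow> norm (Df y \<omega> - Df x \<omega>) \<le> L * norm (y - x)"
    using \<open>dynamics_hyp U f N L\<close> unfolding dynamics_hyp_def by metis
  have f: "continuous_on (UNIV \<times> U) (\<lambda>(x, \<omega>). f x \<omega>)"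
      "\<And>x \<omega>. \<omega> \<in> U \<Longrightarrow> norm (f x \<omega>) < N"
      "\<And>x y \<omega>. \<omega> \<in> U \<Longrightarrow> norm (f y \<omega> - f x \<omega>) \<le> L * norm (y - x)"
    using \<open>dynamics_hyp U f N L\<close> unfolding dynamics_hyp_def by blast+
  obtain Dr :: "real ^ 'd \<Rightarrow> real ^ 'm \<Rightarrow> (real ^ 'd) \<Rightarrow>\<^sub>L real" where Dr:
      "\<And>x \<omega>. \<omega> \<in> U \<Longrightarrow> ((\<lambda>z. r z \<omega>) has_derivative blinfun_apply (Dr x \<omega>)) (at x)"
      "continuous_on (UNIV \<times> U) (\<lambda>(x, \<omega>). Dr x \<omega>)"
      "\<And>x y \<omega>. \<omega> \<in> U \<Longrightarrow> \<bar>r y \<omega> - r x \<omega>\<bar> + norm (Dr y \<omega> - Dr x \<omega>) \<le> L * norm (y - x)"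
    using \<open>running_cost_hyp U r L r0\<close> unfolding running_cost_hyp_def by metis
  have r: "continuous_on (UNIV \<times> U) (\<lambda>(x, \<omega>). r x \<omega>)" "\<And>x \<omega>. \<omega> \<in> U \<Longrightarrow> r0 \<le> r x \<omega>"
    using \<open>running_cost_hyp U r L r0\<close> unfolding running_cost_hyp_def by blast+
  have r_lip: "\<bar>r y \<omega> - r x \<omega>\<bar> \<le> L * norm (y - x)" "norm (Dr y \<omega> - Dr x \<omega>) \<le> L * norm (y - x)"
    if "\<omega> \<in> U" for x y \<omega>
    using Dr(3)[OF that, of y x] norm_ge_zero[of "Dr y \<omega> - Dr x \<omega>"] by linarith+
  obtain W G where W: "open W" "frontier S \<subseteq> W" "0 \<le> G" "G < r0 / N"
      "\<And>x y. x \<in> W \<Longrightarrow> y \<in> W \<Longrightarrow> \<bar>g y - g x\<bar> \<le> G * norm (y - x)"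
    using \<open>terminal_cost_hyp S g N r0\<close> unfolding terminal_cost_hyp_def by metis
  have "G * N < r0" using W(4) \<open>N > 0\<close> by (simp add: pos_less_divide_eq)
  have inner: "\<exists>\<xi>. norm \<xi> = 1 \<and> (\<forall>y\<in>closure (- S). \<xi> \<bullet> (y - x) \<le> 1 / (2 * \<rho>0) * (norm (y - x))\<^sup>2)"
    if "x \<in> frontier S" for x
    using \<open>inner_ball_hyp S \<rho>0\<close> that unfolding inner_ball_hyp_def by blast
  interpret exit_time_problem U S f r g V N L r0 "1 / (2 * \<rho>0)" G W Df Dr
    by unfold_locales (fact hyps | fact f | fact Df | fact r | fact r_lip | fact Dr | fact W | fact inner
        | fact \<open>G * N < r0\<close> | rule less_imp_le, fact f | simp add: \<open>\<rho>0 > 0\<close> less_imp_le)+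
  show ?thesis
  proof (intro conjI ballI impI allI)
    fix x assume x: "x \<in> singular_set S V"
      and dim: "dim_union (proximal_superdiff S V x) (horizon_superdiff S V x) < int CARD('d)"
    have d: "dim_union (proximal_superdiff S V x) (horizon_superdiff S V x) < int DIM(real ^ 'd)"
      using dim by simp
    show "\<exists>\<sigma>>0. \<exists>xbar :: real \<Rightarrow> real ^ 'd. (\<exists>K. K-lipschitz_on {0..\<sigma>} xbar) \<and> xbar 0 = x \<and>
        (\<forall>s \<in> {0<..\<sigma>}. xbar s \<in> singular_set S V - {x})"
      by (rule singularities_propagate[OF x d]) blast
  next
    fix x y and t :: real
    assume "x \<in> - S - singular_set_inf S V" "optimal_trajectory U S f r g x y" "0 < t" "ereal t < exit_time S y"
    then show "V differentiable (at (y t))" by (rule differentiable_along_optimal_trajectory)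
  qed
qed

end
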